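(* Let $a,b,c,d,\alpha,\beta,\gamma,\delta>0$ with $\frac{\beta\gamma}{\alpha\delta}<1<\frac{bc}{ad}$ and let $N\ge1$. Consider the $2\times2$-periodic lozenge tilings of a hexagon, i.e. the model $\mathbb P_n$ defined in the context. As $n\to\infty$, the bottom part of the hexagon converges to a determinantal point process with correlation kernel $K$; that is, for all distinct points $(4m_k,u_k)$, $k=1,\dots,\ell$, with $0<m_k<N$ and $u_k\in\mathbb Z$, $$\lim_{n\to\infty}\mathbb P_n\big(\text{points at }(4m_k,u_k),\ k=1,\dots,\ell\big)=\det\big(K(4m_k,u_k;4m_l,u_l)\big)_{k,l=1}^{\ell},$$ where for $x,x'\in\mathbb Z$ and $0<m,m'<N$ (row index $i$, column index $j$) $$\left[K(4m,2x+j;4m',2x'+i)\right]_{i,j=0}^{1}=-\frac{\chi_{m>m'}}{2\pi\mathrm i}\oint_{|z|=1}A(z)^{m-m'}B(z)^{m-m'}z^{x'-x}\frac{dz}{z}-\frac1{(2\pi\mathrm i)^2}\int_{\gamma_{0,\frac{ad}{bc}}}\int_{\gamma_0}A(w)^{N-m'}B(w)^{-m'}A(z)^{m-N}B(z)^m\frac{w^{x'}}{z^{x+1}}\frac{dz\,dw}{z-w}$$ ($z\in\gamma_0$, $w\in\gamma_{0,\frac{ad}{bc}}$ in the double integral). Here $$A(z)=\begin{pmatrix} \mu^{1/2} & 0 \\ 0 & \mu^{-1/2} \end{pmatrix}\begin{pmatrix} \alpha & \gamma \\ \beta z & \delta \end{pmatrix}\begin{pmatrix} \nu^{1/2} & 0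 \\ 0 & \nu^{-1/2} \end{pmatrix}\begin{pmatrix} \alpha & \beta \\ \gamma z & \delta \end{pmatrix},$$ $$B(z)=\begin{pmatrix} a & b \\ c z & d \end{pmatrix}\begin{pmatrix} \nu^{-1/2} & 0 \\ 0 & \nu^{1/2} \end{pmatrix}\begin{pmatrix} a & c \\ b z & d \end{pmatrix}\begin{pmatrix} \mu^{-1/2} & 0 \\ 0 & \mu^{1/2} \end{pmatrix},$$ $$\mu=\frac{a\beta+b\delta}{c\alpha+d\gamma},\qquad \nu=\frac{a\gamma+c\delta}{b\alpha+d\beta},$$ $\gamma_0$ is a positively oriented simple closed curve around $0$ with $\frac{\alpha\delta}{\beta\gamma}$ in its exterior, and $\gamma_{0,\frac{ad}{bc}}$ is a positively oriented simple closed curve around $\gamma_0$ and $\frac{ad}{bc}$.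
   Context: The model. For $m=1,\dots,4N$ let $$\phi_m(z)=\begin{pmatrix} a & b \\ c z & d \end{pmatrix}\ (m\text{ odd}),\qquad \phi_m(z)=\begin{pmatrix} \alpha & \beta \\ \gamma z & \delta \end{pmatrix}\ (m\text{ even}),$$ write $\phi_m(z)=\sum_k\hat\phi_m(k)z^k$ and let $T_{\phi_m}(2x+r,2y+s)=(\hat\phi_m(y-x))_{r+1,s+1}$, $r,s\in\{0,1\}$, $x,y\in\mathbb Z$, be the associated $2\times2$-block Toeplitz matrix. For $n\ge1$, $\mathbb P_n$ is the probability measure on point configurations $\{(m,u_m^j)\}_{1\le m\le4N-1,\,1\le j\le2n}$ in $\{1,\dots,4N-1\}\times\mathbb Z$ proportional to $$\prod_{m=1}^{4N}\det\left(T_{\phi_m}(u_{m-1}^j,u_m^k)\right)_{j,k=1}^{2n},\qquad u_0^j=j-1,\quad u_{4N}^j=2N+j-1 .$$ This is the law of the $2n$ non-intersecting up-right paths encoding lozenge tilings of a hexagon with vertical sides of length $2n$, with weights that are two-periodic in both directions; "bottom part" means that heights are kept fixed as $n\to\infty$. $\chi_{m>m'}=1$ if $m>m'$ and $0$ otherwise. *)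

theory Defs
  imports
    "HOL-Complex_Analysis.Complex_Analysis"
    "Jordan_Normal_Form.Determinant"
    "Jordan_Normal_Form.Gauss_Jordan_Elimination"
begin

text \<open>Square matrices are those of \<^theory>\<open>Jordan_Normal_Form.Matrix\<close>; their row and column indices
  start at 0, so the index pair \<open>(r + 1, s + 1)\<close> of the usual convention is \<open>(r, s)\<close> here.\<close>

definition mat2 :: "'a \<Rightarrow> 'a \<Rightarrow> 'a \<Rightarrow> 'a \<Rightarrow> 'a mat" where
  "mat2 p q r s = mat_of_rows_list 2 [[p, q], [r, s]]"


text \<open>The symbols are polynomial in \<open>z\<close>; \<open>[:0, c:]\<close> is the polynomial \<open>c z\<close>.\<close>

definition symbol ::
  "real \<Rightarrow> real \<Rightarrow> real \<Rightarrow> real \<Rightarrow> real \<Rightarrow> real \<Rightarrow> real \<Rightarrow> real \<Rightarrow> nat \<Rightarrow> real poly mat" where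
  "symbol a b c d \<alpha> \<beta> \<gamma> \<delta> m =
     (if odd m then mat2 [:a:] [:b:] [:0, c:] [:d:] else mat2 [:\<alpha>:] [:\<beta>:] [:0, \<gamma>:] [:\<delta>:])"

definition fourier_coeff :: "real poly mat \<Rightarrow> int \<Rightarrow> real mat" where
  "fourier_coeff \<phi> k =
     Matrix.mat 2 2 (\<lambda>(r, s). if k < 0 then 0 else coeff (\<phi> $$ (r, s)) (nat k))"

text \<open>An index \<open>u = 2x + r\<close> with \<open>r \<in> {0, 1}\<close> has \<open>x = u div 2\<close> and \<open>r = u mod 2\<close>, also for negative \<open>u\<close>.\<close>

definition block_toeplitz :: "real poly mat \<Rightarrow> int \<Rightarrow> int \<Rightarrow> real" where
  "block_toeplitz \<phi> u v =
     fourier_coeff \<phi> (v div 2 - u div 2) $$ (nat (u mod 2), nat (v mod 2))"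

text \<open>A point configuration is the set of its points \<open>(m, u)\<close>, with exactly \<open>2n\<close> points on each level
  \<open>m = 1, \<dots>, 4N - 1\<close>.  (Families with \<open>u\<^sub>m\<^sup>j = u\<^sub>m\<^sup>k\<close> for some \<open>j \<noteq> k\<close> have weight 0.)\<close>

definition configurations :: "nat \<Rightarrow> nat \<Rightarrow> (nat \<times> int) set set" where
  "configurations N n =
     {C. finite C \<and> C \<subseteq> {0<..<4 * N} \<times> UNIV \<and> (\<forall>m \<in> {0<..<4 * N}. card {u. (m, u) \<in> C} = 2 * n)}"

definition level :: "nat \<Rightarrow> nat \<Rightarrow> (nat \<times> int) set \<Rightarrow> nat \<Rightarrow> int set" where
  "level N n C m =
     (if m = 0 then {0..<2 * int n}
      else if m = 4 * N then {2 * int N..<2 * int N + 2 * int n}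
      else {u. (m, u) \<in> C})"

text \<open>The points of a level are enumerated increasingly.  On the levels strictly between 0 and \<open>4N\<close> the
  enumeration is immaterial, since a permutation there changes the sign of two of the factors.\<close>

definition position :: "nat \<Rightarrow> nat \<Rightarrow> (nat \<times> int) set \<Rightarrow> nat \<Rightarrow> nat \<Rightarrow> int" where
  "position N n C m j = sorted_list_of_set (level N n C m) ! j"

definition weight ::
  "real \<Rightarrow> real \<Rightarrow> real \<Rightarrow> real \<Rightarrow> real \<Rightarrow> real \<Rightarrow> real \<Rightarrow> real \<Rightarrow> nat \<Rightarrow> nat
    \<Rightarrow> (nat \<times> int) set \<Rightarrow> real" where
  "weight a b c d \<alpha> \<beta> \<gamma> \<delta> N n C =
     (\<Prod>m = 1..4 * N.
        Determinant.det (Matrix.mat (2 * n) (2 * n) (\<lambda>(j, k).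
          block_toeplitz (symbol a b c d \<alpha> \<beta> \<gamma> \<delta> m)
            (position N n C (m - 1) j) (position N n C m k))))"

text \<open>For positive parameters all weights are nonnegative (the block Toeplitz matrices are bidiagonal with
  nonnegative entries, hence totally nonnegative), so \<^const>\<open>ennreal\<close> does not truncate anything.\<close>

definition weight_measure ::
  "real \<Rightarrow> real \<Rightarrow> real \<Rightarrow> real \<Rightarrow> real \<Rightarrow> real \<Rightarrow> real \<Rightarrow> real \<Rightarrow> nat \<Rightarrow> nat
    \<Rightarrow> (nat \<times> int) set measure" where
  "weight_measure a b c d \<alpha> \<beta> \<gamma> \<delta> N n =
     density (count_space (configurations N n)) (\<lambda>C. ennreal (weight a b c d \<alpha> \<beta> \<gamma> \<delta> N n C))"

text \<open>\<^const>\<open>uniform_measure\<close> over the whole space divides a measure by its total mass; the result is the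
  probability measure proportional to the weights, not the uniform distribution on configurations.\<close>

definition hexagon_measure ::
  "real \<Rightarrow> real \<Rightarrow> real \<Rightarrow> real \<Rightarrow> real \<Rightarrow> real \<Rightarrow> real \<Rightarrow> real \<Rightarrow> nat \<Rightarrow> nat
    \<Rightarrow> (nat \<times> int) set measure" where
  "hexagon_measure a b c d \<alpha> \<beta> \<gamma> \<delta> N n =
     uniform_measure (weight_measure a b c d \<alpha> \<beta> \<gamma> \<delta> N n) (configurations N n)"

definition mu_par :: "real \<Rightarrow> real \<Rightarrow> real \<Rightarrow> real \<Rightarrow> real \<Rightarrow> real \<Rightarrow> real \<Rightarrow> real \<Rightarrow> real" where
  "mu_par a b c d \<alpha> \<beta> \<gamma> \<delta> = (a * \<beta> + b * \<delta>) / (c * \<alpha> + d * \<gamma>)"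

definition nu_par :: "real \<Rightarrow> real \<Rightarrow> real \<Rightarrow> real \<Rightarrow> real \<Rightarrow> real \<Rightarrow> real \<Rightarrow> real \<Rightarrow> real" where
  "nu_par a b c d \<alpha> \<beta> \<gamma> \<delta> = (a * \<gamma> + c * \<delta>) / (b * \<alpha> + d * \<beta>)"

definition A_mat ::
  "real \<Rightarrow> real \<Rightarrow> real \<Rightarrow> real \<Rightarrow> real \<Rightarrow> real \<Rightarrow> real \<Rightarrow> real \<Rightarrow> complex \<Rightarrow> complex mat" where
  "A_mat a b c d \<alpha> \<beta> \<gamma> \<delta> z =
     (let \<mu> = mu_par a b c d \<alpha> \<beta> \<gamma> \<delta>; \<nu> = nu_par a b c d \<alpha> \<beta> \<gamma> \<delta> in
        mat2 (of_real (\<mu> powr (1/2))) 0 0 (of_real (\<mu> powr (-1/2)))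
      * mat2 (of_real \<alpha>) (of_real \<gamma>) (of_real \<beta> * z) (of_real \<delta>)
      * mat2 (of_real (\<nu> powr (1/2))) 0 0 (of_real (\<nu> powr (-1/2)))
      * mat2 (of_real \<alpha>) (of_real \<beta>) (of_real \<gamma> * z) (of_real \<delta>))"

definition B_mat ::
  "real \<Rightarrow> real \<Rightarrow> real \<Rightarrow> real \<Rightarrow> real \<Rightarrow> real \<Rightarrow> real \<Rightarrow> real \<Rightarrow> complex \<Rightarrow> complex mat" where
  "B_mat a b c d \<alpha> \<beta> \<gamma> \<delta> z =
     (let \<mu> = mu_par a b c d \<alpha> \<beta> \<gamma> \<delta>; \<nu> = nu_par a b c d \<alpha> \<beta> \<gamma> \<delta> in
        mat2 (of_real a) (of_real b) (of_real c * z) (of_real d)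
      * mat2 (of_real (\<nu> powr (-1/2))) 0 0 (of_real (\<nu> powr (1/2)))
      * mat2 (of_real a) (of_real c) (of_real b * z) (of_real d)
      * mat2 (of_real (\<mu> powr (-1/2))) 0 0 (of_real (\<mu> powr (1/2))))"

definition mat_powi :: "'a::field mat \<Rightarrow> int \<Rightarrow> 'a mat" where
  "mat_powi M k =
     (if k \<ge> 0 then M ^\<^sub>m nat k else the (mat_inverse M) ^\<^sub>m nat (- k))"

definition positive_simple_closed_curve :: "(real \<Rightarrow> complex) \<Rightarrow> bool" where
  "positive_simple_closed_curve g \<longleftrightarrow>
     valid_path g \<and> simple_path g \<and> pathfinish g = pathstart g \<and>
     (\<forall>z \<in> inside (path_image g). winding_number g z = 1)"

text \<open>The \<open>2 \<times> 2\<close> block \<open>[K(4m, 2x + j; 4m', 2x' + i)]\<close>, \<open>i\<close> being the row and \<open>j\<close> the column index.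
  In the double integral \<open>z\<close> runs over \<open>g0\<close> and \<open>w\<close> over \<open>g1\<close>.\<close>

definition kernel_block ::
  "real \<Rightarrow> real \<Rightarrow> real \<Rightarrow> real \<Rightarrow> real \<Rightarrow> real \<Rightarrow> real \<Rightarrow> real \<Rightarrow> nat
    \<Rightarrow> (real \<Rightarrow> complex) \<Rightarrow> (real \<Rightarrow> complex) \<Rightarrow> nat \<Rightarrow> int \<Rightarrow> nat \<Rightarrow> int \<Rightarrow> complex mat" where
  "kernel_block a b c d \<alpha> \<beta> \<gamma> \<delta> N g0 g1 m x m' x' =
     (let A = A_mat a b c d \<alpha> \<beta> \<gamma> \<delta>; B = B_mat a b c d \<alpha> \<beta> \<gamma> \<delta> in
      Matrix.mat 2 2 (\<lambda>(i, j).
        - (of_bool (m > m') / (2 * of_real pi * \<i>)) *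
          contour_integral (circlepath 0 1) (\<lambda>z.
            (mat_powi (A z) (int m - int m') * mat_powi (B z) (int m - int m')) $$ (i, j)
              * z powi (x' - x) / z)
        - 1 / (2 * of_real pi * \<i>)\<^sup>2 *
          contour_integral g1 (\<lambda>w. contour_integral g0 (\<lambda>z.
            (mat_powi (A w) (int N - int m') * mat_powi (B w) (- int m')
              * mat_powi (A z) (int m - int N) * mat_powi (B z) (int m)) $$ (i, j)
              * (w powi x' / z powi (x + 1)) / (z - w)))))"

text \<open>Only levels divisible by 4 are relevant: a point is \<open>(4m, 2x + j)\<close>.\<close>

definition limit_kernel ::
  "real \<Rightarrow> real \<Rightarrow> real \<Rightarrow> real \<Rightarrow> real \<Rightarrow> real \<Rightarrow> real \<Rightarrow> real \<Rightarrow> nat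
    \<Rightarrow> (real \<Rightarrow> complex) \<Rightarrow> (real \<Rightarrow> complex) \<Rightarrow> nat \<times> int \<Rightarrow> nat \<times> int \<Rightarrow> complex" where
  "limit_kernel a b c d \<alpha> \<beta> \<gamma> \<delta> N g0 g1 p q =
     kernel_block a b c d \<alpha> \<beta> \<gamma> \<delta> N g0 g1
       (fst p div 4) (snd p div 2) (fst q div 4) (snd q div 2)
       $$ (nat (snd q mod 2), nat (snd p mod 2))"

end

theory Submission
  imports Defs
begin

text \<open>
  By the Cauchy--Binet formula, giving an additional factor \<open>1 + t\<close> to each of the \<open>l\<close> marked points turns the total weight
  \<open>det G\<close> into the determinant of a finite-rank perturbation of \<open>G\<close>, which is \<open>det G * det (1 + t K)\<close> for a matrix \<open>K\<close> of
  size \<open>l\<close> involving \<open>G\<^sup>-\<^sup>1\<close>; the leading coefficient in \<open>t\<close> is the probability at finite \<open>n\<close>.  The Gram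
  matrix \<open>G\<close> is the finite section of a block Toeplitz matrix with symbol \<open>(A B / z)\<^sup>N\<close>.  Since \<open>A B = B A\<close>, where \<open>A\<close> is
  invertible inside and \<open>B / z\<close> outside the unit circle, the symbol has two Wiener--Hopf factorizations.  They yield an
  explicit inverse of the finite section up to an exponentially small error, so the entries of \<open>G\<^sup>-\<^sup>1\<close> converge to those
  of the inverse on the half-line.  Summing the resulting products of Laurent coefficients gives the contour integrals.
\<close>

section \<open>The Cauchy--Binet formula\<close>

text \<open>The parameter inequalities put the only zero of \<open>det A\<close> outside and that of
  \<open>det B\<close> inside the unit circle. This decides which factor is block upper and which
  block lower triangular. The shift of the end points by \<open>2 N\<close> supplies exactly the
  factor \<open>z^(-N)\<close> that makes \<open>(B / z)^N\<close> bounded and invertible at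
  infinity. The obstacle is that the symbol is matrix valued, so no factorization comes from a
  logarithm; it is the commutation of \<open>A\<close> and \<open>B\<close> that gives one in each
  order. Either order alone inverts the section well at one end only, and the perturbation argument
  needs a small error at both ends, which is why the two half-line inverses are combined. Marked
  points at fixed heights see only finitely many entries of the inverse near its corner
  \<open>(0, 0)\<close>, because a path of fixed length has bounded reach. Hence only the lower
  boundary survives in the limit, and all sums in the limiting kernel are finite. The same
  finiteness lets the contours be arbitrary simple closed curves: only winding numbers around 0 and
  the two zeros, and the position of \<open>w\<close> relative to the inner curve, enter.\<close>

definition enum :: "'a::linorder set \<Rightarrow> nat \<Rightarrow> 'a" where
  "enum S k = sorted_list_of_set S ! k"

lemma enum_bij:
  assumes "finite S" "card S = p"
  shows "bij_betw (enum S) {..<p} S"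
  unfolding enum_def
  using bij_betw_nth[of "sorted_list_of_set S" "{..<p}" S] assms by auto

lemma enum_less:
  assumes "finite S" "card S = p" "i < j" "j < p"
  shows "enum S i < enum S j"
  using sorted_wrt_nth_less[OF strict_sorted_list_of_set[of S], of i j] assms by (simp add: enum_def)

lemma enum_interval:
  assumes "k < p"
  shows "enum {h..<h + int p} k = h + int k"
proof -
  let ?xs = "map (\<lambda>i. h + int i) [0..<p]"
  have "x \<in> set ?xs" if "x \<in> {h..<h + int p}" for x
    using that by (auto intro!: image_eqI[of _ _ "nat (x - h)"])
  then have "set ?xs = {h..<h + int p}" by auto
  moreover have "sorted ?xs" "distinct ?xs" by (simp_all add: sorted_iff_nth_mono distinct_map inj_on_def)
  ultimately have "sorted_list_of_set {h..<h + int p} = ?xs"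
    using sorted_list_of_set.idem_if_sorted_distinct by metis
  then show ?thesis using assms by (simp add: enum_def)
qed

text \<open>Composing one enumeration of \<open>S\<close> with all permutations gives every
  injective selection with image \<open>S\<close> exactly once. \<open>restrict\<close> is needed
  because elements of an extensional function space are \<open>undefined\<close> outside
  \<open>{..<p}\<close>.\<close>

lemma card_inj_selections:
  fixes e :: "nat \<Rightarrow> 'a"
  assumes e: "bij_betw e {..<p} S"
  shows "bij_betw (\<lambda>\<sigma>. restrict (e \<circ> \<sigma>) {..<p}) {\<sigma>. \<sigma> permutes {..<p}}
           {f \<in> {..<p} \<rightarrow>\<^sub>E S. inj_on f {..<p} \<and> f ` {..<p} = S}"
proof (rule bij_betwI')
  have einj: "inj_on e {..<p}" and eim: "e ` {..<p} = S" using e by (auto simp: bij_betw_def)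
  fix \<sigma> \<tau> :: "nat \<Rightarrow> nat" assume s: "\<sigma> \<in> {\<sigma>. \<sigma> permutes {..<p}}" "\<tau> \<in> {\<sigma>. \<sigma> permutes {..<p}}"
  have "\<sigma> = \<tau>" if eq: "restrict (e \<circ> \<sigma>) {..<p} = restrict (e \<circ> \<tau>) {..<p}"
  proof
    fix i show "\<sigma> i = \<tau> i"
    proof (cases "i < p")
      case True
      then have "e (\<sigma> i) = e (\<tau> i)" using fun_cong[OF eq, of i] by simp
      moreover have "\<sigma> i < p" "\<tau> i < p" using s True permutes_in_image[of _ "{..<p}" i] by auto
      ultimately show ?thesis using einj by (auto dest: inj_onD)
    next
      case False
      then show ?thesis using s by (auto simp: permutes_def)
    qed
  qed
  then show "(restrict (e \<circ> \<sigma>) {..<p} = restrict (e \<circ> \<tau>) {..<p}) = (\<sigma> = \<tau>)" by auto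
next
  have einj: "inj_on e {..<p}" and eim: "e ` {..<p} = S" using e by (auto simp: bij_betw_def)
  fix \<sigma> :: "nat \<Rightarrow> nat" assume "\<sigma> \<in> {\<sigma>. \<sigma> permutes {..<p}}"
  then have s: "\<sigma> permutes {..<p}" by simp
  have "bij_betw (e \<circ> \<sigma>) {..<p} S"
    using bij_betw_trans[OF permutes_imp_bij[OF s] e] .
  then show "restrict (e \<circ> \<sigma>) {..<p} \<in> {f \<in> {..<p} \<rightarrow>\<^sub>E S. inj_on f {..<p} \<and> f ` {..<p} = S}"
    by (auto simp: bij_betw_def inj_on_def)
next
  have einj: "inj_on e {..<p}" and eim: "e ` {..<p} = S" using e by (auto simp: bij_betw_def)
  fix f assume f: "f \<in> {f \<in> {..<p} \<rightarrow>\<^sub>E S. inj_on f {..<p} \<and> f ` {..<p} = S}"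
  then have fb: "bij_betw f {..<p} S" by (auto simp: bij_betw_def)
  define \<sigma> where "\<sigma> i = (if i < p then inv_into {..<p} e (f i) else i)" for i
  have "bij_betw (inv_into {..<p} e \<circ> f) {..<p} {..<p}"
    using bij_betw_trans[OF fb bij_betw_inv_into[OF e]] .
  then have "bij_betw \<sigma> {..<p} {..<p}"
    by (subst bij_betw_cong[where g = "inv_into {..<p} e \<circ> f"]) (auto simp: \<sigma>_def)
  then have "\<sigma> permutes {..<p}" by (rule bij_imp_permutes) (auto simp: \<sigma>_def)
  moreover have "f = restrict (e \<circ> \<sigma>) {..<p}"
  proof
    fix i show "f i = restrict (e \<circ> \<sigma>) {..<p} i"
    proof (cases "i < p")
      case True
      then have "f i \<in> e ` {..<p}" using f eim by auto
      then show ?thesis using True by (simp add: \<sigma>_def f_inv_into_f)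
    next
      case False then show ?thesis using f by (auto simp: PiE_def extensional_def)
    qed
  qed
  ultimately show "\<exists>\<sigma>\<in>{\<sigma>. \<sigma> permutes {..<p}}. f = restrict (e \<circ> \<sigma>) {..<p}" by blast
qed

lemma det_mat_leibniz:
  "Determinant.det (Matrix.mat p p (\<lambda>(i, j). g i j)) =
     (\<Sum>\<sigma> | \<sigma> permutes {0..<p}. signof \<sigma> * (\<Prod>i = 0..<p. g i (\<sigma> i :: nat)))"
  by (subst det_def'[of _ p]) (auto simp: permutes_in_image intro!: sum.cong prod.cong arg_cong2[of _ _ _ _ times])

text \<open>Multiplying out the rows gives a sum over functions \<open>f\<close> that pick an
  intermediate index for each row. A non-injective \<open>f\<close> leads to two equal rows. The
  others are grouped by their image, and sorting the rows of \<open>Y\<close> produces the sign that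
  turns the sum over permutations into the determinant of the \<open>X\<close> factors.\<close>

theorem cauchy_binet:
  fixes X :: "nat \<Rightarrow> 'b::linorder \<Rightarrow> 'a::comm_ring_1" and Y :: "'b \<Rightarrow> nat \<Rightarrow> 'a"
  assumes W: "finite W"
  shows "Determinant.det (Matrix.mat p p (\<lambda>(i, j). \<Sum>u\<in>W. X i u * Y u j)) =
    (\<Sum>S | S \<subseteq> W \<and> card S = p.
       Determinant.det (Matrix.mat p p (\<lambda>(i, k). X i (enum S k))) *
       Determinant.det (Matrix.mat p p (\<lambda>(k, j). Y (enum S k) j)))"
proof -
  let ?P = "{\<sigma>. \<sigma> permutes {..<p}}"
  let ?F = "{..<p} \<rightarrow>\<^sub>E W"
  define D where "D f = Determinant.det (Matrix.mat p p (\<lambda>(i, j). Y (f i) j))" for f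
  have det: "Determinant.det (Matrix.mat p p (\<lambda>(i, j). g i j)) = (\<Sum>\<sigma>\<in>?P. signof \<sigma> * (\<Prod>i<p. g i (\<sigma> i)))"
    for g :: "nat \<Rightarrow> nat \<Rightarrow> 'a"
    unfolding lessThan_atLeast0 by (rule det_mat_leibniz)
  have finF: "finite ?F" using W by (intro finite_PiE) auto
  have "Determinant.det (Matrix.mat p p (\<lambda>(i, j). \<Sum>u\<in>W. X i u * Y u j)) =
     (\<Sum>\<sigma>\<in>?P. signof \<sigma> * (\<Sum>f\<in>?F. \<Prod>i<p. X i (f i) * Y (f i) (\<sigma> i)))"
    unfolding det using W by (subst prod_sum_PiE) auto
  also have "\<dots> = (\<Sum>f\<in>?F. \<Sum>\<sigma>\<in>?P. signof \<sigma> * (\<Prod>i<p. X i (f i) * Y (f i) (\<sigma> i)))"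
    unfolding sum_distrib_left by (rule sum.swap)
  also have "\<dots> = (\<Sum>f\<in>?F. (\<Prod>i<p. X i (f i)) * D f)"
    unfolding D_def det by (simp add: sum_distrib_left prod.distrib mult_ac)
  also have "\<dots> = (\<Sum>f | f \<in> ?F \<and> inj_on f {..<p}. (\<Prod>i<p. X i (f i)) * D f)"
  proof (rule sum.mono_neutral_right)
    show "\<forall>f\<in>?F - {f. f \<in> ?F \<and> inj_on f {..<p}}. (\<Prod>i<p. X i (f i)) * D f = 0"
    proof
      fix f assume "f \<in> ?F - {f. f \<in> ?F \<and> inj_on f {..<p}}"
      then obtain i j where ij: "i < p" "j < p" "i \<noteq> j" "f i = f j" by (auto simp: inj_on_def)
      have "D f = 0" unfolding D_def
        by (rule det_identical_rows[of _ p i j]) (use ij in \<open>auto intro!: eq_vecI\<close>)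
      then show "(\<Prod>i<p. X i (f i)) * D f = 0" by simp
    qed
  qed (use finF in auto)
  also have "\<dots> = (\<Sum>S | S \<subseteq> W \<and> card S = p. \<Sum>f | f \<in> {f. f \<in> ?F \<and> inj_on f {..<p}} \<and> f ` {..<p} = S.
      (\<Prod>i<p. X i (f i)) * D f)"
  proof (rule sum.group[symmetric])
    show "(\<lambda>f. f ` {..<p}) ` {f. f \<in> ?F \<and> inj_on f {..<p}} \<subseteq> {S. S \<subseteq> W \<and> card S = p}"
    proof clarify
      fix f assume f: "f \<in> ?F" "inj_on f {..<p}"
      have "f ` {..<p} \<subseteq> W" using PiE_mem[OF f(1)] by blast
      then show "f ` {..<p} \<subseteq> W \<and> card (f ` {..<p}) = p" using card_image[OF f(2)] by simp
    qed
    show "finite {f. f \<in> ?F \<and> inj_on f {..<p}}" using finF by (rule rev_finite_subset) blast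
    show "finite {S. S \<subseteq> W \<and> card S = p}" using W by simp
  qed
  also have "\<dots> = (\<Sum>S | S \<subseteq> W \<and> card S = p.
       Determinant.det (Matrix.mat p p (\<lambda>(i, k). X i (enum S k))) * D (enum S))"
  proof (rule sum.cong[OF refl])
    fix S assume "S \<in> {S. S \<subseteq> W \<and> card S = p}"
    then have S: "S \<subseteq> W" "card S = p" "finite S" using W finite_subset by auto
    have "{f. f \<in> {f. f \<in> ?F \<and> inj_on f {..<p}} \<and> f ` {..<p} = S} =
       {f \<in> {..<p} \<rightarrow>\<^sub>E S. inj_on f {..<p} \<and> f ` {..<p} = S}"
      using S by (auto simp: PiE_def)
    then have "(\<Sum>f | f \<in> {f. f \<in> ?F \<and> inj_on f {..<p}} \<and> f ` {..<p} = S. (\<Prod>i<p. X i (f i)) * D f) =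
      (\<Sum>f | f \<in> {..<p} \<rightarrow>\<^sub>E S \<and> inj_on f {..<p} \<and> f ` {..<p} = S. (\<Prod>i<p. X i (f i)) * D f)"
      by simp
    also have "\<dots> = (\<Sum>\<sigma>\<in>?P. (\<Prod>i<p. X i (restrict (enum S \<circ> \<sigma>) {..<p} i)) * D (restrict (enum S \<circ> \<sigma>) {..<p}))"
      by (rule sum.reindex_bij_betw[OF card_inj_selections[OF enum_bij], symmetric]) (use S in auto)
    also have "\<dots> = (\<Sum>\<sigma>\<in>?P. signof \<sigma> * (\<Prod>i<p. X i (enum S (\<sigma> i))) * D (enum S))"
    proof (rule sum.cong[OF refl])
      fix \<sigma> assume "\<sigma> \<in> ?P"
      then have s: "\<sigma> permutes {0..<p}" by (simp add: lessThan_atLeast0)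
      have "D (restrict (enum S \<circ> \<sigma>) {..<p}) =
         Determinant.det (Matrix.mat p p (\<lambda>(i, j). Matrix.mat p p (\<lambda>(i, j). Y (enum S i) j) $$ (\<sigma> i, j)))"
        unfolding D_def by (rule arg_cong[of _ _ Determinant.det], rule eq_matI)
          (use permutes_in_image[OF s] in auto)
      also have "\<dots> = signof \<sigma> * D (enum S)"
        unfolding D_def by (rule det_permute_rows[OF _ s]) simp
      finally show "(\<Prod>i<p. X i (restrict (enum S \<circ> \<sigma>) {..<p} i)) * D (restrict (enum S \<circ> \<sigma>) {..<p})
          = signof \<sigma> * (\<Prod>i<p. X i (enum S (\<sigma> i))) * D (enum S)"
        by (simp add: mult_ac)
    qed
    finally show "(\<Sum>f | f \<in> {f. f \<in> ?F \<and> inj_on f {..<p}} \<and> f ` {..<p} = S. (\<Prod>i<p. X i (f i)) * D f) =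
       Determinant.det (Matrix.mat p p (\<lambda>(i, k). X i (enum S k))) * D (enum S)"
      unfolding det by (simp add: sum_distrib_right)
  qed
  finally show ?thesis unfolding D_def .
qed

section \<open>Minors of bidiagonal matrices\<close>

definition bidiagonal :: "(int \<Rightarrow> int \<Rightarrow> 'a::zero) \<Rightarrow> bool" where
  "bidiagonal T \<longleftrightarrow> (\<forall>u v. v \<noteq> u \<longrightarrow> v \<noteq> u + 1 \<longrightarrow> T u v = 0)"

lemma bidiagonalD: "bidiagonal T \<Longrightarrow> v \<noteq> u \<Longrightarrow> v \<noteq> u + 1 \<Longrightarrow> T u v = 0"
  by (auto simp: bidiagonal_def)

text \<open>A permutation with an inversion meets a zero entry, so only the identity contributes; this is the uniqueness
  of the non-intersecting paths with given endpoints.\<close>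

lemma det_bidiagonal_minor:
  fixes T :: "int \<Rightarrow> int \<Rightarrow> 'a::idom"
  assumes T: "bidiagonal T"
    and u: "\<And>i j. i < j \<Longrightarrow> j < p \<Longrightarrow> u i < u j" and v: "\<And>i j. i < j \<Longrightarrow> j < p \<Longrightarrow> v i < v j"
  shows "Determinant.det (Matrix.mat p p (\<lambda>(i, j). T (u i) (v j))) = (\<Prod>i<p. T (u i) (v i))"
proof -
  let ?P = "{\<sigma>. \<sigma> permutes {0..<p}}"
  have "Determinant.det (Matrix.mat p p (\<lambda>(i, j). T (u i) (v j))) =
      (\<Sum>\<sigma>\<in>?P. signof \<sigma> * (\<Prod>i = 0..<p. T (u i) (v (\<sigma> i))))"
    by (rule det_mat_leibniz)
  also have "\<dots> = (\<Sum>\<sigma>\<in>{id}. signof \<sigma> * (\<Prod>i = 0..<p. T (u i) (v (\<sigma> i))))"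
  proof (rule sum.mono_neutral_right)
    show "\<forall>\<sigma>\<in>?P - {id}. signof \<sigma> * (\<Prod>i = 0..<p. T (u i) (v (\<sigma> i))) = 0"
    proof
      fix \<sigma> assume "\<sigma> \<in> ?P - {id}"
      then have s: "\<sigma> permutes {0..<p}" "\<sigma> \<noteq> id" by auto
      have "\<exists>i<p. T (u i) (v (\<sigma> i)) = 0"
      proof (rule ccontr)
        assume "\<not> (\<exists>i<p. T (u i) (v (\<sigma> i)) = 0)"
        then have nz: "T (u i) (v (\<sigma> i)) \<noteq> 0" if "i < p" for i using that by auto
        have bd: "u i \<le> v (\<sigma> i)" "v (\<sigma> i) \<le> u i + 1" if "i < p" for i
          using nz[OF that] bidiagonalD[OF T, of "v (\<sigma> i)" "u i"] by fastforce+
        have sp: "\<sigma> i < p" if "i < p" for i using permutes_in_image[OF s(1), of i] that by simp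
        have inj: "\<sigma> i = \<sigma> j \<Longrightarrow> i = j" for i j using permutes_inj[OF s(1)] by (auto dest: injD)
        have mono: "strict_mono \<sigma>"
        proof (rule strict_monoI)
          fix i j :: nat assume ij: "i < j"
          show "\<sigma> i < \<sigma> j"
          proof (cases "j < p")
            case True
            show ?thesis
            proof (rule ccontr)
              assume "\<not> \<sigma> i < \<sigma> j"
              \<comment> \<open>An inversion gives the chain \<open>u j \<le> v (\<sigma> j) < v
                (\<sigma> i) \<le> u i + 1 \<le> u j\<close>: with steps of 0 or 1 two paths cannot
                exchange their order.\<close>
              then have lt: "\<sigma> j < \<sigma> i" using inj[of i j] ij by fastforce
              have "v (\<sigma> j) < v (\<sigma> i)" using v[OF lt] sp ij True by simp
              moreover have "v (\<sigma> i) \<le> u i + 1" "u j \<le> v (\<sigma> j)" using bd ij True by auto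
              moreover have "u i < u j" using u[OF ij True] .
              ultimately show False by linarith
            qed
          next
            case False
            then have j: "\<sigma> j = j" using s(1) by (auto simp: permutes_def)
            show ?thesis
            proof (cases "i < p")
              case True then show ?thesis using sp[OF True] False j by simp
            next
              case F: False
              then have "\<sigma> i = i" using s(1) by (auto simp: permutes_def)
              then show ?thesis using ij j by simp
            qed
          qed
        qed
        have "\<sigma> = id"
          by (rule permutes_natset_ge[OF s(1)]) (use strict_mono_imp_increasing[OF mono] in auto)
        then show False using s(2) by simp
      qed
      then have "(\<Prod>i = 0..<p. T (u i) (v (\<sigma> i))) = 0" by (auto intro!: prod_zero)
      then show "signof \<sigma> * (\<Prod>i = 0..<p. T (u i) (v (\<sigma> i))) = 0" by simp
    qed
  qed (auto simp: finite_permutations permutes_id)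
  also have "\<dots> = (\<Prod>i<p. T (u i) (v i))" by (simp add: lessThan_atLeast0)
  finally show ?thesis .
qed

section \<open>Path weights and their perturbation\<close>

text \<open>For bidiagonal \<open>T\<close> this is an entry of the matrix product of
  \<open>T (m + 1), ..., T (m + k)\<close>. Only the predecessors \<open>v - 1\<close> and
  \<open>v\<close> contribute, which keeps the sums finite although the index set is
  bi-infinite.\<close>

primrec path_weight :: "(nat \<Rightarrow> int \<Rightarrow> int \<Rightarrow> 'a::comm_ring_1) \<Rightarrow> nat \<Rightarrow> nat \<Rightarrow> int \<Rightarrow> int \<Rightarrow> 'a" where
  "path_weight T m 0 u v = of_bool (u = v)"
| "path_weight T m (Suc k) u v = (\<Sum>w\<in>{v - 1, v}. path_weight T m k u w * T (m + k + 1) w v)"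

text \<open>The factor \<open>1 + g\<close> is attached when a point is left, not when it is
  reached: the end point carries no mark, and each further Cauchy--Binet step adds exactly the marks
  of the current level.\<close>

primrec marked_weight :: "(nat \<Rightarrow> int \<Rightarrow> int \<Rightarrow> 'a::comm_ring_1) \<Rightarrow> (nat \<Rightarrow> int \<Rightarrow> 'a) \<Rightarrow> nat \<Rightarrow> int \<Rightarrow> int \<Rightarrow> 'a" where
  "marked_weight T g 0 u v = of_bool (u = v)"
| "marked_weight T g (Suc k) u v = (\<Sum>w\<in>{v - 1, v}. marked_weight T g k u w * (1 + g k w) * T (Suc k) w v)"

lemma path_weight_eq_0: "v < u \<or> u + int k < v \<Longrightarrow> path_weight T m k u v = 0"
  by (induction k arbitrary: v) auto

lemma marked_weight_eq_0: "v < u \<or> u + int k < v \<Longrightarrow> marked_weight T g k u v = 0"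
  by (induction k arbitrary: v) auto

lemma marked_weight_zero: "marked_weight T (\<lambda>_ _. 0) k = path_weight T 0 k"
  by (induction k) auto

text \<open>Multiply out the factors \<open>1 + g\<close> and sort the terms by the last point
  \<open>pt q\<close> at which \<open>g\<close> is chosen: before that point all marks are still
  present, after it the path is unmarked. The perturbation is thus a sum of \<open>l\<close>
  rank-one matrices, whose left vectors still depend on \<open>t\<close>.\<close>

lemma marked_weight_expand:
  fixes T :: "nat \<Rightarrow> int \<Rightarrow> int \<Rightarrow> 'a::comm_ring_1" and pt :: "nat \<Rightarrow> nat \<times> int"
  assumes T: "\<And>m. bidiagonal (T m)"
    and g: "\<And>m w. g m w = t * (\<Sum>q<l. of_bool (pt q = (m, w)))"
  shows "marked_weight T g k u v = path_weight T 0 k u v +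
    t * (\<Sum>q<l. of_bool (fst (pt q) < k) * marked_weight T g (fst (pt q)) u (snd (pt q)) *
        path_weight T (fst (pt q)) (k - fst (pt q)) (snd (pt q)) v)"
proof (induction k arbitrary: v)
  case 0
  show ?case by simp
next
  case (Suc k)
  define y where "y q = marked_weight T g (fst (pt q)) u (snd (pt q))" for q
  have one: "(\<Sum>w\<in>{v - 1, v}. of_bool (pt q = (k, w)) * marked_weight T g k u w * T (Suc k) w v) =
     of_bool (fst (pt q) = k) * y q * path_weight T (fst (pt q)) (Suc k - fst (pt q)) (snd (pt q)) v" for q
  proof (cases "pt q")
    case (Pair m z)
    show ?thesis
    proof (cases "m = k")
      case True
      then show ?thesis using Pair by (auto simp: y_def of_bool_def)
    qed (use Pair in auto)
  qed
  have "marked_weight T g (Suc k) u v =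
     (\<Sum>w\<in>{v - 1, v}. marked_weight T g k u w * T (Suc k) w v) +
     (\<Sum>w\<in>{v - 1, v}. g k w * marked_weight T g k u w * T (Suc k) w v)"
    by (simp add: algebra_simps)
  also have "(\<Sum>w\<in>{v - 1, v}. g k w * marked_weight T g k u w * T (Suc k) w v) =
      t * (\<Sum>q<l. \<Sum>w\<in>{v - 1, v}. of_bool (pt q = (k, w)) * marked_weight T g k u w * T (Suc k) w v)"
  proof -
    have "g k w * x * z = t * (\<Sum>q<l. of_bool (pt q = (k, w)) * x * z)" for w x z
      by (simp only: g mult.assoc sum_distrib_right)
    then show ?thesis by (simp only: sum_distrib_left[symmetric]) (rule arg_cong[of _ _ "(*) t"], rule sum.swap)
  qed
  also have "\<dots> = t * (\<Sum>q<l. of_bool (fst (pt q) = k) * y q * path_weight T (fst (pt q)) (Suc k - fst (pt q)) (snd (pt q)) v)"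
    unfolding one ..
  also have "(\<Sum>w\<in>{v - 1, v}. marked_weight T g k u w * T (Suc k) w v) =
     (\<Sum>w\<in>{v - 1, v}. path_weight T 0 k u w * T (Suc k) w v) +
     t * (\<Sum>q<l. \<Sum>w\<in>{v - 1, v}. of_bool (fst (pt q) < k) * y q * path_weight T (fst (pt q)) (k - fst (pt q)) (snd (pt q)) w * T (Suc k) w v)"
  proof -
    have "(x + t * (\<Sum>q<l. f q)) * z = x * z + t * (\<Sum>q<l. f q * z)" for x z f
      by (simp only: distrib_right mult.assoc sum_distrib_right)
    then show ?thesis unfolding Suc.IH y_def[symmetric] 
      by (simp only: sum.distrib sum_distrib_left[symmetric])
        (rule arg_cong[of _ _ "\<lambda>z. _ + t * z"], rule sum.swap)
  qed
  also have "(\<Sum>w\<in>{v - 1, v}. path_weight T 0 k u w * T (Suc k) w v) = path_weight T 0 (Suc k) u v"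
    by simp
  finally have eq: "marked_weight T g (Suc k) u v = path_weight T 0 (Suc k) u v
     + t * (\<Sum>q<l. \<Sum>w\<in>{v - 1, v}. of_bool (fst (pt q) < k) * y q * path_weight T (fst (pt q)) (k - fst (pt q)) (snd (pt q)) w * T (Suc k) w v)
     + t * (\<Sum>q<l. of_bool (fst (pt q) = k) * y q * path_weight T (fst (pt q)) (Suc k - fst (pt q)) (snd (pt q)) v)" .
  have two: "(\<Sum>w\<in>{v - 1, v}. of_bool (fst (pt q) < k) * y q * path_weight T (fst (pt q)) (k - fst (pt q)) (snd (pt q)) w * T (Suc k) w v)
     = of_bool (fst (pt q) < k) * y q * path_weight T (fst (pt q)) (Suc k - fst (pt q)) (snd (pt q)) v" for q
  proof (cases "fst (pt q) < k")
    case True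
    then have "Suc k - fst (pt q) = Suc (k - fst (pt q))" "fst (pt q) + (k - fst (pt q)) + 1 = Suc k" by auto
    then show ?thesis using True by (simp add: sum_distrib_left mult_ac distrib_left)
  qed simp
  have "of_bool (fst (pt q) < Suc k) * y q * z = of_bool (fst (pt q) < k) * y q * z + of_bool (fst (pt q) = k) * y q * z" for q z
    by (auto simp: of_bool_def less_Suc_eq)
  then show ?case unfolding eq two y_def[symmetric] by (simp add: sum.distrib distrib_left)
qed

text \<open>In the Leibniz formula, a row of maximal rank \<open>r\<close> moved by a permutation contributes a zero factor.\<close>

lemma det_one_minus_increasing:
  fixes c :: "nat \<Rightarrow> nat \<Rightarrow> 'a::idom" and r :: "nat \<Rightarrow> nat"
  assumes c: "\<And>i j. i < l \<Longrightarrow> j < l \<Longrightarrow> r j \<le> r i \<Longrightarrow> c i j = 0"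
  shows "Determinant.det (1\<^sub>m l - Matrix.mat l l (\<lambda>(i, j). c i j)) = 1"
proof -
  let ?P = "{\<sigma>. \<sigma> permutes {0..<l}}"
  let ?D = "1\<^sub>m l - Matrix.mat l l (\<lambda>(i, j). c i j)"
  have "Determinant.det ?D = (\<Sum>\<sigma>\<in>?P. signof \<sigma> * (\<Prod>i = 0..<l. ?D $$ (i, \<sigma> i)))"
    by (rule det_def') auto
  also have "\<dots> = (\<Sum>\<sigma>\<in>{id}. signof \<sigma> * (\<Prod>i = 0..<l. ?D $$ (i, \<sigma> i)))"
  proof (rule sum.mono_neutral_right)
    show "\<forall>\<sigma>\<in>?P - {id}. signof \<sigma> * (\<Prod>i = 0..<l. ?D $$ (i, \<sigma> i)) = 0"
    proof
      fix \<sigma> assume "\<sigma> \<in> ?P - {id}"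
      then have s: "\<sigma> permutes {0..<l}" "\<sigma> \<noteq> id" by auto
      define A where "A = {i. \<sigma> i \<noteq> i}"
      have Al: "A \<subseteq> {0..<l}" using s(1) by (auto simp: A_def permutes_def)
      then have "finite A" by (rule finite_subset) simp
      moreover have "A \<noteq> {}" using s(2) by (auto simp: A_def)
      ultimately have "Max (r ` A) \<in> r ` A" by (intro Max_in) auto
      then obtain i where i: "i \<in> A" "r i = Max (r ` A)" by auto
      have max: "r j \<le> r i" if "j \<in> A" for j using that i \<open>finite A\<close> by auto
      have "\<sigma> i \<in> A" using i(1) permutes_inj[OF s(1)] by (auto simp: A_def dest: injD)
      then have il: "i < l" "\<sigma> i < l" "\<sigma> i \<noteq> i" "r (\<sigma> i) \<le> r i" using Al i max by (auto simp: A_def)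
      then have "?D $$ (i, \<sigma> i) = 0" using c[of i "\<sigma> i"] by simp
      then have "(\<Prod>i = 0..<l. ?D $$ (i, \<sigma> i)) = 0" using il(1) by (auto intro!: prod_zero)
      then show "signof \<sigma> * (\<Prod>i = 0..<l. ?D $$ (i, \<sigma> i)) = 0" by simp
    qed
  qed (auto simp: finite_permutations permutes_id)
  also have "\<dots> = 1" using c by simp
  finally show ?thesis .
qed

text \<open>Both sides arise from the bordered matrix with blocks \<open>G, -a, b, D\<close>: adding \<open>Y\<close> times the lower to the
  upper block row clears \<open>-a\<close>, and so does adding the left block column times \<open>X * a\<close> to the right one.\<close>

lemma det_schur_marked:
  fixes M G X a Y b c :: "'a::idom mat"
  assumes car: "M \<in> carrier_mat p p" "G \<in> carrier_mat p p" "X \<in> carrier_mat p p" "a \<in> carrier_mat p l"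
      "Y \<in> carrier_mat p l" "b \<in> carrier_mat l p" "D \<in> carrier_mat l l"
    and GX: "G * X = 1\<^sub>m p" and M: "M = G + Y * b" and YD: "Y * D = a" and D: "Determinant.det D = 1"
  shows "Determinant.det M = Determinant.det G * Determinant.det (D + b * X * a)"
proof -
  note [simp] = car
  have Xa [simp]: "X * a \<in> carrier_mat p l" by (rule mult_carrier_mat[OF car(3) car(4)])
  let ?Q = "four_block_mat G (- a) b D"
  let ?L = "four_block_mat (1\<^sub>m p) Y (0\<^sub>m l p) (1\<^sub>m l)"
  let ?R = "four_block_mat (1\<^sub>m p) (X * a) (0\<^sub>m l p) (1\<^sub>m l)"
  have Qc: "?Q \<in> carrier_mat (p + l) (p + l)" "?L \<in> carrier_mat (p + l) (p + l)" "?R \<in> carrier_mat (p + l) (p + l)"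
    by auto
  have detL: "Determinant.det ?L = 1"
    by (subst det_four_block_mat_lower_left_zero[of _ p _ l]) auto
  have detR: "Determinant.det ?R = 1"
    by (subst det_four_block_mat_lower_left_zero[of _ p _ l]) auto
  have "?L * ?Q = four_block_mat (1\<^sub>m p * G + Y * b) (1\<^sub>m p * (- a) + Y * D) (0\<^sub>m l p * G + 1\<^sub>m l * b) (0\<^sub>m l p * (- a) + 1\<^sub>m l * D)"
    by (rule mult_four_block_mat[of _ p p _ l _ l _ _ p _ l]) auto
  also have "\<dots> = four_block_mat M (0\<^sub>m p l) b D"
  proof -
    have "1\<^sub>m p * (- a) + Y * D = 0\<^sub>m p l" unfolding YD
      using left_mult_one_mat[of "-a" p l] by simp
    moreover have "0\<^sub>m l p * G + 1\<^sub>m l * b = b" by (simp add: left_mult_zero_mat[OF car(2)] left_mult_one_mat[OF car(6)] left_add_zero_mat[OF car(6)])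
    moreover have "0\<^sub>m l p * (- a) + 1\<^sub>m l * D = D"
      using left_mult_zero_mat[of "-a" p l l] by (simp add: left_mult_one_mat[OF car(7)] left_add_zero_mat[OF car(7)])
    moreover have "1\<^sub>m p * G + Y * b = M" using M by (simp add: left_mult_one_mat[OF car(2)])
    ultimately show ?thesis by simp
  qed
  finally have "Determinant.det (?L * ?Q) = Determinant.det (four_block_mat M (0\<^sub>m p l) b D)" by simp
  then have 1: "Determinant.det ?Q = Determinant.det M"
    using det_mult[OF Qc(2) Qc(1)] detL D by (simp add: det_four_block_mat_upper_right_zero[of _ p _ l])
  have "?Q * ?R = four_block_mat (G * 1\<^sub>m p + (- a) * 0\<^sub>m l p) (G * (X * a) + (- a) * 1\<^sub>m l) (b * 1\<^sub>m p + D * 0\<^sub>m l p) (b * (X * a) + D * 1\<^sub>m l)"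
    by (rule mult_four_block_mat[of _ p p _ l _ l _ _ p _ l]) auto
  also have "\<dots> = four_block_mat G (0\<^sub>m p l) b (D + b * X * a)"
  proof -
    have "G * (X * a) = a" using assoc_mult_mat[OF car(2) car(3) car(4)] GX left_mult_one_mat[OF car(4)] by simp
    then have "G * (X * a) + (- a) * 1\<^sub>m l = 0\<^sub>m p l"
      using right_mult_one_mat[of "-a" p l] carrier_matD[OF car(4)] by (auto intro!: eq_matI)
    moreover have "b * (X * a) + D * 1\<^sub>m l = D + b * X * a"
    proof -
      have "b * (X * a) \<in> carrier_mat l l" by (rule mult_carrier_mat[OF car(6) Xa])
      then have "b * (X * a) + D = D + b * (X * a)" by (rule comm_add_mat) (rule car)
      then show ?thesis using assoc_mult_mat[OF car(6) car(3) car(4)] right_mult_one_mat[OF car(7)] by simp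
    qed
    moreover have "b * 1\<^sub>m p + D * 0\<^sub>m l p = b"
      by (simp add: right_mult_zero_mat[OF car(7)] right_mult_one_mat[OF car(6)] right_add_zero_mat[OF car(6)])
    moreover have "G * 1\<^sub>m p + (- a) * 0\<^sub>m l p = G"
      using right_mult_zero_mat[of "-a" p l p] by (simp add: right_mult_one_mat[OF car(2)] right_add_zero_mat[OF car(2)])
    ultimately show ?thesis by simp
  qed
  finally have "Determinant.det (?Q * ?R) = Determinant.det (four_block_mat G (0\<^sub>m p l) b (D + b * X * a))" by simp
  then have "Determinant.det ?Q = Determinant.det G * Determinant.det (D + b * X * a)"
    using det_mult[OF Qc(1) Qc(3)] detR
      det_four_block_mat_upper_right_zero[OF car(2) refl car(6) add_carrier_mat[of "b * X * a" l l D]]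
      mult_carrier_mat[OF mult_carrier_mat[OF car(6) car(3)] car(4)] by simp
  then show ?thesis using 1 by simp
qed

section \<open>The weight of the marked configurations\<close>

lemma det_scale_columns:
  fixes x :: "nat \<Rightarrow> nat \<Rightarrow> 'a::comm_ring_1"
  shows "Determinant.det (Matrix.mat p p (\<lambda>(i, k). x i k * c k)) =
    (\<Prod>k<p. c k) * Determinant.det (Matrix.mat p p (\<lambda>(i, k). x i k))"
proof -
  have "(\<Prod>i = 0..<p. x i (\<sigma> i) * c (\<sigma> i)) = (\<Prod>k<p. c k) * (\<Prod>i = 0..<p. x i (\<sigma> i))" if "\<sigma> permutes {0..<p}" for \<sigma>
    using prod.permute[OF that, of c] by (simp add: prod.distrib lessThan_atLeast0 o_def mult.commute)
  then show ?thesis unfolding det_mat_leibniz by (simp add: sum_distrib_left mult_ac)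
qed

definition minor :: "nat \<Rightarrow> (int \<Rightarrow> int \<Rightarrow> 'a::comm_ring_1) \<Rightarrow> int set \<Rightarrow> int set \<Rightarrow> 'a" where
  "minor p T S S' = Determinant.det (Matrix.mat p p (\<lambda>(j, k). T (enum S j) (enum S' k)))"

text \<open>A Cauchy--Binet step needs the same finite index set for all columns. The window
  \<open>{0..<h}\<close> serves: below 0 the marked weight from a start \<open>j \<ge> 0\<close>
  vanishes, and outside \<open>{v - 1, v}\<close> the bidiagonal factor does.\<close>

lemma det_marked_step:
  fixes T :: "nat \<Rightarrow> int \<Rightarrow> int \<Rightarrow> 'a::comm_ring_1"
  assumes T: "\<And>m. bidiagonal (T m)" and S': "S' \<subseteq> {0..<h}" "card S' = p"
  shows "Determinant.det (Matrix.mat p p (\<lambda>(j, k). marked_weight T g (Suc m) (int j) (enum S' k))) =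
    (\<Sum>S | S \<subseteq> {0..<h} \<and> card S = p. (\<Prod>u\<in>S. 1 + g m u) *
      Determinant.det (Matrix.mat p p (\<lambda>(j, k). marked_weight T g m (int j) (enum S k))) * minor p (T (Suc m)) S S')"
proof -
  have fS': "finite S'" using S' finite_subset by blast
  have "marked_weight T g (Suc m) (int j) v = (\<Sum>w\<in>{0..<h}. (marked_weight T g m (int j) w * (1 + g m w)) * T (Suc m) w v)"
    if "v \<in> {0..<h}" for j v
  proof -
    let ?f = "\<lambda>w. (marked_weight T g m (int j) w * (1 + g m w)) * T (Suc m) w v"
    have "(\<Sum>w\<in>{v - 1, v}. ?f w) = (\<Sum>w\<in>{v - 1, v} \<inter> {0..<h}. ?f w)"
    proof (rule sum.mono_neutral_right)
      show "\<forall>w\<in>{v - 1, v} - {v - 1, v} \<inter> {0..<h}. ?f w = 0"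
      proof
        fix w assume "w \<in> {v - 1, v} - {v - 1, v} \<inter> {0..<h}"
        then have "w < int j" using that by auto
        then show "?f w = 0" using marked_weight_eq_0[of w "int j" m T g] by simp
      qed
    qed auto
    also have "\<dots> = (\<Sum>w\<in>{0..<h}. ?f w)"
    proof (rule sum.mono_neutral_left)
      show "\<forall>w\<in>{0..<h} - {v - 1, v} \<inter> {0..<h}. ?f w = 0"
      proof
        fix w assume "w \<in> {0..<h} - {v - 1, v} \<inter> {0..<h}"
        then have "T (Suc m) w v = 0" by (intro bidiagonalD[OF T]) auto
        then show "?f w = 0" by simp
      qed
    qed auto
    finally show ?thesis by simp
  qed
  moreover have "enum S' k \<in> {0..<h}" if "k < p" for k
    using bij_betw_apply[OF enum_bij[OF fS' S'(2)], of k] that S' by auto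
  ultimately have "Matrix.mat p p (\<lambda>(j, k). marked_weight T g (Suc m) (int j) (enum S' k)) =
    Matrix.mat p p (\<lambda>(j, k). \<Sum>w\<in>{0..<h}. (marked_weight T g m (int j) w * (1 + g m w)) * T (Suc m) w (enum S' k))"
    by (intro cong_mat) auto
  then have "Determinant.det (Matrix.mat p p (\<lambda>(j, k). marked_weight T g (Suc m) (int j) (enum S' k))) =
    Determinant.det (Matrix.mat p p (\<lambda>(j, k). \<Sum>w\<in>{0..<h}. (marked_weight T g m (int j) w * (1 + g m w)) * T (Suc m) w (enum S' k)))"
    by simp
  also have "\<dots> = (\<Sum>S | S \<subseteq> {0..<h} \<and> card S = p.
      Determinant.det (Matrix.mat p p (\<lambda>(j, k). marked_weight T g m (int j) (enum S k) * (1 + g m (enum S k)))) *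
      Determinant.det (Matrix.mat p p (\<lambda>(k, j). T (Suc m) (enum S k) (enum S' j))))"
    by (rule cauchy_binet) simp
  also have "\<dots> = (\<Sum>S | S \<subseteq> {0..<h} \<and> card S = p. (\<Prod>u\<in>S. 1 + g m u) *
      Determinant.det (Matrix.mat p p (\<lambda>(j, k). marked_weight T g m (int j) (enum S k))) * minor p (T (Suc m)) S S')"
  proof (rule sum.cong[OF refl])
    fix S assume "S \<in> {S. S \<subseteq> {0..<h} \<and> card S = p}"
    then have S: "finite S" "card S = p" using finite_subset by auto
    have "(\<Prod>k<p. 1 + g m (enum S k)) = (\<Prod>u\<in>S. 1 + g m u)"
      using prod.reindex_bij_betw[OF enum_bij[OF S], of "\<lambda>u. 1 + g m u"] .
    then show "Determinant.det (Matrix.mat p p (\<lambda>(j, k). marked_weight T g m (int j) (enum S k) * (1 + g m (enum S k)))) *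
      Determinant.det (Matrix.mat p p (\<lambda>(k, j). T (Suc m) (enum S k) (enum S' j))) = (\<Prod>u\<in>S. 1 + g m u) *
      Determinant.det (Matrix.mat p p (\<lambda>(j, k). marked_weight T g m (int j) (enum S k))) * minor p (T (Suc m)) S S'"
      unfolding minor_def by (subst det_scale_columns) simp
  qed
  finally show ?thesis .
qed

definition chain_level :: "nat \<Rightarrow> (nat \<Rightarrow> int set) \<Rightarrow> nat \<Rightarrow> int set" where
  "chain_level p f i = (if i = 0 then {0..<int p} else f i)"

text \<open>Iterating the step sums over all chains of level sets. Level 0 is fixed to
  \<open>{0..<int p}\<close> and is not part of a configuration, so it must carry no marks.\<close>

lemma det_marked_chain:
  fixes T :: "nat \<Rightarrow> int \<Rightarrow> int \<Rightarrow> 'a::comm_ring_1"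
  assumes T: "\<And>m. bidiagonal (T m)" and S': "S' \<subseteq> {0..<h}" "card S' = p" and g: "\<And>u. g 0 u = 0"
  shows "Determinant.det (Matrix.mat p p (\<lambda>(j, k). marked_weight T g (Suc m) (int j) (enum S' k))) =
    (\<Sum>f\<in>{1..m} \<rightarrow>\<^sub>E {S. S \<subseteq> {0..<h} \<and> card S = p}.
      (\<Prod>i = 1..m. (\<Prod>u\<in>f i. 1 + g i u) * minor p (T i) (chain_level p f (i - 1)) (f i)) *
      minor p (T (Suc m)) (chain_level p f m) S')"
  using S'
proof (induction m arbitrary: S')
  case 0
  have "marked_weight T g (Suc 0) (int j) v = T (Suc 0) (int j) v" for j v
  proof -
    have "(\<Sum>w\<in>{v - 1, v}. f w) = f (v - 1) + f v" for f :: "int \<Rightarrow> 'a" by simp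
    then have "marked_weight T g (Suc 0) (int j) v = of_bool (int j = v - 1) * T (Suc 0) (v - 1) v + of_bool (int j = v) * T (Suc 0) v v"
      by (simp only: marked_weight.simps g add_0_right mult_1_right)
    then show ?thesis using bidiagonalD[OF T, of v "int j" "Suc 0"] by (auto simp: of_bool_def)
  qed
  then have "Matrix.mat p p (\<lambda>(j, k). marked_weight T g (Suc 0) (int j) (enum S' k)) =
     Matrix.mat p p (\<lambda>(j, k). T (Suc 0) (enum {0..<int p} j) (enum S' k))"
    using enum_interval[of _ p 0] by (intro cong_mat) (auto simp del: marked_weight.simps)
  then show ?case by (simp add: minor_def chain_level_def del: marked_weight.simps)
next
  case (Suc m)
  let ?SS = "{S. S \<subseteq> {0..<h} \<and> card S = p}"
  let ?c = "\<lambda>f i. (\<Prod>u\<in>f i. 1 + g i u) * minor p (T i) (chain_level p f (i - 1)) (f i)"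
  let ?P = "\<lambda>m f. \<Prod>i = 1..m. ?c f i"
  have "Determinant.det (Matrix.mat p p (\<lambda>(j, k). marked_weight T g (Suc (Suc m)) (int j) (enum S' k))) =
    (\<Sum>S\<in>?SS. (\<Prod>u\<in>S. 1 + g (Suc m) u) *
      Determinant.det (Matrix.mat p p (\<lambda>(j, k). marked_weight T g (Suc m) (int j) (enum S k))) * minor p (T (Suc (Suc m))) S S')"
    by (rule det_marked_step[OF T Suc.prems])
  also have "\<dots> = (\<Sum>S\<in>?SS. \<Sum>f\<in>{1..m} \<rightarrow>\<^sub>E ?SS. (\<Prod>u\<in>S. 1 + g (Suc m) u) *
      (?P m f * minor p (T (Suc m)) (chain_level p f m) S) * minor p (T (Suc (Suc m))) S S')"
    using Suc.IH by (intro sum.cong refl) (simp add: sum_distrib_left sum_distrib_right del: marked_weight.simps)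
  also have "\<dots> = (\<Sum>(S, f)\<in>?SS \<times> ({1..m} \<rightarrow>\<^sub>E ?SS). (\<Prod>u\<in>S. 1 + g (Suc m) u) *
      (?P m f * minor p (T (Suc m)) (chain_level p f m) S) * minor p (T (Suc (Suc m))) S S')"
    by (rule sum.cartesian_product)
  \<comment> \<open>A chain on \<open>{1..m}\<close> together with a set \<open>S\<close> for the
    next level is a chain on \<open>{1..Suc m}\<close>; the update at \<open>Suc m\<close> leaves
    the earlier factors unchanged.\<close>
  also have "\<dots> = (\<Sum>(S, f)\<in>?SS \<times> ({1..m} \<rightarrow>\<^sub>E ?SS).
      ?P (Suc m) (f(Suc m := S)) * minor p (T (Suc (Suc m))) (chain_level p (f(Suc m := S)) (Suc m)) S')"
  proof (rule sum.cong[OF refl])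
    fix x :: "int set \<times> (nat \<Rightarrow> int set)"
    obtain S f where x: "x = (S, f)" by (cases x)
    let ?f = "f(Suc m := S)"
    have "?P m ?f = ?P m f" by (intro prod.cong refl) (auto simp: chain_level_def)
    moreover have "?P (Suc m) ?f = ?P m ?f * ?c ?f (Suc m)" by simp
    moreover have "?c ?f (Suc m) = (\<Prod>u\<in>S. 1 + g (Suc m) u) * minor p (T (Suc m)) (chain_level p f m) S"
      by (simp add: chain_level_def)
    moreover have "chain_level p ?f (Suc m) = S" by (simp add: chain_level_def)
    ultimately have "(\<Prod>u\<in>S. 1 + g (Suc m) u) * (?P m f * minor p (T (Suc m)) (chain_level p f m) S) * minor p (T (Suc (Suc m))) S S' =
      ?P (Suc m) ?f * minor p (T (Suc (Suc m))) (chain_level p ?f (Suc m)) S'" by (simp only: mult_ac)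
    then show "(case x of (S, f) \<Rightarrow> (\<Prod>u\<in>S. 1 + g (Suc m) u) *
      (?P m f * minor p (T (Suc m)) (chain_level p f m) S) * minor p (T (Suc (Suc m))) S S') =
      (case x of (S, f) \<Rightarrow> ?P (Suc m) (f(Suc m := S)) * minor p (T (Suc (Suc m))) (chain_level p (f(Suc m := S)) (Suc m)) S')"
      unfolding x prod.case .
  qed
  also have "\<dots> = (\<Sum>f\<in>(\<lambda>(S, f). f(Suc m := S)) ` (?SS \<times> ({1..m} \<rightarrow>\<^sub>E ?SS)).
      ?P (Suc m) f * minor p (T (Suc (Suc m))) (chain_level p f (Suc m)) S')"
  proof (subst sum.reindex)
    show "inj_on (\<lambda>(S, f). f(Suc m := S)) (?SS \<times> ({1..m} \<rightarrow>\<^sub>E ?SS))" by (rule inj_combinator) simp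
  qed (simp add: case_prod_unfold o_def)
  also have "(\<lambda>(S, f). f(Suc m := S)) ` (?SS \<times> ({1..m} \<rightarrow>\<^sub>E ?SS)) = {1..Suc m} \<rightarrow>\<^sub>E ?SS"
    using PiE_insert_eq[of "Suc m" "{1..m}" "\<lambda>_. ?SS"] by (simp add: atLeastAtMostSuc_conv)
  finally show ?case .
qed

text \<open>Because the marked points are distinct, the inner sum is the indicator of being marked.
  Each marked point of \<open>C\<close> contributes \<open>1 + t\<close> once, and the product can
  be indexed by the marks instead of the points.\<close>

lemma prod_marks:
  fixes t :: "'a::comm_semiring_1" and l :: nat
  assumes C: "finite C" and inj: "inj_on pt {..<l}"
  shows "(\<Prod>x\<in>C. 1 + t * (\<Sum>q<l. of_bool (pt q = x))) = (\<Prod>q<l. 1 + t * of_bool (pt q \<in> C))"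
proof -
  have one: "(\<Sum>q<l. of_bool (pt q = pt r)) = (1::'a)" if "r < l" for r
  proof -
    have "(\<Sum>q<l. of_bool (pt q = pt r)) = (\<Sum>q<l. if q = r then 1 else (0::'a))"
      by (intro sum.cong refl) (use inj that in \<open>auto simp: inj_on_eq_iff\<close>)
    also have "\<dots> = 1" using that by (subst sum.delta) simp_all
    finally show ?thesis .
  qed
  have "(\<Prod>x\<in>C. 1 + t * (\<Sum>q<l. of_bool (pt q = x))) = (\<Prod>x\<in>pt ` {q \<in> {..<l}. pt q \<in> C}. 1 + t * (\<Sum>q<l. of_bool (pt q = x)))"
  proof (rule prod.mono_neutral_right)
    show "\<forall>x\<in>C - pt ` {q \<in> {..<l}. pt q \<in> C}. 1 + t * (\<Sum>q<l. of_bool (pt q = x)) = 1"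
    proof
      fix x assume "x \<in> C - pt ` {q \<in> {..<l}. pt q \<in> C}"
      then have "(\<Sum>q<l. of_bool (pt q = x)) = (0::'a)" by (intro sum.neutral) auto
      then show "1 + t * (\<Sum>q<l. of_bool (pt q = x)) = 1" by simp
    qed
  qed (use C in auto)
  also have "\<dots> = (\<Prod>q\<in>{q \<in> {..<l}. pt q \<in> C}. 1 + t * (\<Sum>q'<l. of_bool (pt q' = pt q)))"
    by (subst prod.reindex) (use inj in \<open>auto simp: inj_on_def\<close>)
  also have "\<dots> = (\<Prod>q\<in>{q \<in> {..<l}. pt q \<in> C}. 1 + t * of_bool (pt q \<in> C))"
  proof (rule prod.cong[OF refl])
    fix q assume "q \<in> {q \<in> {..<l}. pt q \<in> C}"
    then have q: "q < l" "pt q \<in> C" by auto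
    show "1 + t * (\<Sum>q'<l. of_bool (pt q' = pt q)) = 1 + t * of_bool (pt q \<in> C)"
      unfolding one[OF q(1)] using q(2) by simp
  qed
  also have "\<dots> = (\<Prod>q<l. 1 + t * of_bool (pt q \<in> C))"
    by (rule prod.mono_neutral_left) auto
  finally show ?thesis .
qed

section \<open>Configurations of the hexagon and their weights\<close>

locale hexagon =
  fixes a b c d \<alpha> \<beta> \<gamma> \<delta> :: real and N :: nat
  assumes pos: "a > 0" "b > 0" "c > 0" "d > 0" "\<alpha> > 0" "\<beta> > 0" "\<gamma> > 0" "\<delta> > 0"
    and N: "N \<ge> 1"
begin

abbreviation "step m \<equiv> block_toeplitz (symbol a b c d \<alpha> \<beta> \<gamma> \<delta> m)"
abbreviation "wt n C \<equiv> weight a b c d \<alpha> \<beta> \<gamma> \<delta> N n C"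
abbreviation "hexm n \<equiv> hexagon_measure a b c d \<alpha> \<beta> \<gamma> \<delta> N n"

text \<open>The degree-one entry in the lower left corner of the symbol joins height
  \<open>2 x + 1\<close> to \<open>2 x + 2\<close>, the first height of the next block. The block
  Toeplitz matrix is therefore bidiagonal in the scalar indices: a path stays or climbs by
  1.\<close>

lemma step_eq:
  "step m u v = (if v = u then (if even u then (if odd m then a else \<alpha>) else (if odd m then d else \<delta>))
     else if v = u + 1 then (if even u then (if odd m then b else \<beta>) else (if odd m then c else \<gamma>)) else 0)"
proof -
  define x r y s where "x = u div 2" and "r = u mod 2" and "y = v div 2" and "s = v mod 2"
  have u: "u = 2 * x + r" and v: "v = 2 * y + s" by (simp_all add: x_def r_def y_def s_def)
  have rs: "r = 0 \<or> r = 1" "s = 0 \<or> s = 1" by (auto simp: r_def s_def)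
  have k: "y = x \<or> y = x + 1 \<or> y < x \<or> y > x + 1" by linarith
  have big: "coeff [:z:] (nat k) = 0" "coeff [:0, z:] (nat k) = 0" if "k > 1" for k and z :: real
  proof -
    have "nat k = Suc (Suc (nat (k - 2)))" using that by linarith
    then show "coeff [:z:] (nat k) = 0" "coeff [:0, z:] (nat k) = 0" by simp_all
  qed
  have lt: "2 * y + i \<noteq> 2 * x + j" "2 * y + i \<noteq> 2 * x + j + 1" if "y < x \<or> y > x + 1" "i \<in> {0, 1}" "j \<in> {0, 1}" for i j
    using that by auto
  have step: "block_toeplitz (symbol a b c d \<alpha> \<beta> \<gamma> \<delta> m) u v =
     (if y - x < 0 then 0 else coeff (symbol a b c d \<alpha> \<beta> \<gamma> \<delta> m $$ (nat r, nat s)) (nat (y - x)))"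
    unfolding block_toeplitz_def fourier_coeff_def x_def[symmetric] y_def[symmetric] r_def[symmetric] s_def[symmetric]
    using rs by auto
  have sym: "symbol a b c d \<alpha> \<beta> \<gamma> \<delta> m $$ (nat r, nat s) =
     (if odd m then (if r = 0 then (if s = 0 then [:a:] else [:b:]) else (if s = 0 then [:0, c:] else [:d:]))
      else (if r = 0 then (if s = 0 then [:\<alpha>:] else [:\<beta>:]) else (if s = 0 then [:0, \<gamma>:] else [:\<delta>:])))"
    using rs by (auto simp: symbol_def mat2_def mat_of_rows_list_def)
  have even: "even u \<longleftrightarrow> r = 0" by (auto simp: r_def)
  consider "y = x" | "y = x + 1" | "y < x \<or> y > x + 1" by linarith
  then show ?thesis
  proof cases
    case 1
    then show ?thesis unfolding step sym even using rs u v by auto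
  next
    case 2
    then show ?thesis unfolding step sym even using rs u v by auto
  next
    case 3
    have "v \<noteq> u" "v \<noteq> u + 1" unfolding u v using lt[OF 3, of s r] rs by auto
    moreover have "step m u v = 0"
      unfolding step sym using 3 big[of "y - x"] by auto
    ultimately show ?thesis by simp
  qed
qed

lemma bidiagonal_step: "bidiagonal (step m)"
  by (auto simp: bidiagonal_def step_eq)

lemma step_nonneg: "step m u v \<ge> 0"
  using pos by (auto simp: step_eq)

text \<open>Paths start below \<open>2 n\<close> and make \<open>4 N\<close> steps of height at most
  1, so no configuration of positive weight leaves these heights. Sums over the infinite set of
  configurations become finite.\<close>

definition window :: "nat \<Rightarrow> (nat \<times> int) set set" where
  "window n = {C \<in> configurations N n. C \<subseteq> {0<..<4 * N} \<times> {0..<2 * int n + 4 * int N}}"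

lemma finite_window: "finite (window n)"
  by (rule finite_subset[of _ "Pow ({0<..<4 * N} \<times> {0..<2 * int n + 4 * int N})"]) (auto simp: window_def)

lemma level_props:
  assumes "C \<in> configurations N n" "m \<le> 4 * N"
  shows "finite (level N n C m)" "card (level N n C m) = 2 * n"
proof -
  have "finite {u. (m, u) \<in> C}"
    using assms by (intro finite_subset[of "{u. (m, u) \<in> C}" "snd ` C"]) (force simp: configurations_def)+
  then show "finite (level N n C m)" by (simp add: level_def)
  show "card (level N n C m) = 2 * n"
    using assms by (auto simp: level_def configurations_def)
qed

lemma weight_eq: "wt n C = (\<Prod>m = 1..4 * N. minor (2 * n) (step m) (level N n C (m - 1)) (level N n C m))"
  by (simp add: weight_def minor_def position_def enum_def)

lemma weight_eq_prod:
  assumes C: "C \<in> configurations N n"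
  shows "wt n C = (\<Prod>m = 1..4 * N. \<Prod>j<2 * n. step m (enum (level N n C (m - 1)) j) (enum (level N n C m) j))"
  unfolding weight_eq
proof (rule prod.cong[OF refl])
  fix m assume m: "m \<in> {1..4 * N}"
  show "minor (2 * n) (step m) (level N n C (m - 1)) (level N n C m) =
    (\<Prod>j<2 * n. step m (enum (level N n C (m - 1)) j) (enum (level N n C m) j))"
    unfolding minor_def
    by (rule det_bidiagonal_minor[OF bidiagonal_step]; rule enum_less) (use level_props[OF C] m in auto)
qed

lemma weight_nonneg: "C \<in> configurations N n \<Longrightarrow> wt n C \<ge> 0"
  by (simp add: weight_eq_prod prod_nonneg step_nonneg)

lemma weight_outside:
  assumes C: "C \<in> configurations N n" "C \<notin> window n"
  shows "wt n C = 0"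
proof (rule ccontr)
  assume nz: "wt n C \<noteq> 0"
  have st: "step m (enum (level N n C (m - 1)) j) (enum (level N n C m) j) \<noteq> 0" if "m \<in> {1..4 * N}" "j < 2 * n" for m j
  proof
    assume "step m (enum (level N n C (m - 1)) j) (enum (level N n C m) j) = 0"
    then have "(\<Prod>j<2 * n. step m (enum (level N n C (m - 1)) j) (enum (level N n C m) j)) = 0"
      using that(2) by (intro prod_zero) auto
    then have "wt n C = 0" unfolding weight_eq_prod[OF C(1)] using that(1) by (intro prod_zero) auto
    then show False using nz by simp
  qed
  \<comment> \<open>Each minor is a single product over \<open>j\<close>, so the \<open>j\<close>-th
    point of a level comes from the \<open>j\<close>-th point of the previous one; the start is
    \<open>j\<close> itself.\<close>
  have bd: "int j \<le> enum (level N n C m) j \<and> enum (level N n C m) j \<le> int j + int m" if "m \<le> 4 * N" "j < 2 * n" for m j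
    using that(1)
  proof (induction m)
    case 0
    then show ?case using enum_interval[OF that(2), of 0] by (simp add: level_def)
  next
    case (Suc m)
    then have "step (Suc m) (enum (level N n C m) j) (enum (level N n C (Suc m)) j) \<noteq> 0"
      using st[of "Suc m" j] that by simp
    then have "enum (level N n C (Suc m)) j = enum (level N n C m) j \<or> enum (level N n C (Suc m)) j = enum (level N n C m) j + 1"
      using bidiagonalD[OF bidiagonal_step] by blast
    then show ?case using Suc by auto
  qed
  have "C \<subseteq> {0<..<4 * N} \<times> {0..<2 * int n + 4 * int N}"
  proof
    fix x assume x: "x \<in> C"
    obtain m u where mu: "x = (m, u)" by (cases x)
    have m: "0 < m" "m < 4 * N" using C(1) x mu by (auto simp: configurations_def)
    then have "u \<in> level N n C m" using x mu by (simp add: level_def)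
    moreover have "bij_betw (enum (level N n C m)) {..<2 * n} (level N n C m)"
      by (rule enum_bij) (use level_props[OF C(1)] m in auto)
    ultimately obtain j where "j < 2 * n" "u = enum (level N n C m) j" by (auto simp: bij_betw_def)
    then show "x \<in> {0<..<4 * N} \<times> {0..<2 * int n + 4 * int N}" using bd[of m j] m mu by auto
  qed
  then show False using C by (simp add: window_def)
qed

text \<open>The chains with \<open>4 N - 1\<close> intermediate levels are the configurations,
  through \<open>Sigma {1..M}\<close>. Hence the generating function of the marks is one determinant
  of size \<open>2 n\<close>; for \<open>g = 0\<close> it is the partition function.\<close>

lemma weight_sum:
  assumes g: "\<And>u. g 0 u = 0"
  shows "(\<Sum>C\<in>window n. wt n C * (\<Prod>x\<in>C. 1 + g (fst x) (snd x))) =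
    Determinant.det (Matrix.mat (2 * n) (2 * n) (\<lambda>(j, k). marked_weight step g (4 * N) (int j) (2 * int N + int k)))"
proof -
  define M where "M = 4 * N - 1"
  have M: "4 * N = Suc M" using N by (simp add: M_def)
  define h where "h = 2 * int n + 4 * int N"
  define E where "E = {2 * int N..<2 * int N + int (2 * n)}"
  have E: "E \<subseteq> {0..<h}" "card E = 2 * n" by (auto simp: E_def h_def)
  let ?SS = "{S. S \<subseteq> {0..<h} \<and> card S = 2 * n}"
  let ?F = "{1..M} \<rightarrow>\<^sub>E ?SS"
  let ?c = "\<lambda>f i. (\<Prod>u\<in>f i. 1 + g i u) * minor (2 * n) (step i) (chain_level (2 * n) f (i - 1)) (f i)"
  have fin: "finite (f i)" if "f \<in> ?F" "i \<in> {1..M}" for f i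
    using PiE_mem[OF that] finite_subset by blast
  have lev: "level N n (Sigma {1..M} f) i = (if i = 4 * N then E else chain_level (2 * n) f i)" if "i \<le> 4 * N" for f i
    using that M by (auto simp: level_def chain_level_def E_def)
  have "Determinant.det (Matrix.mat (2 * n) (2 * n) (\<lambda>(j, k). marked_weight step g (4 * N) (int j) (2 * int N + int k))) =
     Determinant.det (Matrix.mat (2 * n) (2 * n) (\<lambda>(j, k). marked_weight step g (Suc M) (int j) (enum E k)))"
  proof -
    have "enum E k = 2 * int N + int k" if "k < 2 * n" for k unfolding E_def using that by (rule enum_interval)
    then show ?thesis unfolding M[symmetric]
      by (intro arg_cong[of _ _ Determinant.det] cong_mat) auto
  qed
  also have "\<dots> = (\<Sum>f\<in>?F. (\<Prod>i = 1..M. ?c f i) * minor (2 * n) (step (Suc M)) (chain_level (2 * n) f M) E)"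
    by (rule det_marked_chain[where T = step and g = g, OF bidiagonal_step E g])
  also have "\<dots> = (\<Sum>C\<in>window n. wt n C * (\<Prod>x\<in>C. 1 + g (fst x) (snd x)))"
  proof (rule sum.reindex_bij_witness[of _ "\<lambda>C. restrict (\<lambda>m. {u. (m, u) \<in> C}) {1..M}" "Sigma {1..M}"])
    fix f assume f: "f \<in> ?F"
    show "restrict (\<lambda>m. {u. (m, u) \<in> Sigma {1..M} f}) {1..M} = f"
      using f by (auto simp: PiE_def extensional_def restrict_def fun_eq_iff)
    have "f m \<subseteq> {0..<h} \<and> card (f m) = 2 * n" if "m \<in> {1..M}" for m using PiE_mem[OF f that] by simp
    then show "Sigma {1..M} f \<in> window n"
      using M fin[OF f] by (auto simp: window_def configurations_def h_def subset_iff)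
    have "wt n (Sigma {1..M} f) = (\<Prod>m = 1..Suc M. minor (2 * n) (step m) (level N n (Sigma {1..M} f) (m - 1)) (level N n (Sigma {1..M} f) m))"
      by (simp only: weight_eq M)
    also have "\<dots> = (\<Prod>m = 1..M. minor (2 * n) (step m) (level N n (Sigma {1..M} f) (m - 1)) (level N n (Sigma {1..M} f) m)) *
        minor (2 * n) (step (Suc M)) (level N n (Sigma {1..M} f) M) (level N n (Sigma {1..M} f) (Suc M))"
      by simp
    also have "\<dots> = (\<Prod>m = 1..M. minor (2 * n) (step m) (chain_level (2 * n) f (m - 1)) (f m)) *
        minor (2 * n) (step (Suc M)) (chain_level (2 * n) f M) E"
    proof -
      have "level N n (Sigma {1..M} f) (Suc M) = E" "level N n (Sigma {1..M} f) M = chain_level (2 * n) f M"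
        using lev[of "Suc M" f] lev[of M f] M by auto
      moreover have "minor (2 * n) (step m) (level N n (Sigma {1..M} f) (m - 1)) (level N n (Sigma {1..M} f) m) =
         minor (2 * n) (step m) (chain_level (2 * n) f (m - 1)) (f m)" if "m \<in> {1..M}" for m
        using lev[of "m - 1" f] lev[of m f] M that by (auto simp: chain_level_def)
      ultimately show ?thesis by simp
    qed
    finally have w: "wt n (Sigma {1..M} f) = \<dots>" .
    have "(\<Prod>x\<in>Sigma {1..M} f. 1 + g (fst x) (snd x)) = (\<Prod>i = 1..M. \<Prod>u\<in>f i. 1 + g i u)"
      by (subst prod.Sigma) (use fin[OF f] in \<open>auto simp: case_prod_unfold\<close>)
    then show "wt n (Sigma {1..M} f) * (\<Prod>x\<in>Sigma {1..M} f. 1 + g (fst x) (snd x)) =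
      (\<Prod>i = 1..M. ?c f i) * minor (2 * n) (step (Suc M)) (chain_level (2 * n) f M) E"
      unfolding w by (simp only: prod.distrib mult_ac)
  next
    fix C assume C: "C \<in> window n"
    then have C': "C \<subseteq> {1..M} \<times> {0..<h}" using M by (fastforce simp: window_def h_def)
    show "Sigma {1..M} (restrict (\<lambda>m. {u. (m, u) \<in> C}) {1..M}) = C" using C' by auto
    have "card {u. (m, u) \<in> C} = 2 * n" if "m \<in> {1..M}" for m
      using C that M by (auto simp: window_def configurations_def)
    then show "restrict (\<lambda>m. {u. (m, u) \<in> C}) {1..M} \<in> ?F"
      using C' by auto
  qed
  finally show ?thesis by simp
qed

text \<open>Only \<open>window n\<close> carries mass, so the integral over the counting measure is
  a finite sum. Positivity of the total mass comes later, from the invertibility of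
  \<open>gram\<close>.\<close>

lemma measure_hexagon:
  assumes Z: "(\<Sum>C\<in>window n. wt n C) > 0"
  shows "measure (hexm n) {C \<in> configurations N n. Q C} =
    (\<Sum>C\<in>window n. wt n C * of_bool (Q C)) / (\<Sum>C\<in>window n. wt n C)"
proof -
  let ?M = "weight_measure a b c d \<alpha> \<beta> \<gamma> \<delta> N n" and ?\<Omega> = "configurations N n"
  have sub: "window n \<subseteq> ?\<Omega>" by (auto simp: window_def)
  have em: "emeasure ?M {C \<in> ?\<Omega>. R C} = ennreal (\<Sum>C\<in>window n. wt n C * of_bool (R C))" for R
  proof -
    have "emeasure ?M {C \<in> ?\<Omega>. R C} = (\<integral>\<^sup>+C. ennreal (wt n C) * indicator {C \<in> ?\<Omega>. R C} C \<partial>count_space ?\<Omega>)"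
      unfolding weight_measure_def by (rule emeasure_density) auto
    also have "\<dots> = (\<Sum>C\<in>window n. ennreal (wt n C) * indicator {C \<in> ?\<Omega>. R C} C)"
      by (rule nn_integral_count_space') (use sub finite_window weight_outside in auto)
    also have "\<dots> = (\<Sum>C\<in>window n. ennreal (wt n C * of_bool (R C)))"
      by (intro sum.cong refl) (use sub in \<open>auto simp: indicator_def of_bool_def\<close>)
    also have "\<dots> = ennreal (\<Sum>C\<in>window n. wt n C * of_bool (R C))"
      by (rule sum_ennreal) (use sub weight_nonneg in auto)
    finally show ?thesis .
  qed
  have sp: "sets ?M = Pow ?\<Omega>" by (simp add: weight_measure_def)
  have tot: "emeasure ?M ?\<Omega> = ennreal (\<Sum>C\<in>window n. wt n C)" using em[of "\<lambda>_. True"] by simp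
  have "emeasure (hexm n) {C \<in> ?\<Omega>. Q C} = emeasure ?M (?\<Omega> \<inter> {C \<in> ?\<Omega>. Q C}) / emeasure ?M ?\<Omega>"
    unfolding hexagon_measure_def by (rule emeasure_uniform_measure) (auto simp: sp)
  also have "?\<Omega> \<inter> {C \<in> ?\<Omega>. Q C} = {C \<in> ?\<Omega>. Q C}" by auto
  also have "emeasure ?M {C \<in> ?\<Omega>. Q C} / emeasure ?M ?\<Omega> =
     ennreal ((\<Sum>C\<in>window n. wt n C * of_bool (Q C)) / (\<Sum>C\<in>window n. wt n C))"
    unfolding em tot by (rule divide_ennreal) (use Z sub weight_nonneg in \<open>auto intro!: sum_nonneg\<close>)
  finally show ?thesis unfolding measure_def
    by (simp add: Z less_imp_le sum_nonneg weight_nonneg subsetD[OF sub])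
qed

end

section \<open>The correlation kernel at finite size\<close>

lemma index_mult_mat_sum:
  assumes "A \<in> carrier_mat n k" "B \<in> carrier_mat k m" "i < n" "j < m"
  shows "(A * B) $$ (i, j) = (\<Sum>x<k. A $$ (i, x) * B $$ (x, j))"
  using assms by (simp add: scalar_prod_def lessThan_atLeast0)

lemma tendsto_det:
  fixes f :: "'b \<Rightarrow> nat \<Rightarrow> nat \<Rightarrow> 'a::real_normed_field"
  assumes "\<And>i j. i < l \<Longrightarrow> j < l \<Longrightarrow> ((\<lambda>x. f x i j) \<longlongrightarrow> g i j) F"
  shows "((\<lambda>x. Determinant.det (Matrix.mat l l (\<lambda>(i, j). f x i j))) \<longlongrightarrow>
    Determinant.det (Matrix.mat l l (\<lambda>(i, j). g i j))) F"
  unfolding det_mat_leibniz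
  by (intro tendsto_sum tendsto_mult tendsto_const tendsto_prod assms) (auto simp: permutes_in_image)

text \<open>With \<open>t = 1 / s\<close>, multiply by \<open>s ^ l\<close> and let \<open>s\<close> tend to 0: this extracts the coefficient of \<open>t ^ l\<close>.\<close>

lemma det_shifted_limit:
  fixes K :: "nat \<Rightarrow> nat \<Rightarrow> real" and w :: "'c \<Rightarrow> real"
  assumes eq: "\<And>t. (\<Sum>C\<in>\<W>. w C * (\<Prod>q<l. 1 + t * of_bool (P q C))) =
     z * Determinant.det (Matrix.mat l l (\<lambda>(i, j). of_bool (i = j) + t * K i j))"
  shows "(\<Sum>C\<in>\<W>. w C * of_bool (\<forall>q<l. P q C)) = z * Determinant.det (Matrix.mat l l (\<lambda>(i, j). K i j))"
proof -
  let ?f = "\<lambda>s. \<Sum>C\<in>\<W>. w C * (\<Prod>q<l. s + of_bool (P q C))"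
  let ?g = "\<lambda>s. z * Determinant.det (Matrix.mat l l (\<lambda>(i, j). s * of_bool (i = j) + K i j))"
  have fg: "?f s = ?g s" if "s \<noteq> 0" for s
  proof -
    have "?f s = s ^ l * (\<Sum>C\<in>\<W>. w C * (\<Prod>q<l. 1 + (1 / s) * of_bool (P q C)))"
    proof -
      have "(\<Prod>q<l. s + of_bool (P q C)) = s ^ l * (\<Prod>q<l. 1 + (1 / s) * of_bool (P q C))" for C
      proof -
        have "(\<Prod>q<l. s + of_bool (P q C)) = (\<Prod>q<l. s * (1 + (1 / s) * of_bool (P q C)))"
          using that by (intro prod.cong refl) (simp add: field_simps)
        then show ?thesis by (simp add: prod.distrib)
      qed
      then show ?thesis by (simp add: sum_distrib_left mult_ac)
    qed
    also have "\<dots> = z * (s ^ l * Determinant.det (Matrix.mat l l (\<lambda>(i, j). of_bool (i = j) + (1 / s) * K i j)))"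
      unfolding eq by simp
    also have "s ^ l * Determinant.det (Matrix.mat l l (\<lambda>(i, j). of_bool (i = j) + (1 / s) * K i j)) =
       Determinant.det (s \<cdot>\<^sub>m Matrix.mat l l (\<lambda>(i, j). of_bool (i = j) + (1 / s) * K i j))"
      by simp
    also have "s \<cdot>\<^sub>m Matrix.mat l l (\<lambda>(i, j). of_bool (i = j) + (1 / s) * K i j) = Matrix.mat l l (\<lambda>(i, j). s * of_bool (i = j) + K i j)"
      using that by (intro eq_matI) (auto simp: field_simps)
    finally show ?thesis .
  qed
  have "(?f \<longlongrightarrow> (\<Sum>C\<in>\<W>. w C * (\<Prod>q<l. 0 + of_bool (P q C)))) (at 0)"
    by (intro tendsto_sum tendsto_mult tendsto_prod tendsto_add tendsto_const tendsto_ident_at)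
  moreover have "(?g \<longlongrightarrow> z * Determinant.det (Matrix.mat l l (\<lambda>(i, j). 0 * of_bool (i = j) + K i j))) (at 0)"
    by (intro tendsto_mult tendsto_const tendsto_det tendsto_add tendsto_ident_at)
  moreover have "(?f \<longlongrightarrow> x) (at 0) \<longleftrightarrow> (?g \<longlongrightarrow> x) (at 0)" for x
    by (rule tendsto_cong) (auto simp: eventually_at_filter fg)
  ultimately have "(\<Sum>C\<in>\<W>. w C * (\<Prod>q<l. 0 + of_bool (P q C))) = z * Determinant.det (Matrix.mat l l (\<lambda>(i, j). 0 * of_bool (i = j) + K i j))"
    using tendsto_unique[OF at_neq_bot] by blast
  moreover have "(\<Prod>q<l. 0 + of_bool (P q C)) = (of_bool (\<forall>q<l. P q C) :: real)" for C
  proof (cases "\<forall>q<l. P q C")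
    case False
    then obtain q where "q < l" "\<not> P q C" by auto
    then have "(\<Prod>q<l. 0 + of_bool (P q C)) = (0::real)" by (intro prod_zero) auto
    then show ?thesis using False by simp
  qed simp
  ultimately show ?thesis by simp
qed

context hexagon
begin

text \<open>The Lindstroem--Gessel--Viennot matrix: total weights of single paths from start
  \<open>j\<close> to end \<open>2 N + k\<close>. Its determinant is the partition function.\<close>

definition gram :: "nat \<Rightarrow> real mat" where
  "gram n = Matrix.mat (2 * n) (2 * n) (\<lambda>(j, k). path_weight step 0 (4 * N) (int j) (2 * int N + int k))"

text \<open>The Eynard--Mehta kernel, with \<open>X\<close> in the role of the inverse of
  \<open>gram\<close>: weights from \<open>p\<close> to the ends, the inverse, weights from the
  starts to \<open>q\<close>, minus the direct weight from \<open>p\<close> to \<open>q\<close>. The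
  order of the arguments is opposite to that of \<open>limit_kernel\<close>.\<close>

definition finite_kernel :: "nat \<Rightarrow> real mat \<Rightarrow> nat \<times> int \<Rightarrow> nat \<times> int \<Rightarrow> real" where
  "finite_kernel n X p q =
     (\<Sum>j<2 * n. (\<Sum>k<2 * n. path_weight step (fst p) (4 * N - fst p) (snd p) (2 * int N + int k) * X $$ (k, j)) *
        path_weight step 0 (fst q) (int j) (snd q)) -
     of_bool (fst p < fst q) * path_weight step (fst p) (fst q - fst p) (snd p) (snd q)"

lemma marked_weight_sum:
  assumes inj: "inj_on pt {..<l}" and pt: "\<And>q. q < l \<Longrightarrow> 0 < fst (pt q) \<and> fst (pt q) < 4 * N"
    and X: "X \<in> carrier_mat (2 * n) (2 * n)" "gram n * X = 1\<^sub>m (2 * n)"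
  shows "(\<Sum>C\<in>window n. wt n C * (\<Prod>q<l. 1 + t * of_bool (pt q \<in> C))) =
    Determinant.det (gram n) * Determinant.det (Matrix.mat l l (\<lambda>(r, q). of_bool (r = q) + t * finite_kernel n X (pt r) (pt q)))"
proof -
  define g where "g m w = t * (\<Sum>q<l. of_bool (pt q = (m, w)))" for m :: nat and w :: int
  have g0: "g 0 u = 0" for u
  proof -
    have "(\<Sum>q<l. of_bool (pt q = (0, u))) = (0::real)" by (rule sum.neutral) (use pt in force)
    then show ?thesis unfolding g_def by simp
  qed
  let ?p = "2 * n"
  define M where "M = Matrix.mat ?p ?p (\<lambda>(j, k). marked_weight step g (4 * N) (int j) (2 * int N + int k))"
  define Y where "Y = Matrix.mat ?p l (\<lambda>(j, q). t * marked_weight step g (fst (pt q)) (int j) (snd (pt q)))"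
  define ca where "ca = Matrix.mat ?p l (\<lambda>(j, q). t * path_weight step 0 (fst (pt q)) (int j) (snd (pt q)))"
  define cb where "cb = Matrix.mat l ?p (\<lambda>(q, k). path_weight step (fst (pt q)) (4 * N - fst (pt q)) (snd (pt q)) (2 * int N + int k))"
  define cc where "cc r q = t * (of_bool (fst (pt r) < fst (pt q)) * path_weight step (fst (pt r)) (fst (pt q) - fst (pt r)) (snd (pt r)) (snd (pt q)))" for r q
  define D where "D = 1\<^sub>m l - Matrix.mat l l (\<lambda>(r, q). cc r q)"
  have car: "M \<in> carrier_mat ?p ?p" "gram n \<in> carrier_mat ?p ?p" "X \<in> carrier_mat ?p ?p" "ca \<in> carrier_mat ?p l"
    "Y \<in> carrier_mat ?p l" "cb \<in> carrier_mat l ?p" "D \<in> carrier_mat l l"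
    using X by (auto simp: M_def gram_def ca_def Y_def cb_def D_def)
  note expand = marked_weight_expand[where T = step and g = g and pt = pt and t = t and l = l, OF bidiagonal_step g_def]
  have "(\<Sum>C\<in>window n. wt n C * (\<Prod>q<l. 1 + t * of_bool (pt q \<in> C))) =
    (\<Sum>C\<in>window n. wt n C * (\<Prod>x\<in>C. 1 + g (fst x) (snd x)))"
  proof (intro sum.cong refl)
    fix C assume "C \<in> window n"
    then have "finite C" by (auto simp: window_def configurations_def)
    from prod_marks[OF this inj, of t] show "wt n C * (\<Prod>q<l. 1 + t * of_bool (pt q \<in> C)) = wt n C * (\<Prod>x\<in>C. 1 + g (fst x) (snd x))"
      by (simp only: g_def prod.collapse)
  qed
  also have "\<dots> = Determinant.det M" unfolding M_def by (rule weight_sum[where g = g, OF g0])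
  also have "\<dots> = Determinant.det (gram n) * Determinant.det (D + cb * X * ca)"
  proof (rule det_schur_marked[OF car X(2)])
    \<comment> \<open>The last-mark expansion at level \<open>4 N\<close>, which lies above all
      marked points.\<close>
    show "M = gram n + Y * cb"
    proof (rule eq_matI)
      fix j k assume "j < dim_row (gram n + Y * cb)" "k < dim_col (gram n + Y * cb)"
      then have jk: "j < ?p" "k < ?p" using car by auto
      have "(Y * cb) $$ (j, k) = (\<Sum>q<l. t * marked_weight step g (fst (pt q)) (int j) (snd (pt q)) *
          path_weight step (fst (pt q)) (4 * N - fst (pt q)) (snd (pt q)) (2 * int N + int k))"
        using jk by (simp add: Y_def cb_def scalar_prod_def lessThan_atLeast0)
      also have "\<dots> = t * (\<Sum>q<l. of_bool (fst (pt q) < 4 * N) * marked_weight step g (fst (pt q)) (int j) (snd (pt q)) *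
          path_weight step (fst (pt q)) (4 * N - fst (pt q)) (snd (pt q)) (2 * int N + int k))"
        unfolding sum_distrib_left using pt by (intro sum.cong refl) (simp add: mult_ac)
      finally show "M $$ (j, k) = (gram n + Y * cb) $$ (j, k)"
        using jk car expand[of "4 * N" "int j" "2 * int N + int k"] by (simp add: M_def gram_def Y_def cb_def del: times_mat_def)
    qed (use car in auto)
    \<comment> \<open>The same expansion at the level of \<open>pt q\<close> expresses column
      \<open>q\<close> of \<open>Y\<close> through columns of strictly lower level. Collecting them
      on one side gives \<open>D\<close>, and the right-hand side contains unmarked weights
      only.\<close>
    show "Y * D = ca"
    proof (rule eq_matI)
      fix j q assume "j < dim_row ca" "q < dim_col ca"
      then have jq: "j < ?p" "q < l" using car by auto
      have "(Y * D) $$ (j, q) = (\<Sum>r<l. Y $$ (j, r) * (of_bool (r = q) - cc r q))"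
        using jq car(5) by (simp add: D_def scalar_prod_def lessThan_atLeast0 of_bool_def)
      also have "\<dots> = (\<Sum>r<l. Y $$ (j, r) * of_bool (r = q)) - (\<Sum>r<l. Y $$ (j, r) * cc r q)"
        by (simp only: right_diff_distrib sum_subtractf)
      also have "(\<Sum>r<l. Y $$ (j, r) * of_bool (r = q)) = Y $$ (j, q)"
      proof -
        have "(\<Sum>r<l. Y $$ (j, r) * of_bool (r = q)) = (\<Sum>r<l. if r = q then Y $$ (j, r) else 0)"
          by (intro sum.cong refl) simp
        then show ?thesis using jq by (simp only: sum.delta finite_lessThan lessThan_iff if_True)
      qed
      also have "(\<Sum>r<l. Y $$ (j, r) * cc r q) = t * (t * (\<Sum>r<l. of_bool (fst (pt r) < fst (pt q)) *
          marked_weight step g (fst (pt r)) (int j) (snd (pt r)) * path_weight step (fst (pt r)) (fst (pt q) - fst (pt r)) (snd (pt r)) (snd (pt q))))"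
        unfolding sum_distrib_left cc_def using jq by (intro sum.cong refl) (simp add: Y_def mult_ac)
      also have "Y $$ (j, q) - \<dots> = t * path_weight step 0 (fst (pt q)) (int j) (snd (pt q))"
        using jq expand[of "fst (pt q)" "int j" "snd (pt q)"] by (simp add: Y_def algebra_simps)
      finally show "(Y * D) $$ (j, q) = ca $$ (j, q)" using jq by (simp add: ca_def)
    qed (use car in auto)
    show "Determinant.det D = 1" unfolding D_def
      by (rule det_one_minus_increasing[of l "\<lambda>q. fst (pt q)"]) (simp add: cc_def)
  qed
  also have "D + cb * X * ca = Matrix.mat l l (\<lambda>(r, q). of_bool (r = q) + t * finite_kernel n X (pt r) (pt q))"
  proof (rule eq_matI)
    fix r q assume "r < dim_row (Matrix.mat l l (\<lambda>(r, q). of_bool (r = q) + t * finite_kernel n X (pt r) (pt q)))"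
      "q < dim_col (Matrix.mat l l (\<lambda>(r, q). of_bool (r = q) + t * finite_kernel n X (pt r) (pt q)))"
    then have rq: "r < l" "q < l" by auto
    have bX: "(cb * X) $$ (r, j) = (\<Sum>k<?p. path_weight step (fst (pt r)) (4 * N - fst (pt r)) (snd (pt r)) (2 * int N + int k) * X $$ (k, j))"
      if "j < ?p" for j
      using rq X(1) that by (simp add: cb_def scalar_prod_def lessThan_atLeast0)
    have "(cb * X * ca) $$ (r, q) = (\<Sum>j<?p. (cb * X) $$ (r, j) * ca $$ (j, q))"
      by (rule index_mult_mat_sum[OF mult_carrier_mat[OF car(6,3)] car(4) rq])
    also have "\<dots> = t * (\<Sum>j<?p. (\<Sum>k<?p. path_weight step (fst (pt r)) (4 * N - fst (pt r)) (snd (pt r)) (2 * int N + int k) * X $$ (k, j)) *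
        path_weight step 0 (fst (pt q)) (int j) (snd (pt q)))"
      unfolding sum_distrib_left using rq by (intro sum.cong refl) (simp add: bX ca_def mult_ac)
    finally have "(D + cb * X * ca) $$ (r, q) = of_bool (r = q) - cc r q + t * (\<Sum>j<?p. (\<Sum>k<?p. path_weight step (fst (pt r)) (4 * N - fst (pt r)) (snd (pt r)) (2 * int N + int k) * X $$ (k, j)) *
        path_weight step 0 (fst (pt q)) (int j) (snd (pt q)))"
      using rq car mult_carrier_mat[OF mult_carrier_mat[OF car(6,3)] car(4)] by (simp add: D_def of_bool_def)
    then show "(D + cb * X * ca) $$ (r, q) = Matrix.mat l l (\<lambda>(r, q). of_bool (r = q) + t * finite_kernel n X (pt r) (pt q)) $$ (r, q)"
      using rq by (simp add: finite_kernel_def cc_def algebra_simps)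
  qed (use car mult_carrier_mat[OF mult_carrier_mat[OF car(6,3)] car(4)] in auto)
  finally show ?thesis .
qed

text \<open>The top coefficient in \<open>t\<close> selects the configurations that contain all
  \<open>l\<close> points. An inverse \<open>X\<close> makes \<open>det (gram n)\<close> non-zero,
  hence positive as a sum of nonnegative weights, and it cancels in the quotient.\<close>

theorem hexagon_probability:
  assumes inj: "inj_on pt {..<l}" and pt: "\<And>q. q < l \<Longrightarrow> 0 < fst (pt q) \<and> fst (pt q) < 4 * N"
    and X: "X \<in> carrier_mat (2 * n) (2 * n)" "X * gram n = 1\<^sub>m (2 * n)"
  shows "measure (hexm n) {C \<in> configurations N n. \<forall>q<l. pt q \<in> C} =
    Determinant.det (Matrix.mat l l (\<lambda>(r, q). finite_kernel n X (pt r) (pt q)))"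
proof -
  have G: "gram n \<in> carrier_mat (2 * n) (2 * n)" by (simp add: gram_def)
  have GX: "gram n * X = 1\<^sub>m (2 * n)" using mat_mult_left_right_inverse[OF X(1) G X(2)] .
  have Z: "(\<Sum>C\<in>window n. wt n C) = Determinant.det (gram n)"
    using weight_sum[of "\<lambda>_ _. 0" n] by (simp add: marked_weight_zero gram_def)
  have "Determinant.det X * Determinant.det (gram n) = 1" using det_mult[OF X(1) G] X(2) by simp
  then have "Determinant.det (gram n) \<noteq> 0" by auto
  moreover have "(\<Sum>C\<in>window n. wt n C) \<ge> 0"
    by (rule sum_nonneg) (auto simp: window_def weight_nonneg)
  ultimately have Zpos: "(\<Sum>C\<in>window n. wt n C) > 0" using Z by simp
  have "(\<Sum>C\<in>window n. wt n C * of_bool (\<forall>q<l. pt q \<in> C)) =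
    Determinant.det (gram n) * Determinant.det (Matrix.mat l l (\<lambda>(r, q). finite_kernel n X (pt r) (pt q)))"
    by (rule det_shifted_limit, rule marked_weight_sum[OF inj pt X(1) GX])
  then show ?thesis using measure_hexagon[OF Zpos, of "\<lambda>C. \<forall>q<l. pt q \<in> C"] Z Zpos by simp
qed

end

section \<open>Laurent coefficients on the unit circle\<close>

text \<open>The Fourier coefficient on the unit circle. It is an integral rather than a Taylor
  coefficient because the inverse of \<open>B\<close> has its pole inside the circle.\<close>

definition lcoef :: "(complex \<Rightarrow> complex) \<Rightarrow> int \<Rightarrow> complex" where
  "lcoef f k = contour_integral (circlepath 0 1) (\<lambda>z. f z * z powi (- k - 1)) / (2 * of_real pi * \<i>)"

text \<open>By the residue theorem the integral depends only on the winding numbers around the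
  singularities. This takes the place of homotopies between contours.\<close>

lemma contour_integral_eq_winding:
  assumes "finite S" "f holomorphic_on - S"
    and g: "valid_path g" "pathfinish g = pathstart g" "path_image g \<inter> S = {}"
    and h: "valid_path h" "pathfinish h = pathstart h" "path_image h \<inter> S = {}"
    and w: "\<And>s. s \<in> S \<Longrightarrow> winding_number g s = winding_number h s"
  shows "contour_integral g f = contour_integral h f"
proof -
  have hol: "f holomorphic_on UNIV - S" using assms(2) by (simp add: Compl_eq_Diff_UNIV)
  have "contour_integral g f = 2 * pi * \<i> * (\<Sum>p\<in>S. winding_number g p * residue f p)"
    by (rule Residue_theorem[OF _ _ assms(1) hol]) (use g in auto)
  also have "\<dots> = 2 * pi * \<i> * (\<Sum>p\<in>S. winding_number h p * residue f p)"
    using w by simp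
  also have "\<dots> = contour_integral h f"
    by (rule Residue_theorem[OF _ _ assms(1) hol, symmetric]) (use h in auto)
  finally show ?thesis .
qed

lemma holomorphic_on_powi: "(\<lambda>z. z powi k) holomorphic_on S" if "0 \<notin> S \<or> k \<ge> 0"
  using that by (cases "k \<ge> 0") (auto simp: power_int_def intro!: holomorphic_intros)

lemma continuous_on_powi: "continuous_on (sphere 0 1) (\<lambda>z::complex. z powi k)"
  by (rule holomorphic_on_imp_continuous_on, rule holomorphic_on_powi) auto

lemma circle_integrable:
  assumes "continuous_on (sphere 0 1) f"
  shows "(\<lambda>z. f z * z powi k) contour_integrable_on circlepath 0 1"
  by (rule contour_integrable_continuous_circlepath)
    (use assms in \<open>auto intro!: continuous_intros continuous_on_powi[unfolded sphere_def] simp: sphere_def\<close>)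

lemma lcoef_cong:
  assumes "\<And>z. z \<in> sphere 0 1 \<Longrightarrow> f z = g z"
  shows "lcoef f k = lcoef g k"
  unfolding lcoef_def
  by (intro arg_cong2[of _ _ _ _ "(/)"] refl contour_integral_eq) (use assms in auto)

lemma lcoef_add:
  assumes "continuous_on (sphere 0 1) f" "continuous_on (sphere 0 1) g"
  shows "lcoef (\<lambda>z. f z + g z) k = lcoef f k + lcoef g k"
  unfolding lcoef_def distrib_right
  by (subst contour_integral_add) (use assms in \<open>auto intro!: circle_integrable simp: add_divide_distrib\<close>)

lemma lcoef_cmult:
  assumes "continuous_on (sphere 0 1) f"
  shows "lcoef (\<lambda>z. c * f z) k = c * lcoef f k"
  unfolding lcoef_def mult.assoc
  by (subst contour_integral_lmul) (use assms in \<open>auto intro!: circle_integrable\<close>)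

lemma lcoef_sum:
  assumes "finite I" "\<And>i. i \<in> I \<Longrightarrow> continuous_on (sphere 0 1) (f i)"
  shows "lcoef (\<lambda>z. \<Sum>i\<in>I. f i z) k = (\<Sum>i\<in>I. lcoef (f i) k)"
  unfolding lcoef_def sum_distrib_right
  by (subst contour_integral_sum) (use assms in \<open>auto intro!: circle_integrable simp: sum_divide_distrib\<close>)

lemma lcoef_shift: "lcoef (\<lambda>z. z powi j * f z) k = lcoef f (k - j)"
  unfolding lcoef_def
proof (intro arg_cong2[of _ _ _ _ "(/)"] refl contour_integral_eq)
  fix z assume "z \<in> path_image (circlepath 0 (1::real))"
  then have "z \<noteq> 0" by auto
  then have "z powi j * z powi (- k - 1) = z powi (- (k - j) - 1)"
    by (subst power_int_add[symmetric]) (auto simp: algebra_simps)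
  then show "z powi j * f z * z powi (- k - 1) = f z * z powi (- (k - j) - 1)"
    by (simp add: mult_ac)
qed

lemma lcoef_bound:
  assumes "continuous_on (sphere 0 1) f" "\<And>z. z \<in> sphere 0 1 \<Longrightarrow> norm (f z) \<le> B"
  shows "norm (lcoef f k) \<le> B"
proof -
  have "norm (contour_integral (circlepath 0 1) (\<lambda>z. f z * z powi (- k - 1))) \<le> B * (2 * pi * 1)"
  proof (rule has_contour_integral_bound_circlepath)
    show "((\<lambda>z. f z * z powi (- k - 1)) has_contour_integral contour_integral (circlepath 0 1) (\<lambda>z. f z * z powi (- k - 1))) (circlepath 0 1)"
      by (rule has_contour_integral_integral, rule circle_integrable) fact
    have "norm (f 1) \<le> B" using assms(2)[of 1] by simp
    then show "0 \<le> B" using norm_ge_zero order_trans by blast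
    show "norm (f x * x powi (- k - 1)) \<le> B" if "norm (x - 0) = 1" for x
      using assms(2)[of x] that by (simp add: norm_mult norm_power_int)
  qed simp
  then show ?thesis unfolding lcoef_def by (simp add: norm_divide norm_mult field_simps)
qed

text \<open>\<open>pos\<close> says that no singularity lies on or between the two circles. The
  power of \<open>z\<close> adds the singularity 0, which both circles enclose.\<close>

lemma lcoef_radius:
  assumes S: "finite S" "f holomorphic_on - S" and r: "r > 0"
    and pos: "\<And>s. s \<in> S \<Longrightarrow> (norm s < 1 \<and> norm s < r) \<or> (norm s > 1 \<and> norm s > r)"
  shows "lcoef f k = contour_integral (circlepath 0 r) (\<lambda>z. f z * z powi (- k - 1)) / (2 * of_real pi * \<i>)"
proof -
  have "contour_integral (circlepath 0 1) (\<lambda>z. f z * z powi (- k - 1)) = contour_integral (circlepath 0 r) (\<lambda>z. f z * z powi (- k - 1))"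
  proof (rule contour_integral_eq_winding[of "insert 0 S"])
    show "(\<lambda>z. f z * z powi (- k - 1)) holomorphic_on - insert 0 S"
      by (intro holomorphic_on_mult holomorphic_on_powi holomorphic_on_subset[OF S(2)]) auto
    show "path_image (circlepath 0 1) \<inter> insert 0 S = {}" "path_image (circlepath 0 r) \<inter> insert 0 S = {}"
      using r pos by fastforce+
    fix s assume s: "s \<in> insert 0 S"
    have wn: "winding_number (circlepath 0 R) s = (if norm s < R then 1 else 0)" if "R > 0" "norm s \<noteq> R" for R
    proof (cases "norm s < R")
      case True then show ?thesis by (simp add: winding_number_circlepath)
    next
      case False
      then have "winding_number (circlepath 0 R) s = 0"
        using that by (intro winding_number_zero_outside[of _ "cball 0 R"]) auto
      then show ?thesis using False by simp
    qed
    have "(norm s < 1 \<and> norm s < r) \<or> (norm s > 1 \<and> norm s > r)" using s pos r by auto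
    then show "winding_number (circlepath 0 1) s = winding_number (circlepath 0 r) s"
      using wn[of 1] wn[of r] r by auto
  qed (use S r in auto)
  then show ?thesis by (simp add: lcoef_def)
qed

lemma lcoef_radius_bound:
  assumes S: "finite S" "f holomorphic_on - S" and r: "r > 0"
    and pos: "\<And>s. s \<in> S \<Longrightarrow> (norm s < 1 \<and> norm s < r) \<or> (norm s > 1 \<and> norm s > r)"
    and B: "\<And>z. norm z = r \<Longrightarrow> norm (f z) \<le> B"
  shows "norm (lcoef f k) \<le> B * r powi (- k)"
proof -
  have "norm (contour_integral (circlepath 0 r) (\<lambda>z. f z * z powi (- k - 1))) \<le> (B * r powi (- k - 1)) * (2 * pi * r)"
  proof (rule has_contour_integral_bound_circlepath[OF has_contour_integral_integral])
    show "(\<lambda>z. f z * z powi (- k - 1)) contour_integrable_on circlepath 0 r"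
    proof (rule contour_integrable_holomorphic_simple[of _ "- insert 0 S"])
      show "(\<lambda>z. f z * z powi (- k - 1)) holomorphic_on - insert 0 S"
        by (intro holomorphic_on_mult holomorphic_on_powi holomorphic_on_subset[OF S(2)]) auto
      show "path_image (circlepath 0 r) \<subseteq> - insert 0 S" using r pos by fastforce
    qed (use S in \<open>auto intro!: finite_imp_closed\<close>)
    have "norm (f (of_real r)) \<le> B" using B[of "of_real r"] r by simp
    then have "0 \<le> B" using norm_ge_zero order_trans by blast
    then show "0 \<le> B * r powi (- k - 1)" using r by simp
    show "norm (f x * x powi (- k - 1)) \<le> B * r powi (- k - 1)" if "norm (x - 0) = r" for x
      using B[of x] that r by (auto simp: norm_mult norm_power_int intro!: mult_right_mono)
  qed (use r in simp)
  also have "(B * r powi (- k - 1)) * (2 * pi * r) = (B * r powi (- k)) * (2 * pi)"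
    using r power_int_add_1[of r "- k - 1"] by simp
  finally have "norm (contour_integral (circlepath 0 r) (\<lambda>z. f z * z powi (- k - 1))) \<le> B * r powi (- k) * (2 * pi)" .
  then show ?thesis by (simp add: lcoef_radius[OF S r pos] norm_divide norm_mult field_simps)
qed

text \<open>With all singularities inside the unit circle the radius may tend to infinity, and the
  bound \<open>B * r powi (p - k)\<close> then tends to 0.\<close>

lemma lcoef_growth:
  assumes S: "finite S" "f holomorphic_on - S" "\<And>s. s \<in> S \<Longrightarrow> norm s < 1"
    and B: "\<And>z. norm z \<ge> 1 \<Longrightarrow> norm (f z) \<le> B * norm z powi p" and k: "k > p"
  shows "lcoef f k = 0"
proof -
  have "norm (lcoef f k) \<le> B / r" if r: "r \<ge> 1" for r :: real
  proof -
    have "norm (lcoef f k) \<le> (B * r powi p) * r powi (- k)"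
      by (rule lcoef_radius_bound[OF S(1,2)]) (use r B S(3) in fastforce)+
    also have "\<dots> = B * r powi (p - k)" using r by (simp add: power_int_diff power_int_minus field_simps)
    also have "\<dots> \<le> B * r powi (- 1)"
    proof (rule mult_left_mono)
      have "norm (f 1) \<le> B" using B[of 1] by simp
      then show "0 \<le> B" using norm_ge_zero order_trans by blast
      show "r powi (p - k) \<le> r powi (- 1)" by (rule power_int_increasing) (use k r in auto)
    qed
    finally show ?thesis by (simp add: power_int_minus field_simps)
  qed
  then have "\<forall>\<^sub>F r in at_top. norm (lcoef f k) \<le> B / r"
    by (auto intro!: eventually_at_top_linorderI[of 1])
  moreover have "((\<lambda>r. B / r) \<longlongrightarrow> 0) at_top" by real_asymp
  ultimately have "norm (lcoef f k) \<le> 0"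
    by (intro tendsto_lowerbound[of _ 0 at_top]) auto
  then show ?thesis by simp
qed

lemma lcoef_powi: "lcoef (\<lambda>z. z powi j) k = of_bool (k = j)"
proof -
  have "contour_integral (circlepath 0 1) (\<lambda>z. z powi (j - k - 1)) = (if k = j then 2 * of_real pi * \<i> else 0)"
  proof (cases "k = j")
    case True
    then show ?thesis using contour_integral_circlepath[of 1 0] by (simp add: power_int_minus field_simps)
  next
    case False
    have "((\<lambda>z. z powi (j - k - 1)) has_contour_integral 0) (circlepath 0 1)"
    proof (rule Cauchy_theorem_primitive[of "- {0}" "\<lambda>z. z powi (j - k) / of_int (j - k)"])
      fix z :: complex assume "z \<in> - {0}"
      then show "((\<lambda>z. z powi (j - k) / of_int (j - k)) has_field_derivative z powi (j - k - 1)) (at z within - {0})"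
        using False by (auto intro!: derivative_eq_intros)
    qed auto
    then show ?thesis using False contour_integral_unique by auto
  qed
  then show ?thesis using lcoef_shift[of j "\<lambda>_. 1" k] by (simp add: lcoef_def algebra_simps)
qed

section \<open>Block Laurent matrices\<close>

lemma holomorphic_circle_coeffs:
  assumes f: "f holomorphic_on ball 0 R" and R: "R > 1"
  shows "k < 0 \<Longrightarrow> lcoef f k = 0"
    and "\<And>z. z \<in> sphere 0 1 \<Longrightarrow> (\<lambda>n. lcoef f (int n) * z ^ n) sums f z"
    and "summable (\<lambda>n. norm (lcoef f (int n)))"
proof -
  show "lcoef f k = 0" if "k < 0"
  proof -
    have "((\<lambda>z. f z * z powi (- k - 1)) has_contour_integral 0) (circlepath 0 1)"
    proof (rule Cauchy_theorem_convex_simple[of _ "ball 0 R"])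
      show "(\<lambda>z. f z * z powi (- k - 1)) holomorphic_on ball 0 R"
        by (intro holomorphic_on_mult f holomorphic_on_powi) (use that in auto)
    qed (use R in auto)
    then show ?thesis by (simp add: lcoef_def contour_integral_unique)
  qed
  have c: "lcoef f (int n) = (deriv ^^ n) f 0 / fact n" for n
  proof -
    have "((\<lambda>u. f u / (u - 0) ^ Suc n) has_contour_integral (2 * pi * \<i> / fact n * (deriv ^^ n) f 0)) (circlepath 0 1)"
    proof (rule Cauchy_has_contour_integral_higher_derivative_circlepath)
      show "continuous_on (cball 0 1) f"
        by (rule holomorphic_on_imp_continuous_on, rule holomorphic_on_subset[OF f]) (use R in auto)
      show "f holomorphic_on ball 0 1" by (rule holomorphic_on_subset[OF f]) (use R in auto)
    qed auto
    then have "contour_integral (circlepath 0 1) (\<lambda>u. f u / u ^ Suc n) = 2 * pi * \<i> / fact n * (deriv ^^ n) f 0"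
      by (simp add: contour_integral_unique)
    moreover have "contour_integral (circlepath 0 1) (\<lambda>u. f u * u powi (- int n - 1)) = contour_integral (circlepath 0 1) (\<lambda>u. f u / u ^ Suc n)"
    proof (rule contour_integral_eq)
      fix u assume "u \<in> path_image (circlepath 0 (1::real))"
      have "- int n - 1 = - int (Suc n)" by simp
      then show "f u * u powi (- int n - 1) = f u / u ^ Suc n"
        by (simp only: power_int_minus power_int_of_nat) (simp add: divide_inverse)
    qed
    ultimately show ?thesis unfolding lcoef_def by simp
  qed
  have sums: "(\<lambda>n. lcoef f (int n) * z ^ n) sums f z" if "z \<in> ball 0 R" for z
    using holomorphic_power_series[OF f that] by (simp add: c)
  show "(\<lambda>n. lcoef f (int n) * z ^ n) sums f z" if "z \<in> sphere 0 1" for z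
    using sums[of z] that R by auto
  obtain r where r: "1 < r" "r < R" using dense R by blast
  have "summable (\<lambda>n. lcoef f (int n) * (of_real r) ^ n)"
    using sums[of "of_real r"] r by (auto intro: sums_summable)
  from powser_insidea[OF this, of 1] show "summable (\<lambda>n. norm (lcoef f (int n)))"
    using r by simp
qed

lemma continuous_on_sphere_bounded:
  fixes g :: "complex \<Rightarrow> complex"
  assumes "continuous_on (sphere 0 1) g"
  obtains B where "B > 0" "\<And>z. z \<in> sphere 0 1 \<Longrightarrow> norm (g z) \<le> B"
proof -
  have "bounded (g ` sphere 0 1)"
    by (rule compact_imp_bounded[OF compact_continuous_image[OF assms]]) simp
  then obtain B where "B > 0" "\<forall>x\<in>g ` sphere 0 1. norm x \<le> B" unfolding bounded_pos by blast
  then show ?thesis by (intro that[of B]) auto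
qed

text \<open>One factor with an absolutely summable Taylor series is enough: its partial sums
  converge uniformly on the circle, and \<open>lcoef\<close> is continuous for the uniform norm. The
  other factor is only continuous, so that symbols with poles inside the disc are covered.\<close>

lemma lcoef_convolution:
  assumes f: "f holomorphic_on ball 0 R" and R: "R > 1" and g: "continuous_on (sphere 0 1) g"
  shows "((\<lambda>i. lcoef f i * lcoef g (d - i)) has_sum lcoef (\<lambda>z. f z * g z) d) UNIV"
proof -
  define c where "c n = lcoef f (int n)" for n
  obtain B where B: "B > 0" "\<And>z. z \<in> sphere 0 1 \<Longrightarrow> norm (g z) \<le> B"
    using continuous_on_sphere_bounded[OF g] by blast
  have fc: "continuous_on (sphere 0 1) f"
    by (rule holomorphic_on_imp_continuous_on, rule holomorphic_on_subset[OF f]) (use R in auto)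
  have sc: "summable (\<lambda>n. norm (c n))" unfolding c_def using holomorphic_circle_coeffs(3)[OF f R] .
  have wl: "uniform_limit (sphere 0 1) (\<lambda>n z. \<Sum>i<n. c i * z ^ i) (\<lambda>z. \<Sum>i. c i * z ^ i) sequentially"
    by (rule Weierstrass_m_test[OF _ sc]) (auto simp: norm_mult norm_power)
  have fz: "(\<Sum>i. c i * z ^ i) = f z" if "z \<in> sphere 0 1" for z
    using holomorphic_circle_coeffs(2)[OF f R that] by (simp add: c_def sums_iff)
  have ul: "uniform_limit (sphere 0 1) (\<lambda>n z. \<Sum>i<n. c i * z ^ i) f sequentially"
    by (rule uniform_limit_cong'[THEN iffD1, OF _ _ wl]) (auto simp: fz)
  have part: "lcoef (\<lambda>z. (\<Sum>i<n. c i * z ^ i) * g z) d = (\<Sum>i<n. c i * lcoef g (d - int i))" for n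
  proof -
    have cont: "continuous_on (sphere 0 1) (\<lambda>z. z powi int i * g z)" for i
      by (rule continuous_on_mult[OF continuous_on_powi g])
    have "lcoef (\<lambda>z. (\<Sum>i<n. c i * z ^ i) * g z) d = lcoef (\<lambda>z. \<Sum>i<n. c i * (z powi int i * g z)) d"
      by (rule lcoef_cong) (simp add: sum_distrib_right mult.assoc)
    also have "\<dots> = (\<Sum>i<n. lcoef (\<lambda>z. c i * (z powi int i * g z)) d)"
      by (rule lcoef_sum) (simp, rule continuous_on_mult[OF continuous_on_const cont])
    also have "\<dots> = (\<Sum>i<n. c i * lcoef g (d - int i))"
      by (simp only: lcoef_cmult[OF cont] lcoef_shift)
    finally show ?thesis .
  qed
  have "(\<lambda>n. \<Sum>i<n. c i * lcoef g (d - int i)) \<longlonglongrightarrow> lcoef (\<lambda>z. f z * g z) d"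
  proof (rule tendstoI)
    fix e :: real assume e: "e > 0"
    have "\<forall>\<^sub>F n in sequentially. \<forall>z\<in>sphere 0 1. dist (\<Sum>i<n. c i * z ^ i) (f z) < e / (2 * B)"
      using uniform_limitD[OF ul, of "e / (2 * B)"] e B by simp
    then show "\<forall>\<^sub>F n in sequentially. dist (\<Sum>i<n. c i * lcoef g (d - int i)) (lcoef (\<lambda>z. f z * g z) d) < e"
    proof eventually_elim
      case (elim n)
      let ?p = "\<lambda>z. \<Sum>i<n. c i * z ^ i"
      have pg: "continuous_on (sphere 0 1) (\<lambda>z. ?p z * g z)"
        by (intro continuous_on_mult continuous_on_sum continuous_on_power continuous_on_const continuous_on_id g)
      have fg: "continuous_on (sphere 0 1) (\<lambda>z. f z * g z)" by (rule continuous_on_mult[OF fc g])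
      have mfg: "continuous_on (sphere 0 1) (\<lambda>z. (- 1) * (f z * g z))" by (rule continuous_on_mult[OF continuous_on_const fg])
      have "lcoef (\<lambda>z. ?p z * g z + (- 1) * (f z * g z)) d = lcoef (\<lambda>z. ?p z * g z) d + (-1) * lcoef (\<lambda>z. f z * g z) d"
        by (simp only: lcoef_add[OF pg mfg] lcoef_cmult[OF fg])
      moreover have "norm (lcoef (\<lambda>z. ?p z * g z + (- 1) * (f z * g z)) d) \<le> e / (2 * B) * B"
      proof (rule lcoef_bound)
        show "continuous_on (sphere 0 1) (\<lambda>z. ?p z * g z + (- 1) * (f z * g z))"
          by (rule continuous_on_add[OF pg mfg])
        fix z :: complex assume z: "z \<in> sphere 0 1"
        have "?p z * g z + (- 1) * (f z * g z) = (?p z - f z) * g z" by (simp add: algebra_simps)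
        then have "norm (?p z * g z + (- 1) * (f z * g z)) = norm (?p z - f z) * norm (g z)"
          by (simp add: norm_mult)
        also have "\<dots> \<le> e / (2 * B) * B"
          using elim z B(2)[OF z] B(1) e by (intro mult_mono) (auto simp: dist_norm less_imp_le)
        finally show "norm (?p z * g z + (- 1) * (f z * g z)) \<le> e / (2 * B) * B" .
      qed
      ultimately show ?case using part B(1) e by (simp add: dist_norm)
    qed
  qed
  then have s: "(\<lambda>n. c n * lcoef g (d - int n)) sums lcoef (\<lambda>z. f z * g z) d"
    by (simp add: sums_def)
  have "summable (\<lambda>n. norm (c n * lcoef g (d - int n)))"
  proof (rule summable_comparison_test'[OF summable_mult2[OF sc, of B]])
    fix n show "norm (norm (c n * lcoef g (d - int n))) \<le> norm (c n) * B"
      using lcoef_bound[OF g B(2)] by (simp add: norm_mult mult_left_mono)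
  qed
  then have "((\<lambda>n. c n * lcoef g (d - int n)) has_sum lcoef (\<lambda>z. f z * g z) d) UNIV"
    by (rule norm_summable_imp_has_sum[OF _ s])
  then have "((\<lambda>i. lcoef f i * lcoef g (d - i)) has_sum lcoef (\<lambda>z. f z * g z) d) (range int)"
    by (subst has_sum_reindex) (auto simp: c_def o_def)
  moreover have "((\<lambda>i. lcoef f i * lcoef g (d - i)) has_sum lcoef (\<lambda>z. f z * g z) d) (range int) \<longleftrightarrow>
     ((\<lambda>i. lcoef f i * lcoef g (d - i)) has_sum lcoef (\<lambda>z. f z * g z) d) UNIV"
  proof (rule has_sum_cong_neutral)
    fix i assume "i \<in> UNIV - range int"
    then have "i < 0" using rangeI[of int "nat i"] by (cases "i < 0") auto
    then show "lcoef f i * lcoef g (d - i) = 0" using holomorphic_circle_coeffs(1)[OF f R] by simp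
  qed simp_all
  ultimately show ?thesis by simp
qed

text \<open>The block Laurent matrix of the symbol \<open>F\<close>, with the scalar indices \<open>u = 2x + r\<close>.\<close>

definition laurent_op :: "(complex \<Rightarrow> complex mat) \<Rightarrow> int \<Rightarrow> int \<Rightarrow> complex" where
  "laurent_op F u v = lcoef (\<lambda>z. F z $$ (nat (u mod 2), nat (v mod 2))) (v div 2 - u div 2)"

lemma laurent_op_shift: "laurent_op F (u + 2 * k) (v + 2 * k) = laurent_op F u v"
  by (simp add: laurent_op_def)

lemma laurent_op_cong:
  "(\<And>z. z \<in> sphere 0 1 \<Longrightarrow> F z = G z) \<Longrightarrow> laurent_op F u v = laurent_op G u v"
  unfolding laurent_op_def by (rule lcoef_cong) simp

lemma nat_mod_2_less: "nat (u mod 2) < 2" by auto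

definition circle_continuous :: "(complex \<Rightarrow> complex mat) \<Rightarrow> bool" where
  "circle_continuous F \<longleftrightarrow> (\<forall>z. F z \<in> carrier_mat 2 2) \<and>
     (\<forall>r<2. \<forall>s<2. continuous_on (sphere 0 1) (\<lambda>z. F z $$ (r, s)))"

definition disc_holomorphic :: "(complex \<Rightarrow> complex mat) \<Rightarrow> bool" where
  "disc_holomorphic F \<longleftrightarrow> (\<forall>z. F z \<in> carrier_mat 2 2) \<and>
     (\<exists>R>1. \<forall>r<2. \<forall>s<2. (\<lambda>z. F z $$ (r, s)) holomorphic_on ball 0 R)"

lemma disc_holomorphic_imp_continuous: "disc_holomorphic F \<Longrightarrow> circle_continuous F"
proof -
  assume F: "disc_holomorphic F"
  then obtain R where R: "R > 1" "\<And>r s. r < 2 \<Longrightarrow> s < 2 \<Longrightarrow> (\<lambda>z. F z $$ (r, s)) holomorphic_on ball 0 R"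
    unfolding disc_holomorphic_def by blast
  have "sphere 0 1 \<subseteq> ball (0::complex) R" using R(1) by auto
  then have "continuous_on (sphere 0 1) (\<lambda>z. F z $$ (r, s))" if "r < 2" "s < 2" for r s
    using holomorphic_on_imp_continuous_on[OF R(2)[OF that]] continuous_on_subset by blast
  then show ?thesis using F by (auto simp: disc_holomorphic_def circle_continuous_def)
qed

lemma index_mult_mat2:
  fixes F G :: "'a::semiring_0 mat"
  assumes "F \<in> carrier_mat 2 2" "G \<in> carrier_mat 2 2" "r < 2" "s < 2"
  shows "(F * G) $$ (r, s) = F $$ (r, 0) * G $$ (0, s) + F $$ (r, 1) * G $$ (1, s)"
  using assms by (simp add: scalar_prod_def numeral_2_eq_2)

lemma has_sum_parity:
  fixes f :: "int \<Rightarrow> complex"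
  assumes "((\<lambda>y. f (2 * y)) has_sum s) UNIV" "((\<lambda>y. f (2 * y + 1)) has_sum t) UNIV"
  shows "(f has_sum (s + t)) UNIV"
proof -
  have "bij_betw (\<lambda>y::int. 2 * y) UNIV {k. even k}" "bij_betw (\<lambda>y::int. 2 * y + 1) UNIV {k. odd k}"
    by (rule bij_betw_byWitness[of _ "\<lambda>k. k div 2"]; auto)+
  then have "(f has_sum s) {k. even k}" "(f has_sum t) {k. odd k}"
    using assms has_sum_reindex_bij_betw by blast+
  then have "(f has_sum (s + t)) ({k. even k} \<union> {k. odd k})"
    by (rule has_sum_Un_disjoint) auto
  moreover have "{k. even k} \<union> {k. odd k} = (UNIV :: int set)" by auto
  ultimately show ?thesis by simp
qed

text \<open>The scalar index \<open>k = 2 y + q\<close> splits into a block index \<open>y\<close>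
  and an inner index \<open>q\<close>; the sums over even and odd \<open>k\<close> are the two terms
  of the matrix product of the symbols.\<close>

lemma laurent_op_mult_parts:
  assumes F: "circle_continuous F" and G: "circle_continuous G"
    and conv: "\<And>q d. q < 2 \<Longrightarrow> ((\<lambda>y. lcoef (\<lambda>z. F z $$ (nat (u mod 2), q)) (y - u div 2) * lcoef (\<lambda>z. G z $$ (q, nat (v mod 2))) (v div 2 - y))
       has_sum lcoef (\<lambda>z. F z $$ (nat (u mod 2), q) * G z $$ (q, nat (v mod 2))) (v div 2 - u div 2)) UNIV"
  shows "((\<lambda>k. laurent_op F u k * laurent_op G k v) has_sum laurent_op (\<lambda>z. F z * G z) u v) UNIV"
proof -
  let ?r = "nat (u mod 2)" and ?s = "nat (v mod 2)" and ?d = "v div 2 - u div 2"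
  have "laurent_op (\<lambda>z. F z * G z) u v = lcoef (\<lambda>z. F z $$ (?r, 0) * G z $$ (0, ?s) + F z $$ (?r, 1) * G z $$ (1, ?s)) ?d"
    unfolding laurent_op_def
    by (rule lcoef_cong, rule index_mult_mat2) (use F G nat_mod_2_less in \<open>auto simp: circle_continuous_def\<close>)
  also have "\<dots> = lcoef (\<lambda>z. F z $$ (?r, 0) * G z $$ (0, ?s)) ?d + lcoef (\<lambda>z. F z $$ (?r, 1) * G z $$ (1, ?s)) ?d"
    by (rule lcoef_add) (use F G nat_mod_2_less in \<open>auto simp: circle_continuous_def intro!: continuous_on_mult\<close>)
  finally have eq: "laurent_op (\<lambda>z. F z * G z) u v = \<dots>" .
  show ?thesis unfolding eq
    by (rule has_sum_parity) (use conv[of 0] conv[of 1] in \<open>simp_all add: laurent_op_def\<close>)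
qed

lemma laurent_op_mult_left:
  assumes F: "disc_holomorphic F" and G: "circle_continuous G"
  shows "((\<lambda>k. laurent_op F u k * laurent_op G k v) has_sum laurent_op (\<lambda>z. F z * G z) u v) UNIV"
proof (rule laurent_op_mult_parts)
  fix q d :: nat assume q: "q < 2"
  let ?f = "\<lambda>z. F z $$ (nat (u mod 2), q)" and ?g = "\<lambda>z. G z $$ (q, nat (v mod 2))"
  obtain R where R: "R > 1" "?f holomorphic_on ball 0 R"
    using F q nat_mod_2_less unfolding disc_holomorphic_def by blast
  have "((\<lambda>i. lcoef ?f i * lcoef ?g ((v div 2 - u div 2) - i)) has_sum lcoef (\<lambda>z. ?f z * ?g z) (v div 2 - u div 2)) UNIV"
    by (rule lcoef_convolution[OF R(2,1)]) (use G q nat_mod_2_less in \<open>auto simp: circle_continuous_def\<close>)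
  then show "((\<lambda>y. lcoef ?f (y - u div 2) * lcoef ?g (v div 2 - y)) has_sum lcoef (\<lambda>z. ?f z * ?g z) (v div 2 - u div 2)) UNIV"
    by (subst has_sum_reindex_bij_betw[of "\<lambda>i. i + u div 2" UNIV UNIV, symmetric])
      (auto simp: algebra_simps intro!: bij_betw_byWitness[of _ "\<lambda>i. i - u div 2"])
qed (use assms disc_holomorphic_imp_continuous in auto)

text \<open>Scalar convolution is symmetric, so the scalar lemma is applied with the entries
  exchanged; reflecting the summation index at \<open>v div 2\<close> restores the order of the
  matrices.\<close>

lemma laurent_op_mult_right:
  assumes F: "circle_continuous F" and G: "disc_holomorphic G"
  shows "((\<lambda>k. laurent_op F u k * laurent_op G k v) has_sum laurent_op (\<lambda>z. F z * G z) u v) UNIV"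
proof (rule laurent_op_mult_parts)
  fix q d :: nat assume q: "q < 2"
  let ?f = "\<lambda>z. F z $$ (nat (u mod 2), q)" and ?g = "\<lambda>z. G z $$ (q, nat (v mod 2))"
  obtain R where R: "R > 1" "?g holomorphic_on ball 0 R"
    using G q nat_mod_2_less unfolding disc_holomorphic_def by blast
  have "((\<lambda>i. lcoef ?g i * lcoef ?f ((v div 2 - u div 2) - i)) has_sum lcoef (\<lambda>z. ?g z * ?f z) (v div 2 - u div 2)) UNIV"
    by (rule lcoef_convolution[OF R(2,1)]) (use F q nat_mod_2_less in \<open>auto simp: circle_continuous_def\<close>)
  then show "((\<lambda>y. lcoef ?f (y - u div 2) * lcoef ?g (v div 2 - y)) has_sum lcoef (\<lambda>z. ?f z * ?g z) (v div 2 - u div 2)) UNIV"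
    by (subst has_sum_reindex_bij_betw[of "\<lambda>i. v div 2 - i" UNIV UNIV, symmetric])
      (auto simp: algebra_simps intro!: bij_betw_byWitness[of _ "\<lambda>i. v div 2 - i"])
qed (use assms disc_holomorphic_imp_continuous in auto)

section \<open>Finite sections of a matrix with Wiener--Hopf factorizations\<close>

text \<open>The row sums of \<open>T R - 1\<close> are at most \<open>p * e \<le> 1 / 2\<close>, so
  \<open>T R\<close> has no kernel vector: consider a coordinate of maximal modulus. For the true
  inverse \<open>X\<close> one has \<open>X - R = X (1 - T R)\<close>, which first bounds
  \<open>X\<close> by \<open>2 r\<close> and then the difference.\<close>

lemma mat_perturbation:
  fixes T R X :: "complex mat"
  assumes T: "T \<in> carrier_mat p p" and R: "R \<in> carrier_mat p p"
    and e: "\<And>i j. i < p \<Longrightarrow> j < p \<Longrightarrow> norm ((T * R) $$ (i, j) - of_bool (i = j)) \<le> e" and pe: "real p * e \<le> 1 / 2"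
  shows "Determinant.det T \<noteq> 0"
    and "X \<in> carrier_mat p p \<Longrightarrow> X * T = 1\<^sub>m p \<Longrightarrow> (\<And>i j. i < p \<Longrightarrow> j < p \<Longrightarrow> norm (R $$ (i, j)) \<le> r) \<Longrightarrow>
      i < p \<Longrightarrow> j < p \<Longrightarrow> norm (X $$ (i, j) - R $$ (i, j)) \<le> 2 * r * (real p * e)"
proof -
  define M where "M = T * R"
  have M: "M \<in> carrier_mat p p" using T R by (auto simp: M_def)
  have eM: "norm (M $$ (i, j) - of_bool (i = j)) \<le> e" if "i < p" "j < p" for i j
    using e[OF that] by (simp add: M_def)
  have "Determinant.det M \<noteq> 0"
  proof
    assume "Determinant.det M = 0"
    then obtain v where v: "v \<in> carrier_vec p" "v \<noteq> 0\<^sub>v p" "M *\<^sub>v v = 0\<^sub>v p"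
      using det_0_iff_vec_prod_zero[OF M] by auto
    then obtain k where k: "k < p" "vec_index v k \<noteq> 0" by (metis eq_vecI carrier_vecD index_zero_vec)
    define m where "m = Max ((\<lambda>j. norm (vec_index v j)) ` {..<p})"
    have "m \<in> (\<lambda>j. norm (vec_index v j)) ` {..<p}" unfolding m_def using k by (intro Max_in) auto
    then obtain i where i: "i < p" "m = norm (vec_index v i)" by auto
    have mx: "norm (vec_index v j) \<le> m" if "j < p" for j using that unfolding m_def by (intro Max_ge) auto
    have m0: "m > 0" using mx[OF k(1)] k(2) by (meson less_le_trans zero_less_norm_iff)
    have "0 = (\<Sum>j<p. M $$ (i, j) * vec_index v j)"
      using arg_cong[OF v(3), of "\<lambda>w. vec_index w i"] M v(1) i(1) by (simp add: scalar_prod_def lessThan_atLeast0)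
    also have "\<dots> = (\<Sum>j<p. (M $$ (i, j) - of_bool (i = j)) * vec_index v j) + vec_index v i"
      using i(1) by (simp add: left_diff_distrib sum_subtractf of_bool_def if_distrib[of "\<lambda>x. x * _"] sum.delta cong: if_cong)
    finally have "vec_index v i = - (\<Sum>j<p. (M $$ (i, j) - of_bool (i = j)) * vec_index v j)"
      by (simp add: eq_neg_iff_add_eq_0 add.commute)
    then have "m \<le> (\<Sum>j<p. norm ((M $$ (i, j) - of_bool (i = j)) * vec_index v j))"
      using i(2) norm_sum by simp
    also have "\<dots> \<le> (\<Sum>j<p. e * m)"
    proof (rule sum_mono)
      fix j assume "j \<in> {..<p}"
      then have j: "j < p" by simp
      show "norm ((M $$ (i, j) - of_bool (i = j)) * vec_index v j) \<le> e * m"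
        unfolding norm_mult
        by (rule mult_mono[OF eM[OF i(1) j] mx[OF j] order_trans[OF norm_ge_zero eM[OF i(1) j]] norm_ge_zero])
    qed
    also have "\<dots> = (real p * e) * m" by simp
    also have "\<dots> \<le> 1 / 2 * m" using pe m0 by (intro mult_right_mono) auto
    finally show False using m0 by simp
  qed
  then show "Determinant.det T \<noteq> 0" using det_mult[OF T R] by (auto simp: M_def)
  assume X: "X \<in> carrier_mat p p" "X * T = 1\<^sub>m p" and r: "\<And>i j. i < p \<Longrightarrow> j < p \<Longrightarrow> norm (R $$ (i, j)) \<le> r"
    and ij: "i < p" "j < p"
  have XM: "X * M = R" using assoc_mult_mat[OF X(1) T R] X(2) R by (simp add: M_def)
  let ?I = "{..<p} \<times> {..<p}"
  define x where "x = Max ((\<lambda>(i, j). norm (X $$ (i, j))) ` ?I)"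
  have "x \<in> (\<lambda>(i, j). norm (X $$ (i, j))) ` ?I" unfolding x_def using ij by (intro Max_in) auto
  then obtain i' j' where x: "i' < p" "j' < p" "x = norm (X $$ (i', j'))" by auto
  have mx: "norm (X $$ (i, j)) \<le> x" if "i < p" "j < p" for i j unfolding x_def using that by (intro Max_ge) auto
  have diff: "norm (X $$ (i, j) - R $$ (i, j)) \<le> x * (real p * e)" if ij: "i < p" "j < p" for i j
  proof -
    have "R $$ (i, j) = (\<Sum>k<p. X $$ (i, k) * M $$ (k, j))"
      using ij X(1) M XM[symmetric] by (simp add: scalar_prod_def lessThan_atLeast0)
    also have "\<dots> = (\<Sum>k<p. X $$ (i, k) * (M $$ (k, j) - of_bool (k = j))) + X $$ (i, j)"
      using ij by (simp add: right_diff_distrib sum_subtractf of_bool_def if_distrib[of "\<lambda>x. _ * x"] sum.delta cong: if_cong)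
    finally have "norm (X $$ (i, j) - R $$ (i, j)) = norm (\<Sum>k<p. X $$ (i, k) * (M $$ (k, j) - of_bool (k = j)))"
      by (simp add: norm_minus_commute)
    also have "\<dots> \<le> (\<Sum>k<p. norm (X $$ (i, k) * (M $$ (k, j) - of_bool (k = j))))" by (rule norm_sum)
    also have "\<dots> \<le> (\<Sum>k<p. x * e)"
    proof (rule sum_mono)
      fix k assume "k \<in> {..<p}"
      then have k: "k < p" by simp
      show "norm (X $$ (i, k) * (M $$ (k, j) - of_bool (k = j))) \<le> x * e"
        unfolding norm_mult
        by (rule mult_mono[OF mx[OF ij(1) k] eM[OF k ij(2)] order_trans[OF norm_ge_zero mx[OF ij(1) k]] norm_ge_zero])
    qed
    finally show ?thesis by (simp add: mult_ac)
  qed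
  have "x \<le> norm (R $$ (i', j')) + norm (X $$ (i', j') - R $$ (i', j'))"
    using norm_triangle_ineq[of "R $$ (i', j')" "X $$ (i', j') - R $$ (i', j')"] x(3) by simp
  also have "\<dots> \<le> r + x * (1 / 2)"
    using r[OF x(1,2)] diff[OF x(1,2)] mult_left_mono[OF pe, of x] x(3) by fastforce
  \<comment> \<open>The maximal entry \<open>x\<close> of \<open>X\<close> stands on both sides with
    factor at most \<open>1 / 2\<close> on the right, and is absorbed.\<close>
  finally have x2: "x \<le> 2 * r" by simp
  have "0 \<le> e" using order_trans[OF norm_ge_zero eM[OF ij]] .
  then have "x * (real p * e) \<le> 2 * r * (real p * e)" using x2 by (intro mult_right_mono) auto
  then show "norm (X $$ (i, j) - R $$ (i, j)) \<le> 2 * r * (real p * e)" using diff[OF ij] by linarith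
qed

lemma div_2_less_neg: "j < 0 \<Longrightarrow> 0 \<le> y \<Longrightarrow> j div 2 < y div (2::int)"
  by presburger

lemma div_2_less_even: "y < 2 * m \<Longrightarrow> 2 * m \<le> j \<Longrightarrow> y div 2 < j div (2::int)"
  by presburger

lemma sum_int_lessThan: "(\<Sum>k\<in>{0..<int p}. f k) = (\<Sum>k<p. f (int k))"
  by (rule sum.reindex_bij_witness[of _ int nat]) auto

lemma has_sum_norm_le_up:
  fixes f :: "int \<Rightarrow> complex"
  assumes f: "(f has_sum s) {a..}" and b: "\<And>i::nat. norm (f (a + int i)) \<le> c * \<rho> ^ i" and \<rho>: "0 < \<rho>" "\<rho> < 1"
  shows "norm s \<le> c / (1 - \<rho>)"
proof -
  have "bij_betw (\<lambda>i. a + int i) UNIV {a..}"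
    by (rule bij_betw_byWitness[of _ "\<lambda>k. nat (k - a)"]) auto
  then have "((\<lambda>i. f (a + int i)) has_sum s) UNIV" using f has_sum_reindex_bij_betw by blast
  then have "(\<lambda>i. f (a + int i)) sums s" by (rule has_sum_imp_sums)
  then have s: "s = (\<Sum>i. f (a + int i))" by (simp add: sums_iff)
  have g: "(\<lambda>i. c * \<rho> ^ i) sums (c * (1 / (1 - \<rho>)))"
    by (rule sums_mult, rule geometric_sums) (use \<rho> in auto)
  have "norm s \<le> (\<Sum>i. c * \<rho> ^ i)" unfolding s
    by (rule norm_suminf_le[OF b]) (use g in \<open>auto simp: sums_iff\<close>)
  then show ?thesis using g by (simp add: sums_iff)
qed

lemma has_sum_norm_le_down:
  fixes f :: "int \<Rightarrow> complex"
  assumes f: "(f has_sum s) {..<a}" and b: "\<And>i::nat. norm (f (a - 1 - int i)) \<le> c * \<rho> ^ i" and \<rho>: "0 < \<rho>" "\<rho> < 1"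
  shows "norm s \<le> c / (1 - \<rho>)"
proof -
  have "bij_betw (\<lambda>k. - k) {1 - a..} {..<a}"
    by (rule bij_betw_byWitness[of _ uminus]) auto
  then have "((\<lambda>k. f (- k)) has_sum s) {1 - a..}" using f has_sum_reindex_bij_betw by blast
  then show ?thesis by (rule has_sum_norm_le_up) (use b \<rho> in \<open>auto simp: algebra_simps\<close>)
qed

lemma has_sum_tail:
  fixes f :: "int \<Rightarrow> complex"
  assumes "(f has_sum s) UNIV" "finite F" "A \<inter> F = {}" "\<And>x. x \<notin> A \<Longrightarrow> x \<notin> F \<Longrightarrow> f x = 0"
  shows "(f has_sum (s - sum f F)) A"
proof -
  have "(f has_sum (s - sum f F)) (UNIV - F)"
    by (rule has_sum_Diff[OF assms(1) has_sum_finite]) (use assms in auto)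
  then show ?thesis
    by (rule has_sum_cong_neutral[THEN iffD1, rotated -1]) (use assms in auto)
qed

lemma has_sum_eq_sum:
  fixes f :: "int \<Rightarrow> complex"
  assumes "(f has_sum s) UNIV" "finite F" "\<And>x. x \<notin> F \<Longrightarrow> f x = 0"
  shows "s = sum f F"
proof -
  have "(f has_sum (s - sum f F)) {}" by (rule has_sum_tail) (use assms in auto)
  then show ?thesis by (metis diff_eq_diff_eq eq_iff_diff_eq_0 has_sum_empty has_sum_unique)
qed

text \<open>\<open>W = U L\<close> and \<open>W = L U\<close> are the two Wiener--Hopf factorizations of a banded Laurent matrix, \<open>V\<close> is its inverse,
  and primes denote inverses.  The products are those of matrices over the integers; \<open>div 2\<close> is the block index.\<close>

locale wiener_hopf =
  fixes W U U' L L' V :: "int \<Rightarrow> int \<Rightarrow> complex" and \<beta> :: int and C \<rho> :: real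
  assumes \<rho>: "0 < \<rho>" "\<rho> < 1"
    and band: "\<And>x y. \<bar>x - y\<bar> > \<beta> \<Longrightarrow> W x y = 0"
    and W_bound: "\<And>x y. norm (W x y) \<le> C"
    and upper: "\<And>x y. y div 2 < x div 2 \<Longrightarrow> U x y = 0" "\<And>x y. y div 2 < x div 2 \<Longrightarrow> U' x y = 0"
    and lower: "\<And>x y. x div 2 < y div 2 \<Longrightarrow> L x y = 0" "\<And>x y. x div 2 < y div 2 \<Longrightarrow> L' x y = 0"
    and decay: "\<And>x y. norm (U' x y) \<le> C * \<rho> ^ nat \<bar>x - y\<bar>" "\<And>x y. norm (L' x y) \<le> C * \<rho> ^ nat \<bar>x - y\<bar>"
    and WL': "\<And>x y. ((\<lambda>k. W x k * L' k y) has_sum U x y) UNIV"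
    and WU': "\<And>x y. ((\<lambda>k. W x k * U' k y) has_sum L x y) UNIV"
    and WV: "\<And>x y. ((\<lambda>k. W x k * V k y) has_sum of_bool (x = y)) UNIV"
    and UU': "\<And>x y. ((\<lambda>k. U x k * U' k y) has_sum of_bool (x = y)) UNIV"
    and LL': "\<And>x y. ((\<lambda>k. L x k * L' k y) has_sum of_bool (x = y)) UNIV"
    and U'L': "\<And>x y. ((\<lambda>k. U' x k * L' k y) has_sum V x y) UNIV"
    and L'U': "\<And>x y. ((\<lambda>k. L' x k * U' k y) has_sum V x y) UNIV"
begin

lemma C_nonneg: "C \<ge> 0" using order_trans[OF norm_ge_zero W_bound] .

text \<open>\<open>PP\<close> inverts \<open>W\<close> on the half-line bounded below by \<open>0\<close>, and \<open>QQ\<close> on the half-line bounded above by \<open>2 n\<close>.  The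
  combination \<open>RR\<close> is an inverse of the finite section on \<open>[0, 2 n)\<close> up to an error that is exponentially small in \<open>n\<close>:
  outside the section one of \<open>PP\<close>, \<open>QQ\<close> vanishes, and \<open>V\<close> nearly cancels the other.\<close>

definition "PP n k y = (\<Sum>j\<in>{0..<2 * int n}. L' k j * U' j y)"
definition "QQ n k y = (\<Sum>j\<in>{0..<2 * int n}. U' k j * L' j y)"
definition "RR n k y = PP n k y + QQ n k y - V k y"

lemma decay_le: "norm (U' x y) \<le> C" "norm (L' x y) \<le> C"
proof -
  have "C * \<rho> ^ nat \<bar>x - y\<bar> \<le> C * 1"
    by (intro mult_left_mono power_le_one) (use \<rho> C_nonneg in auto)
  then show "norm (U' x y) \<le> C" "norm (L' x y) \<le> C" using decay[of x y] by linarith+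
qed

text \<open>\<open>V\<close> is the full sum of which \<open>QQ\<close> keeps
  \<open>0 \<le> j < 2 n\<close>. For \<open>y \<ge> 0\<close> the terms with \<open>j < 0\<close>
  vanish since \<open>L'\<close> is block lower triangular. The difference is the tail
  \<open>j \<ge> 2 n\<close>, damped by the decay of \<open>U'\<close> over the distance from
  \<open>k\<close>.\<close>

lemma QQ_V:
  assumes "0 \<le> y" "k \<le> 2 * int n"
  shows "norm (QQ n k y - V k y) \<le> C\<^sup>2 * \<rho> ^ nat (2 * int n - k) / (1 - \<rho>)"
proof -
  have "((\<lambda>j. U' k j * L' j y) has_sum (V k y - QQ n k y)) {2 * int n..}"
    unfolding QQ_def
  proof (rule has_sum_tail[OF U'L'])
    fix j assume "j \<notin> {2 * int n..}" "j \<notin> {0..<2 * int n}"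
    then have "j div 2 < y div 2" using assms by (auto intro: div_2_less_neg div_2_less_even)
    then show "U' k j * L' j y = 0" using lower by simp
  qed auto
  then have "norm (V k y - QQ n k y) \<le> C\<^sup>2 * \<rho> ^ nat (2 * int n - k) / (1 - \<rho>)"
  proof (rule has_sum_norm_le_up)
    fix i :: nat
    have "norm (U' k (2 * int n + int i)) \<le> C * \<rho> ^ nat \<bar>k - (2 * int n + int i)\<bar>" by (rule decay)
    also have "nat \<bar>k - (2 * int n + int i)\<bar> = nat (2 * int n - k) + i" using assms by auto
    finally have "norm (U' k (2 * int n + int i)) * norm (L' (2 * int n + int i) y) \<le> C * \<rho> ^ (nat (2 * int n - k) + i) * C"
      by (rule mult_mono[OF _ decay_le(2)]) (use C_nonneg \<rho> in auto)
    then show "norm (U' k (2 * int n + int i) * L' (2 * int n + int i) y) \<le> C\<^sup>2 * \<rho> ^ nat (2 * int n - k) * \<rho> ^ i"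
      by (simp add: norm_mult power_add power2_eq_square mult_ac)
  qed (use \<rho> in auto)
  then show ?thesis by (simp add: norm_minus_commute)
qed

text \<open>The mirror image: the tail is now \<open>j < 0\<close>, because \<open>U' j y\<close>
  vanishes for \<open>y < 2 n \<le> j\<close>. This uses that \<open>2 n\<close> is a block
  boundary.\<close>

lemma PP_V:
  assumes "y < 2 * int n" "k \<ge> 0"
  shows "norm (PP n k y - V k y) \<le> C\<^sup>2 * \<rho> ^ nat k / (1 - \<rho>)"
proof -
  have "((\<lambda>j. L' k j * U' j y) has_sum (V k y - PP n k y)) {..<0}"
    unfolding PP_def
  proof (rule has_sum_tail[OF L'U'])
    fix j assume "j \<notin> {..<0}" "j \<notin> {0..<2 * int n}"
    then have "y div 2 < j div 2" using assms by (auto intro: div_2_less_neg div_2_less_even)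
    then show "L' k j * U' j y = 0" using upper by simp
  qed auto
  then have "norm (V k y - PP n k y) \<le> C\<^sup>2 * \<rho> ^ nat k / (1 - \<rho>)"
  proof (rule has_sum_norm_le_down)
    fix i :: nat
    have "norm (L' k (0 - 1 - int i)) \<le> C * \<rho> ^ nat \<bar>k - (0 - 1 - int i)\<bar>" by (rule decay)
    also have "\<dots> \<le> C * \<rho> ^ (nat k + i)"
      by (intro mult_left_mono power_decreasing) (use assms \<rho> C_nonneg in auto)
    finally have "norm (L' k (0 - 1 - int i)) * norm (U' (0 - 1 - int i) y) \<le> C * \<rho> ^ (nat k + i) * C"
      by (rule mult_mono[OF _ decay_le(1)]) (use C_nonneg \<rho> in auto)
    then show "norm (L' k (0 - 1 - int i) * U' (0 - 1 - int i) y) \<le> C\<^sup>2 * \<rho> ^ nat k * \<rho> ^ i"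
      by (simp add: norm_mult power_add power2_eq_square mult_ac)
  qed (use \<rho> in auto)
  then show ?thesis by (simp add: norm_minus_commute)
qed

lemma band_sum:
  assumes "((\<lambda>k. W x k * F k) has_sum s) UNIV"
  shows "(\<Sum>k\<in>{x - \<beta>..x + \<beta>}. W x k * F k) = s"
  by (rule has_sum_eq_sum[OF assms, symmetric]) (auto simp: band)

text \<open>The sum runs over the whole band, also beyond the section. \<open>W\<close> turns
  \<open>L'\<close> into \<open>U\<close> and \<open>U'\<close> into \<open>L\<close>, so
  \<open>PP\<close>, \<open>QQ\<close> and \<open>V\<close> each reproduce the identity, and the
  signs in \<open>RR\<close> leave 1 + 1 - 1 of it.\<close>

lemma RR_band:
  assumes x: "0 \<le> x" "x < 2 * int n" and y: "0 \<le> y" "y < 2 * int n"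
  shows "(\<Sum>k\<in>{x - \<beta>..x + \<beta>}. W x k * RR n k y) = of_bool (x = y)"
proof -
  let ?B = "{x - \<beta>..x + \<beta>}" and ?I = "{0..<2 * int n}"
  have "(\<Sum>k\<in>?B. W x k * PP n k y) = (\<Sum>j\<in>?I. (\<Sum>k\<in>?B. W x k * L' k j) * U' j y)"
    unfolding PP_def sum_distrib_left sum_distrib_right by (subst sum.swap) (simp add: mult_ac)
  also have "\<dots> = (\<Sum>j\<in>?I. U x j * U' j y)" using band_sum[OF WL'] by simp
  also have "\<dots> = of_bool (x = y)"
  proof (rule has_sum_eq_sum[OF UU', symmetric])
    fix j assume j: "j \<notin> ?I"
    show "U x j * U' j y = 0"
    proof (cases "j < 0")
      case True
      then have "j div 2 < x div 2" using x by (auto intro: div_2_less_neg div_2_less_even)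
      then show ?thesis using upper by simp
    next
      case False
      then have "y div 2 < j div 2" using y j by (auto intro: div_2_less_neg div_2_less_even)
      then show ?thesis using upper by simp
    qed
  qed simp
  finally have 1: "(\<Sum>k\<in>?B. W x k * PP n k y) = of_bool (x = y)" .
  have "(\<Sum>k\<in>?B. W x k * QQ n k y) = (\<Sum>j\<in>?I. (\<Sum>k\<in>?B. W x k * U' k j) * L' j y)"
    unfolding QQ_def sum_distrib_left sum_distrib_right by (subst sum.swap) (simp add: mult_ac)
  also have "\<dots> = (\<Sum>j\<in>?I. L x j * L' j y)" using band_sum[OF WU'] by simp
  also have "\<dots> = of_bool (x = y)"
  proof (rule has_sum_eq_sum[OF LL', symmetric])
    fix j assume j: "j \<notin> ?I"
    show "L x j * L' j y = 0"
    proof (cases "j < 0")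
      case True
      then have "j div 2 < y div 2" using y by (auto intro: div_2_less_neg div_2_less_even)
      then show ?thesis using lower by simp
    next
      case False
      then have "x div 2 < j div 2" using x j by (auto intro: div_2_less_neg div_2_less_even)
      then show ?thesis using lower by simp
    qed
  qed simp
  finally have 2: "(\<Sum>k\<in>?B. W x k * QQ n k y) = of_bool (x = y)" .
  have "(\<Sum>k\<in>?B. W x k * RR n k y) = (\<Sum>k\<in>?B. W x k * PP n k y) + (\<Sum>k\<in>?B. W x k * QQ n k y) - (\<Sum>k\<in>?B. W x k * V k y)"
    by (simp add: RR_def algebra_simps sum.distrib sum_subtractf)
  then show ?thesis using 1 2 band_sum[OF WV, of x y] by simp
qed

lemma RR_off:
  assumes y: "0 \<le> y" "y < 2 * int n" and k: "k < 0 \<or> k \<ge> 2 * int n"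
  shows "norm (RR n k y) \<le> C\<^sup>2 / (1 - \<rho>) * \<rho> ^ (2 * n)"
proof (cases "k < 0")
  case True
  have "PP n k y = 0" unfolding PP_def
  proof (rule sum.neutral, rule ballI)
    fix j assume "j \<in> {0..<2 * int n}"
    then have "k div 2 < j div 2" using True by (auto intro: div_2_less_neg div_2_less_even)
    then show "L' k j * U' j y = 0" using lower by simp
  qed
  then have "norm (RR n k y) \<le> C\<^sup>2 * \<rho> ^ nat (2 * int n - k) / (1 - \<rho>)"
    using QQ_V[of y k n] True y by (simp add: RR_def)
  also have "\<dots> \<le> C\<^sup>2 * \<rho> ^ (2 * n) / (1 - \<rho>)"
    by (intro divide_right_mono mult_left_mono power_decreasing) (use True \<rho> in auto)
  finally show ?thesis by simp
next
  case False
  then have k': "k \<ge> 2 * int n" using k by simp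
  have "QQ n k y = 0" unfolding QQ_def
  proof (rule sum.neutral, rule ballI)
    fix j assume "j \<in> {0..<2 * int n}"
    then have "j div 2 < k div 2" using k' by (auto intro: div_2_less_neg div_2_less_even)
    then show "U' k j * L' j y = 0" using upper by simp
  qed
  then have "norm (RR n k y) \<le> C\<^sup>2 * \<rho> ^ nat k / (1 - \<rho>)"
    using PP_V[of y n k] False y by (simp add: RR_def)
  also have "\<dots> \<le> C\<^sup>2 * \<rho> ^ (2 * n) / (1 - \<rho>)"
    by (intro divide_right_mono mult_left_mono power_decreasing) (use k' \<rho> in auto)
  finally show ?thesis by simp
qed

definition "TT n = Matrix.mat (2 * n) (2 * n) (\<lambda>(i, j). W (int i) (int j))"
definition "RM n = Matrix.mat (2 * n) (2 * n) (\<lambda>(i, j). RR n (int i) (int j))"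
definition "err n = real (nat (2 * \<beta> + 1)) * C * (C\<^sup>2 / (1 - \<rho>)) * \<rho> ^ (2 * n)"

text \<open>The product over the section is the full band sum minus at most
  \<open>2 \<beta> + 1\<close> terms that stick out, and there \<open>RR\<close> is exponentially
  small.\<close>

lemma TT_RM:
  assumes ij: "i < 2 * n" "j < 2 * n"
  shows "norm ((TT n * RM n) $$ (i, j) - of_bool (i = j)) \<le> err n"
proof -
  let ?B = "{int i - \<beta>..int i + \<beta>}" and ?I = "{0..<int (2 * n)}"
  have "(TT n * RM n) $$ (i, j) = (\<Sum>k<2 * n. W (int i) (int k) * RR n (int k) (int j))"
    using ij by (simp add: TT_def RM_def scalar_prod_def lessThan_atLeast0)
  also have "\<dots> = (\<Sum>k\<in>?I. W (int i) k * RR n k (int j))" by (rule sum_int_lessThan[symmetric])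
  also have "\<dots> = (\<Sum>k\<in>?B \<inter> ?I. W (int i) k * RR n k (int j))"
    by (rule sum.mono_neutral_right) (auto intro!: band)
  also have "\<dots> = (\<Sum>k\<in>?B. W (int i) k * RR n k (int j)) - (\<Sum>k\<in>?B - ?I. W (int i) k * RR n k (int j))"
    using sum.Int_Diff[of ?B "\<lambda>k. W (int i) k * RR n k (int j)" ?I] by simp
  also have "(\<Sum>k\<in>?B. W (int i) k * RR n k (int j)) = of_bool (i = j)"
    using RR_band[of "int i" n "int j"] ij by simp
  finally have "norm ((TT n * RM n) $$ (i, j) - of_bool (i = j)) = norm (\<Sum>k\<in>?B - ?I. W (int i) k * RR n k (int j))"
    by simp
  also have "\<dots> \<le> (\<Sum>k\<in>?B - ?I. C * (C\<^sup>2 / (1 - \<rho>) * \<rho> ^ (2 * n)))"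
  proof (rule sum_norm_le)
    fix k assume "k \<in> ?B - ?I"
    then have "norm (RR n k (int j)) \<le> C\<^sup>2 / (1 - \<rho>) * \<rho> ^ (2 * n)" using ij by (intro RR_off) auto
    then show "norm (W (int i) k * RR n k (int j)) \<le> C * (C\<^sup>2 / (1 - \<rho>) * \<rho> ^ (2 * n))"
      unfolding norm_mult by (intro mult_mono W_bound) (use C_nonneg in auto)
  qed
  also have "\<dots> = real (card (?B - ?I)) * (C * (C\<^sup>2 / (1 - \<rho>) * \<rho> ^ (2 * n)))" by simp
  also have "\<dots> \<le> real (card ?B) * (C * (C\<^sup>2 / (1 - \<rho>) * \<rho> ^ (2 * n)))"
    by (intro mult_right_mono of_nat_mono card_mono) (use C_nonneg \<rho> in auto)
  also have "\<dots> = err n" by (simp add: err_def mult_ac)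
  finally show ?thesis .
qed

text \<open>A bound that grows linearly in \<open>n\<close> suffices, because it is multiplied by
  the exponentially small \<open>err n\<close>.\<close>

lemma RM_bound:
  assumes ij: "i < 2 * n" "j < 2 * n"
  shows "norm (RM n $$ (i, j)) \<le> 2 * real n * C\<^sup>2 + C\<^sup>2 / (1 - \<rho>)"
proof -
  have "norm (PP n (int i) (int j)) \<le> (\<Sum>k\<in>{0..<2 * int n}. C\<^sup>2)"
    unfolding PP_def
  proof (rule sum_norm_le)
    show "norm (L' (int i) k * U' k (int j)) \<le> C\<^sup>2" for k
      unfolding norm_mult power2_eq_square by (intro mult_mono decay_le) (use C_nonneg in auto)
  qed
  then have 1: "norm (PP n (int i) (int j)) \<le> 2 * real n * C\<^sup>2" by simp
  have "norm (QQ n (int i) (int j) - V (int i) (int j)) \<le> C\<^sup>2 * \<rho> ^ nat (2 * int n - int i) / (1 - \<rho>)"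
    by (rule QQ_V) (use ij in auto)
  also have "\<dots> \<le> C\<^sup>2 * 1 / (1 - \<rho>)"
    by (intro divide_right_mono mult_left_mono power_le_one) (use \<rho> in auto)
  finally have 2: "norm (QQ n (int i) (int j) - V (int i) (int j)) \<le> C\<^sup>2 / (1 - \<rho>)" by simp
  have "RM n $$ (i, j) = PP n (int i) (int j) + (QQ n (int i) (int j) - V (int i) (int j))"
    using ij by (simp add: RM_def RR_def)
  then show ?thesis using 1 2 norm_triangle_ineq[of "PP n (int i) (int j)" "QQ n (int i) (int j) - V (int i) (int j)"] by simp
qed

lemma n_rho: "(\<lambda>n. real n * \<rho> ^ n) \<longlonglongrightarrow> 0"
  using powser_times_n_limit_0[of \<rho>] \<rho> by simp

lemma n_err: "(\<lambda>n. real (2 * n) * err n) \<longlonglongrightarrow> 0"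
proof -
  have "(\<lambda>n. 2 * (real (nat (2 * \<beta> + 1)) * C * (C\<^sup>2 / (1 - \<rho>))) * ((real n * \<rho> ^ n) * \<rho> ^ n)) \<longlonglongrightarrow> 2 * (real (nat (2 * \<beta> + 1)) * C * (C\<^sup>2 / (1 - \<rho>))) * (0 * 0)"
    by (intro tendsto_mult tendsto_const n_rho LIMSEQ_power_zero) (use \<rho> in auto)
  then show ?thesis by (simp add: err_def power_mult power2_eq_square power_mult_distrib mult_ac)
qed

lemma eventually_det_nonzero: "\<forall>\<^sub>F n in sequentially. Determinant.det (TT n) \<noteq> 0"
proof -
  have "\<forall>\<^sub>F n in sequentially. real (2 * n) * err n < 1 / 2"
    using order_tendstoD(2)[OF n_err, of "1/2"] by simp
  then show ?thesis
  proof eventually_elim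
    case (elim n)
    show ?case
      by (rule mat_perturbation(1)[of _ "2 * n" "RM n" "err n"])
        (use elim TT_RM in \<open>auto simp: TT_def RM_def\<close>)
  qed
qed

text \<open>For fixed \<open>i\<close> and \<open>j\<close> the upper end of the section recedes and
  \<open>QQ - V\<close> tends to 0. \<open>PP\<close> becomes independent of \<open>n\<close>, since
  \<open>U' k j\<close> vanishes once \<open>k\<close> lies in a later block than \<open>j\<close>,
  in particular for \<open>k > j + 1\<close>. What remains is the inverse on the half-line.\<close>

theorem inverse_limit:
  assumes X: "\<forall>\<^sub>F n in sequentially. X n \<in> carrier_mat (2 * n) (2 * n) \<and> X n * TT n = 1\<^sub>m (2 * n)"
  shows "(\<lambda>n. X n $$ (i, j)) \<longlonglongrightarrow> (\<Sum>k\<in>{0..int j + 1}. L' (int i) k * U' k (int j))"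
proof -
  let ?s = "\<Sum>k\<in>{0..int j + 1}. L' (int i) k * U' k (int j)"
  \<comment> \<open>The first term bounds the distance of the true inverse from \<open>RM\<close>,
    the second that of \<open>RM\<close> from the half-line inverse.\<close>
  let ?b = "\<lambda>n. 2 * (2 * real n * C\<^sup>2 + C\<^sup>2 / (1 - \<rho>)) * (real (2 * n) * err n) + C\<^sup>2 * \<rho> ^ nat (2 * int n - int i) / (1 - \<rho>)"
  define K where "K = real (nat (2 * \<beta> + 1)) * C * (C\<^sup>2 / (1 - \<rho>))"
  have half: "\<forall>\<^sub>F n in sequentially. real (2 * n) * err n < 1 / 2"
    using order_tendstoD(2)[OF n_err, of "1/2"] by simp
  have large: "\<forall>\<^sub>F n in sequentially. n > i + j" by (rule eventually_gt_at_top)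
  have "\<forall>\<^sub>F n in sequentially. norm (X n $$ (i, j) - ?s) \<le> ?b n"
    using X half large
  proof eventually_elim
    case (elim n)
    then have ij: "i < 2 * n" "j < 2 * n" by auto
    have 1: "norm (X n $$ (i, j) - RM n $$ (i, j)) \<le> 2 * (2 * real n * C\<^sup>2 + C\<^sup>2 / (1 - \<rho>)) * (real (2 * n) * err n)"
      by (rule mat_perturbation(2)[of "TT n"])
        (use elim TT_RM RM_bound ij in \<open>auto simp: TT_def RM_def\<close>)
    have "PP n (int i) (int j) = ?s" unfolding PP_def
    proof (rule sum.mono_neutral_right)
      show "\<forall>k\<in>{0..<2 * int n} - {0..int j + 1}. L' (int i) k * U' k (int j) = 0"
      proof
        fix k assume "k \<in> {0..<2 * int n} - {0..int j + 1}"
        then have "int j div 2 < k div 2" by auto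
        then show "L' (int i) k * U' k (int j) = 0" using upper by simp
      qed
    qed (use elim in auto)
    then have "RM n $$ (i, j) - ?s = QQ n (int i) (int j) - V (int i) (int j)"
      using ij by (simp add: RM_def RR_def)
    then have 2: "norm (RM n $$ (i, j) - ?s) \<le> C\<^sup>2 * \<rho> ^ nat (2 * int n - int i) / (1 - \<rho>)"
      using QQ_V[of "int j" "int i" n] ij by simp
    show ?case using 1 2 norm_triangle_ineq[of "X n $$ (i, j) - RM n $$ (i, j)" "RM n $$ (i, j) - ?s"] by simp
  qed
  moreover have "?b \<longlonglongrightarrow> 0"
  proof -
    have "(\<lambda>n. 8 * C\<^sup>2 * K * ((real n * \<rho> ^ n) * (real n * \<rho> ^ n)) + 4 * K * (C\<^sup>2 / (1 - \<rho>)) * ((real n * \<rho> ^ n) * \<rho> ^ n))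
        \<longlonglongrightarrow> 8 * C\<^sup>2 * K * (0 * 0) + 4 * K * (C\<^sup>2 / (1 - \<rho>)) * (0 * 0)"
      by (intro tendsto_add tendsto_mult tendsto_const n_rho LIMSEQ_power_zero) (use \<rho> in auto)
    moreover have "8 * C\<^sup>2 * K * ((real n * \<rho> ^ n) * (real n * \<rho> ^ n)) + 4 * K * (C\<^sup>2 / (1 - \<rho>)) * ((real n * \<rho> ^ n) * \<rho> ^ n)
       = 2 * (2 * real n * C\<^sup>2 + C\<^sup>2 / (1 - \<rho>)) * (real (2 * n) * err n)" for n
      unfolding err_def K_def[symmetric] by (simp add: power_mult power2_eq_square power_mult_distrib algebra_simps)
    ultimately have 1: "(\<lambda>n. 2 * (2 * real n * C\<^sup>2 + C\<^sup>2 / (1 - \<rho>)) * (real (2 * n) * err n)) \<longlonglongrightarrow> 0" by simp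
    have "filterlim (\<lambda>n. nat (2 * int n - int i)) at_top sequentially"
      by (rule filterlim_at_top_mono[OF filterlim_ident[of sequentially, THEN filterlim_compose[OF filterlim_minus_const_nat_at_top[of i]]]])
        (auto intro!: always_eventually)
    then have "(\<lambda>n. \<rho> ^ nat (2 * int n - int i)) \<longlonglongrightarrow> 0"
      using filterlim_compose[OF LIMSEQ_power_zero[of \<rho>]] \<rho> by simp
    then have "(\<lambda>n. C\<^sup>2 * \<rho> ^ nat (2 * int n - int i) / (1 - \<rho>)) \<longlonglongrightarrow> C\<^sup>2 * 0 / (1 - \<rho>)"
      by (intro tendsto_divide tendsto_mult tendsto_const) (use \<rho> in auto)
    with 1 show ?thesis using tendsto_add by fastforce
  qed
  ultimately have "(\<lambda>n. X n $$ (i, j) - ?s) \<longlonglongrightarrow> 0"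
    by (rule Lim_null_comparison)
  then show ?thesis by (simp add: LIM_zero_iff)
qed

end

section \<open>Two by two matrices and matrix symbols\<close>

lemma mat2_carrier [simp]: "mat2 p q r s \<in> carrier_mat 2 2"
  by (simp add: mat2_def mat_of_rows_list_def numeral_2_eq_2)

lemma sq_mult_carrier: "X \<in> carrier_mat n n \<Longrightarrow> Y \<in> carrier_mat n n \<Longrightarrow> X * Y \<in> carrier_mat n n"
  by (rule mult_carrier_mat)

lemma sq_assoc:
  "X \<in> carrier_mat n n \<Longrightarrow> Y \<in> carrier_mat n n \<Longrightarrow> Z \<in> carrier_mat n n \<Longrightarrow> X * Y * Z = X * (Y * (Z :: 'a::semiring_0 mat))"
  by (rule assoc_mult_mat)

lemma mat2_index [simp]:
  "mat2 p q r s $$ (0, 0) = p" "mat2 p q r s $$ (0, Suc 0) = q"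
  "mat2 p q r s $$ (Suc 0, 0) = r" "mat2 p q r s $$ (Suc 0, Suc 0) = s"
  by (simp_all add: mat2_def mat_of_rows_list_def)

lemma less_2_cases_nat: "(r::nat) < 2 \<Longrightarrow> r = 0 \<or> r = Suc 0"
  by auto

lemma mat2_eqI:
  assumes "X \<in> carrier_mat 2 2" "Y \<in> carrier_mat 2 2"
    and "X $$ (0, 0) = Y $$ (0, 0)" "X $$ (0, Suc 0) = Y $$ (0, Suc 0)"
      "X $$ (Suc 0, 0) = Y $$ (Suc 0, 0)" "X $$ (Suc 0, Suc 0) = Y $$ (Suc 0, Suc 0)"
  shows "X = Y"
proof (rule eq_matI)
  fix i j assume "i < dim_row Y" "j < dim_col Y"
  then have "i < 2" "j < 2" using assms by auto
  then show "X $$ (i, j) = Y $$ (i, j)" using assms less_2_cases_nat by metis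
qed (use assms in auto)

lemma mat2_mult:
  "mat2 p q r s * mat2 p' q' r' s' =
     mat2 (p * p' + q * r') (p * q' + q * s') (r * p' + s * r') (r * q' + s * (s' :: 'a::semiring_0))"
  by (rule mat2_eqI) (simp_all add: index_mult_mat2 sq_mult_carrier del: index_mult_mat(1))

lemma mat2_one: "1\<^sub>m 2 = mat2 1 0 0 1"
  by (rule mat2_eqI) simp_all

definition mat2_det :: "'a::comm_ring_1 mat \<Rightarrow> 'a" where
  "mat2_det X = X $$ (0, 0) * X $$ (Suc 0, Suc 0) - X $$ (0, Suc 0) * X $$ (Suc 0, 0)"

text \<open>The adjugate formula shows the poles and the growth of the inverse. The kernel is stated
  with \<open>mat_inverse\<close>, which is computed by elimination;
  \<open>mat_inverse_unique\<close> identifies the two.\<close>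

definition mat2_inv :: "'a::field mat \<Rightarrow> 'a mat" where
  "mat2_inv X = mat2 (X $$ (Suc 0, Suc 0) / mat2_det X) (- X $$ (0, Suc 0) / mat2_det X)
     (- X $$ (Suc 0, 0) / mat2_det X) (X $$ (0, 0) / mat2_det X)"

lemma mat2_inv_carrier [simp]: "mat2_inv X \<in> carrier_mat 2 2"
  by (simp add: mat2_inv_def)

lemma mat2_det_mult:
  assumes "X \<in> carrier_mat 2 2" "Y \<in> carrier_mat 2 2"
  shows "mat2_det (X * Y) = mat2_det X * mat2_det Y"
  using assms by (simp add: mat2_det_def index_mult_mat2 algebra_simps del: index_mult_mat(1))

lemma mat2_inv:
  assumes X: "X \<in> carrier_mat 2 2" and d: "mat2_det X \<noteq> 0"
  shows "X * mat2_inv X = 1\<^sub>m 2" "mat2_inv X * X = 1\<^sub>m 2"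
proof -
  have e: "X $$ (0, 0) * X $$ (Suc 0, Suc 0) - X $$ (0, Suc 0) * X $$ (Suc 0, 0) = mat2_det X"
    by (simp add: mat2_det_def)
  show "X * mat2_inv X = 1\<^sub>m 2" "mat2_inv X * X = 1\<^sub>m 2"
    by (rule mat2_eqI; use X d e in \<open>simp add: index_mult_mat2 mat2_inv_def sq_mult_carrier del: index_mult_mat(1) add: diff_divide_distrib[symmetric] add_divide_distrib[symmetric] mult_ac\<close>)+
qed

lemma mat_inverse_unique:
  fixes X Y :: "'a::field mat"
  assumes X: "X \<in> carrier_mat n n" and Y: "Y \<in> carrier_mat n n" and XY: "X * Y = 1\<^sub>m n"
  shows "mat_inverse X = Some Y"
proof (cases "mat_inverse X")
  case None
  have "Determinant.det X * Determinant.det Y = 1" using det_mult[OF X Y] XY by simp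
  then have "Determinant.det X \<noteq> 0" by auto
  then have "X \<in> Units (ring_mat TYPE('a) n ())" by (rule det_non_zero_imp_unit[OF X])
  then show ?thesis using mat_inverse(1)[OF X None, of "()"] by simp
next
  case (Some Z)
  have Z: "X * Z = 1\<^sub>m n" "Z * X = 1\<^sub>m n" "Z \<in> carrier_mat n n" using mat_inverse(2)[OF X Some] by auto
  have "Z = Z * (X * Y)" using XY Z by simp
  also have "\<dots> = Y" using assoc_mult_mat[OF Z(3) X Y] Z Y by simp
  finally show ?thesis using Some by simp
qed

lemma mat_inverse_mat2:
  assumes "X \<in> carrier_mat 2 2" "mat2_det X \<noteq> 0"
  shows "the (mat_inverse X) = mat2_inv X"
  using mat_inverse_unique[OF assms(1) mat2_inv_carrier mat2_inv(1)[OF assms]] by simp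

lemma pow_mat_add: "X \<in> carrier_mat n n \<Longrightarrow> X ^\<^sub>m (j + k) = X ^\<^sub>m j * X ^\<^sub>m k"
  by (induction k) (simp_all add: sq_assoc[of _ n] sq_mult_carrier pow_carrier_mat)

lemma pow_mat_commute:
  assumes X: "X \<in> carrier_mat n n" and Y: "Y \<in> carrier_mat n n" and c: "X * Y = Y * X"
  shows "X ^\<^sub>m k * Y = Y * X ^\<^sub>m k"
proof (induction k)
  case 0
  then show ?case using X Y by simp
next
  case (Suc k)
  have Xk: "X ^\<^sub>m k \<in> carrier_mat n n" using X by (rule pow_carrier_mat)
  have "X ^\<^sub>m Suc k * Y = X ^\<^sub>m k * (X * Y)" using assoc_mult_mat[OF Xk X Y] by simp
  also have "\<dots> = (X ^\<^sub>m k * Y) * X" unfolding c using assoc_mult_mat[OF Xk Y X] by simp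
  also have "\<dots> = Y * X ^\<^sub>m Suc k" unfolding Suc.IH using assoc_mult_mat[OF Y Xk X] by simp
  finally show ?case .
qed

lemma pow_mat_commute2:
  assumes "X \<in> carrier_mat n n" "Y \<in> carrier_mat n n" "X * Y = Y * X"
  shows "X ^\<^sub>m j * Y ^\<^sub>m k = Y ^\<^sub>m k * X ^\<^sub>m j"
  using pow_mat_commute[OF assms(2) pow_carrier_mat[OF assms(1)] pow_mat_commute[OF assms, symmetric], of k j] by simp

lemma pow_mat_mult:
  assumes X: "X \<in> carrier_mat n n" and Y: "Y \<in> carrier_mat n n" and c: "X * Y = Y * X"
  shows "(X * Y) ^\<^sub>m k = X ^\<^sub>m k * Y ^\<^sub>m k"
proof (induction k)
  case 0
  then show ?case using X Y by simp
next
  case (Suc k)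
  have Xk: "X ^\<^sub>m k \<in> carrier_mat n n" and Yk: "Y ^\<^sub>m k \<in> carrier_mat n n" using X Y by (auto intro: pow_carrier_mat)
  have "(X * Y) ^\<^sub>m Suc k = X ^\<^sub>m k * Y ^\<^sub>m k * (X * Y)" using Suc.IH by simp
  also have "\<dots> = X ^\<^sub>m k * (Y ^\<^sub>m k * X) * Y"
    using X Y Xk Yk by (simp add: sq_assoc[of _ n] sq_mult_carrier)
  also have "Y ^\<^sub>m k * X = X * Y ^\<^sub>m k" by (rule pow_mat_commute[OF Y X c[symmetric]])
  also have "X ^\<^sub>m k * (X * Y ^\<^sub>m k) * Y = X ^\<^sub>m Suc k * Y ^\<^sub>m Suc k"
    using X Y Xk Yk by (simp add: sq_assoc[of _ n] sq_mult_carrier)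
  finally show ?case .
qed

lemma pow_mat_one: "(1\<^sub>m n :: 'a::semiring_1 mat) ^\<^sub>m k = 1\<^sub>m n"
  by (induction k) simp_all

lemma pow_mat_inv:
  assumes X: "X \<in> carrier_mat n n" "Y \<in> carrier_mat n n" and i: "X * Y = 1\<^sub>m n" "Y * X = 1\<^sub>m n"
  shows "X ^\<^sub>m k * Y ^\<^sub>m k = 1\<^sub>m n"
  using pow_mat_mult[OF X, of k] i pow_mat_one by metis

text \<open>Since \<open>A\<close> and \<open>B\<close> commute, powers of the product split in
  either order and inverse powers cancel partially. The first two identities give the two factors of
  the kernel; the first with \<open>m = 0\<close> and the last three give Wiener--Hopf
  relations.\<close>

lemma commuting_pair_identities:
  fixes A B A' B' :: "'a::field mat"
  assumes car: "A \<in> carrier_mat n n" "B \<in> carrier_mat n n" "A' \<in> carrier_mat n n" "B' \<in> carrier_mat n n"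
    and inv: "A * A' = 1\<^sub>m n" "A' * A = 1\<^sub>m n" "B * B' = 1\<^sub>m n" "B' * B = 1\<^sub>m n"
    and comm: "A * B = B * A" and m: "m \<le> k"
  shows "(A * B) ^\<^sub>m (k - m) * B' ^\<^sub>m k = A ^\<^sub>m (k - m) * B' ^\<^sub>m m"
    and "A' ^\<^sub>m k * (A * B) ^\<^sub>m m = A' ^\<^sub>m (k - m) * B ^\<^sub>m m"
    and "(A * B) ^\<^sub>m k * A' ^\<^sub>m k = B ^\<^sub>m k"
    and "A' ^\<^sub>m k * B' ^\<^sub>m k = B' ^\<^sub>m k * A' ^\<^sub>m k"
    and "(A * B) ^\<^sub>m k * (B' ^\<^sub>m k * A' ^\<^sub>m k) = 1\<^sub>m n"
proof -
  note pc [simp] = pow_carrier_mat[OF car(1)] pow_carrier_mat[OF car(2)] pow_carrier_mat[OF car(3)] pow_carrier_mat[OF car(4)]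
  note as = sq_assoc[of _ n] sq_mult_carrier
  have P: "(A * B) ^\<^sub>m j = A ^\<^sub>m j * B ^\<^sub>m j" for j by (rule pow_mat_mult[OF car(1,2) comm])
  have BB': "B ^\<^sub>m j * B' ^\<^sub>m j = 1\<^sub>m n" and AA': "A ^\<^sub>m j * A' ^\<^sub>m j = 1\<^sub>m n" and A'A: "A' ^\<^sub>m j * A ^\<^sub>m j = 1\<^sub>m n" for j
    using pow_mat_inv car inv by blast+
  have k: "k = (k - m) + m" using m by simp
  have "(A * B) ^\<^sub>m (k - m) * B' ^\<^sub>m k = A ^\<^sub>m (k - m) * B ^\<^sub>m (k - m) * (B' ^\<^sub>m (k - m) * B' ^\<^sub>m m)"
    using pow_mat_add[OF car(4), of "k - m" m] k P by simp
  also have "\<dots> = A ^\<^sub>m (k - m) * (B ^\<^sub>m (k - m) * B' ^\<^sub>m (k - m)) * B' ^\<^sub>m m" by (simp add: as)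
  finally show "(A * B) ^\<^sub>m (k - m) * B' ^\<^sub>m k = A ^\<^sub>m (k - m) * B' ^\<^sub>m m"
    unfolding BB' by (simp add: right_mult_one_mat[OF pc(1)])
  have "A' ^\<^sub>m k * (A * B) ^\<^sub>m m = A' ^\<^sub>m (k - m) * A' ^\<^sub>m m * (A ^\<^sub>m m * B ^\<^sub>m m)"
    using pow_mat_add[OF car(3), of "k - m" m] k P by simp
  also have "\<dots> = A' ^\<^sub>m (k - m) * (A' ^\<^sub>m m * A ^\<^sub>m m) * B ^\<^sub>m m" by (simp add: as)
  finally show "A' ^\<^sub>m k * (A * B) ^\<^sub>m m = A' ^\<^sub>m (k - m) * B ^\<^sub>m m"
    unfolding A'A by (simp add: right_mult_one_mat[OF pc(3)])
  have "(A * B) ^\<^sub>m k * A' ^\<^sub>m k = B ^\<^sub>m k * A ^\<^sub>m k * A' ^\<^sub>m k"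
    unfolding P using pow_mat_commute2[OF car(1,2) comm, of k k] by simp
  also have "\<dots> = B ^\<^sub>m k * (A ^\<^sub>m k * A' ^\<^sub>m k)" by (simp add: as)
  finally show "(A * B) ^\<^sub>m k * A' ^\<^sub>m k = B ^\<^sub>m k"
    unfolding AA' by (simp add: right_mult_one_mat[OF pc(2)])
  \<comment> \<open>Inverses of commuting matrices commute: insert the identity as
    \<open>(B' A') (A B)\<close> on the left and exchange \<open>A\<close> and
    \<open>B\<close>.\<close>
  have "A' * B' = (B' * A') * (A * B) * (A' * B')"
  proof -
    have "(B' * A') * (A * B) = B' * (A' * A) * B" using car by (simp add: as)
    then have "(B' * A') * (A * B) = 1\<^sub>m n" using inv car by (simp add: right_mult_one_mat[OF car(4)])
    then show ?thesis using left_mult_one_mat[OF mult_carrier_mat[OF car(3,4)]] by simp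
  qed
  also have "\<dots> = (B' * A') * (B * (A * A') * B')" unfolding comm using car by (simp add: as)
  also have "\<dots> = B' * A'" using inv car by (simp add: right_mult_one_mat[OF car(2)] right_mult_one_mat[OF mult_carrier_mat[OF car(4,3)]])
  finally have comm': "A' * B' = B' * A'" .
  show "A' ^\<^sub>m k * B' ^\<^sub>m k = B' ^\<^sub>m k * A' ^\<^sub>m k" by (rule pow_mat_commute2[OF car(3,4) comm'])
  have "(A * B) ^\<^sub>m k * (B' ^\<^sub>m k * A' ^\<^sub>m k) = A ^\<^sub>m k * (B ^\<^sub>m k * B' ^\<^sub>m k) * A' ^\<^sub>m k"
    unfolding P by (simp add: as)
  then show "(A * B) ^\<^sub>m k * (B' ^\<^sub>m k * A' ^\<^sub>m k) = 1\<^sub>m n"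
    unfolding BB' by (simp add: right_mult_one_mat[OF pc(1)] AA')
qed

section \<open>Holomorphic matrix symbols\<close>

definition mat_holomorphic :: "complex set \<Rightarrow> (complex \<Rightarrow> complex mat) \<Rightarrow> bool" where
  "mat_holomorphic S F \<longleftrightarrow> (\<forall>z. F z \<in> carrier_mat 2 2) \<and> (\<forall>r<2. \<forall>s<2. (\<lambda>z. F z $$ (r, s)) holomorphic_on S)"

lemma mat_holomorphicD:
  assumes "mat_holomorphic S F"
  shows "F z \<in> carrier_mat 2 2" "r < 2 \<Longrightarrow> s < 2 \<Longrightarrow> (\<lambda>z. F z $$ (r, s)) holomorphic_on S"
  using assms by (auto simp: mat_holomorphic_def)

lemma mat_holomorphic_subset: "mat_holomorphic S F \<Longrightarrow> T \<subseteq> S \<Longrightarrow> mat_holomorphic T F"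
  unfolding mat_holomorphic_def by (auto intro: holomorphic_on_subset[of _ S T])

lemma mat_holomorphic_mat2:
  assumes "f holomorphic_on S" "g holomorphic_on S" "h holomorphic_on S" "k holomorphic_on S"
  shows "mat_holomorphic S (\<lambda>z. mat2 (f z) (g z) (h z) (k z))"
  unfolding mat_holomorphic_def using assms by (auto dest!: less_2_cases_nat)

lemma mat_holomorphic_mult:
  assumes F: "mat_holomorphic S F" and G: "mat_holomorphic S G"
  shows "mat_holomorphic S (\<lambda>z. F z * G z)"
proof -
  have "(F z * G z) $$ (r, s) = F z $$ (r, 0) * G z $$ (0, s) + F z $$ (r, 1) * G z $$ (1, s)" if "r < 2" "s < 2" for r s z
    using index_mult_mat2[OF mat_holomorphicD(1)[OF F] mat_holomorphicD(1)[OF G] that] .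
  then show ?thesis unfolding mat_holomorphic_def
    using mat_holomorphicD[OF F] mat_holomorphicD[OF G]
    by (auto intro!: holomorphic_on_add holomorphic_on_mult sq_mult_carrier)
qed

lemma mat_holomorphic_pow:
  assumes F: "mat_holomorphic S F"
  shows "mat_holomorphic S (\<lambda>z. F z ^\<^sub>m k)"
proof (induction k)
  case 0
  have "F z ^\<^sub>m 0 = mat2 1 0 0 1" for z
    using mat_holomorphicD(1)[OF F, of z] by (simp add: mat2_one)
  then show ?case by (simp only:) (intro mat_holomorphic_mat2 holomorphic_on_const)
next
  case (Suc k)
  then show ?case using mat_holomorphic_mult[OF Suc.IH F] by simp
qed

lemma mat_holomorphic_inv:
  assumes F: "mat_holomorphic S F" and d: "\<And>z. z \<in> S \<Longrightarrow> mat2_det (F z) \<noteq> 0"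
  shows "mat_holomorphic S (\<lambda>z. mat2_inv (F z))"
  unfolding mat2_inv_def
  using d unfolding mat2_det_def
  by (intro mat_holomorphic_mat2 holomorphic_on_divide holomorphic_on_diff holomorphic_on_mult holomorphic_on_minus mat_holomorphicD(2)[OF F]) auto

lemma mat_holomorphic_disc: "mat_holomorphic (ball 0 R) F \<Longrightarrow> R > 1 \<Longrightarrow> disc_holomorphic F"
  unfolding mat_holomorphic_def disc_holomorphic_def by (auto intro!: exI[of _ R])

lemma mat_holomorphic_circle: "mat_holomorphic S F \<Longrightarrow> sphere 0 1 \<subseteq> S \<Longrightarrow> circle_continuous F"
  unfolding mat_holomorphic_def circle_continuous_def
  by (auto intro: continuous_on_subset[OF holomorphic_on_imp_continuous_on, of _ S "sphere 0 1"])

text \<open>An entry of a product of two by two matrices is a sum of two terms, whence a factor 2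
  per multiplication.\<close>

lemma pow_mat2_bound:
  fixes X :: "complex mat"
  assumes X: "X \<in> carrier_mat 2 2" and b: "\<And>r s. r < 2 \<Longrightarrow> s < 2 \<Longrightarrow> norm (X $$ (r, s)) \<le> M"
  shows "r < 2 \<Longrightarrow> s < 2 \<Longrightarrow> norm ((X ^\<^sub>m k) $$ (r, s)) \<le> (2 * M) ^ k"
proof (induction k arbitrary: r s)
  case 0
  then show ?case using X by (auto dest!: less_2_cases_nat)
next
  case (Suc k)
  have M: "M \<ge> 0" by (rule order_trans[OF norm_ge_zero b[of 0 0]]) simp_all
  have Xk: "X ^\<^sub>m k \<in> carrier_mat 2 2" using X by (rule pow_carrier_mat)
  have "norm ((X ^\<^sub>m Suc k) $$ (r, s)) = norm ((X ^\<^sub>m k) $$ (r, 0) * X $$ (0, s) + (X ^\<^sub>m k) $$ (r, 1) * X $$ (1, s))"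
    using index_mult_mat2[OF Xk X Suc.prems] by simp
  also have "\<dots> \<le> norm ((X ^\<^sub>m k) $$ (r, 0)) * norm (X $$ (0, s)) + norm ((X ^\<^sub>m k) $$ (r, 1)) * norm (X $$ (1, s))"
    using norm_triangle_ineq by (metis norm_mult)
  also have "\<dots> \<le> (2 * M) ^ k * M + (2 * M) ^ k * M"
    by (intro add_mono mult_mono Suc.IH b) (use Suc.prems M in auto)
  finally show ?case by (simp add: mult_ac)
qed

section \<open>Triangularity and decay of block Laurent matrices\<close>

lemma laurent_op_eq_0_left:
  assumes F: "disc_holomorphic F" and uv: "v div 2 < u div 2"
  shows "laurent_op F u v = 0"
proof -
  obtain R where "R > 1" "(\<lambda>z. F z $$ (nat (u mod 2), nat (v mod 2))) holomorphic_on ball 0 R"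
    using F nat_mod_2_less unfolding disc_holomorphic_def by blast
  then show ?thesis unfolding laurent_op_def using holomorphic_circle_coeffs(1) uv by simp
qed

text \<open>Lower triangularity is read off at infinity, by enlarging the contour, just as upper
  triangularity is read off at 0.\<close>

lemma laurent_op_growth:
  assumes F: "mat_holomorphic (- {s}) F" and s: "norm s < 1"
    and g: "\<And>z r q. norm z \<ge> 1 \<Longrightarrow> r < 2 \<Longrightarrow> q < 2 \<Longrightarrow> norm (F z $$ (r, q)) \<le> M * norm z powi k"
    and uv: "v div 2 - u div 2 > k"
  shows "laurent_op F u v = 0"
  unfolding laurent_op_def
  by (rule lcoef_growth[of "{s}" _ M k])
    (use s uv in \<open>auto intro!: mat_holomorphicD(2)[OF F] nat_mod_2_less g\<close>)

lemma uniform_bound_entries: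
  fixes f :: "nat \<Rightarrow> nat \<Rightarrow> 'b \<Rightarrow> real"
  assumes "\<And>r s. r < 2 \<Longrightarrow> s < 2 \<Longrightarrow> \<exists>M. \<forall>i. f r s i \<le> M"
  shows "\<exists>M\<ge>0. \<forall>r<2. \<forall>s<2. \<forall>i. f r s i \<le> M"
proof -
  obtain M where M: "\<And>r s i. r < 2 \<Longrightarrow> s < 2 \<Longrightarrow> f r s i \<le> M r s" using assms by metis
  define K where "K = (\<Sum>r<2. \<Sum>s<2. \<bar>M r s\<bar>)"
  have "f r s i \<le> K" if "r < 2" "s < 2" for r s i
  proof -
    have "f r s i \<le> \<bar>M r s\<bar>" using M[OF that, of i] by simp
    also have "\<dots> \<le> (\<Sum>s<2. \<bar>M r s\<bar>)" by (rule member_le_sum) (use that in auto)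
    also have "\<dots> \<le> K" unfolding K_def
      by (rule member_le_sum[of r "{..<2}" "\<lambda>r. \<Sum>s<2. \<bar>M r s\<bar>"]) (use that in \<open>auto intro!: sum_nonneg\<close>)
    finally show ?thesis .
  qed
  moreover have "K \<ge> 0" unfolding K_def by (intro sum_nonneg) auto
  ultimately show ?thesis by blast
qed

lemma laurent_op_bounded:
  assumes F: "circle_continuous F"
  obtains M where "M \<ge> 0" "\<And>u v. norm (laurent_op F u v) \<le> M"
proof -
  have "\<exists>M. \<forall>i. norm (lcoef (\<lambda>z. F z $$ (r, s)) i) \<le> M" if "r < 2" "s < 2" for r s
  proof -
    have c: "continuous_on (sphere 0 1) (\<lambda>z. F z $$ (r, s))" using F that by (auto simp: circle_continuous_def)
    obtain M where "\<And>z. z \<in> sphere 0 1 \<Longrightarrow> norm (F z $$ (r, s)) \<le> M"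
      using continuous_on_sphere_bounded[OF c] by metis
    then show ?thesis using lcoef_bound[OF c] by blast
  qed
  from uniform_bound_entries[of "\<lambda>r s i. norm (lcoef (\<lambda>z. F z $$ (r, s)) i)", OF this]
  obtain M where "M \<ge> 0" "\<forall>r<2. \<forall>s<2. \<forall>i. norm (lcoef (\<lambda>z. F z $$ (r, s)) i) \<le> M" by blast
  then show ?thesis using that[of M] nat_mod_2_less unfolding laurent_op_def by blast
qed

text \<open>Moving the contour to radius \<open>r\<close> turns analyticity into exponential decay:
  \<open>r > 1\<close> serves symbols analytic inside the circle, \<open>r < 1\<close> those
  analytic outside.\<close>

lemma laurent_op_radius_bound:
  assumes F: "mat_holomorphic (- {p}) F" and r: "r > 0"
    and pos: "(norm p < 1 \<and> norm p < r) \<or> (norm p > 1 \<and> norm p > r)"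
  obtains M where "M \<ge> 0" "\<And>u v. norm (laurent_op F u v) \<le> M * r powi (u div 2 - v div 2)"
proof -
  have "\<exists>M. \<forall>i. norm (lcoef (\<lambda>z. F z $$ (q, s)) i) * r powi i \<le> M" if "q < 2" "s < 2" for q s
  proof -
    have h: "(\<lambda>z. F z $$ (q, s)) holomorphic_on - {p}" by (rule mat_holomorphicD(2)[OF F that])
    have "continuous_on (sphere 0 r) (\<lambda>z. F z $$ (q, s))"
      by (rule holomorphic_on_imp_continuous_on[OF holomorphic_on_subset[OF h]]) (use pos in auto)
    then have "bounded ((\<lambda>z. F z $$ (q, s)) ` sphere 0 r)"
      by (intro compact_imp_bounded compact_continuous_image) auto
    then obtain M where M: "\<forall>x\<in>(\<lambda>z. F z $$ (q, s)) ` sphere 0 r. norm x \<le> M" unfolding bounded_pos by blast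
    have "norm (lcoef (\<lambda>z. F z $$ (q, s)) i) \<le> M * r powi (- i)" for i
      by (rule lcoef_radius_bound[of "{p}", OF _ _ r]) (use h pos M in auto)
    then have "norm (lcoef (\<lambda>z. F z $$ (q, s)) i) * r powi i \<le> M * r powi (- i) * r powi i" for i
      using r by (intro mult_right_mono) auto
    moreover have "M * r powi (- i) * r powi i = M" for i using r by (simp add: power_int_minus)
    ultimately show ?thesis by metis
  qed
  from uniform_bound_entries[of "\<lambda>q s i. norm (lcoef (\<lambda>z. F z $$ (q, s)) i) * r powi i", OF this]
  obtain M where M: "M \<ge> 0" "\<forall>q<2. \<forall>s<2. \<forall>i. norm (lcoef (\<lambda>z. F z $$ (q, s)) i) * r powi i \<le> M" by blast
  show ?thesis
  proof (rule that[OF M(1)])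
    fix u v :: int
    let ?i = "v div 2 - u div 2"
    have "norm (laurent_op F u v) * r powi ?i \<le> M"
      unfolding laurent_op_def using M(2) nat_mod_2_less by blast
    then have "norm (laurent_op F u v) * r powi ?i * r powi (- ?i) \<le> M * r powi (- ?i)"
      using r by (intro mult_right_mono) auto
    moreover have "r powi ?i * r powi (- ?i) = 1"
      using r by (subst power_int_minus) simp
    ultimately have "norm (laurent_op F u v) \<le> M * r powi (- ?i)"
      by (simp only: mult.assoc mult_1_right)
    then show "norm (laurent_op F u v) \<le> M * r powi (u div 2 - v div 2)" by simp
  qed
qed

lemma laurent_op_one: "laurent_op (\<lambda>_. 1\<^sub>m 2) u v = of_bool (u = v)"
proof -
  have one: "lcoef (\<lambda>_. 1) k = of_bool (k = 0)" for k using lcoef_powi[of 0 k] by simp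
  have zero: "lcoef (\<lambda>_. 0) k = 0" for k by (simp add: lcoef_def)
  have "u = v \<longleftrightarrow> u div 2 = v div 2 \<and> u mod 2 = v mod 2" by (metis mult_div_mod_eq)
  moreover have "nat (u mod 2) = nat (v mod 2) \<longleftrightarrow> u mod 2 = v mod 2" by (simp add: eq_nat_nat_iff)
  ultimately show ?thesis unfolding laurent_op_def using nat_mod_2_less one zero
    by (auto simp: one zero)
qed

section \<open>The symbol of the hexagon\<close>

lemma laurent_op_affine:
  "laurent_op (\<lambda>z. mat2 p q (r * z) s) u v =
     (if v = u then (if even u then p else s) else if v = u + 1 then (if even u then q else r) else 0)"
proof -
  have const: "lcoef (\<lambda>_. w) k = w * of_bool (k = 0)" for w k
    using lcoef_cmult[of "\<lambda>_. 1" w k] lcoef_powi[of 0 k] by simp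
  have lin: "lcoef (\<lambda>z. w * z) k = w * of_bool (k = 1)" for w k
    using lcoef_cmult[of "\<lambda>z. z" w k] lcoef_powi[of 1 k] by (simp add: continuous_on_id)
  define x i y j where "x = u div 2" and "i = u mod 2" and "y = v div 2" and "j = v mod 2"
  have u: "u = 2 * x + i" and v: "v = 2 * y + j" by (simp_all add: x_def i_def y_def j_def)
  have ij: "i = 0 \<or> i = 1" "j = 0 \<or> j = 1" by (auto simp: i_def j_def)
  have even: "even u \<longleftrightarrow> i = 0" by (auto simp: i_def)
  have op: "laurent_op (\<lambda>z. mat2 p q (r * z) s) u v =
     (if i = 0 then (if j = 0 then p * of_bool (y - x = 0) else q * of_bool (y - x = 0))
      else (if j = 0 then r * of_bool (y - x = 1) else s * of_bool (y - x = 0)))"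
    unfolding laurent_op_def x_def[symmetric] y_def[symmetric] i_def[symmetric] j_def[symmetric]
    using ij by (auto simp: const lin)
  have lt: "2 * y + k \<noteq> 2 * x + l" "2 * y + k \<noteq> 2 * x + l + 1" if "y < x \<or> y > x + 1" "k \<in> {0, 1}" "l \<in> {0, 1}" for k l
    using that by auto
  consider "y = x" | "y = x + 1" | "y < x \<or> y > x + 1" by linarith
  then show ?thesis
  proof cases
    case 1
    then show ?thesis unfolding op even using ij u v by auto
  next
    case 2
    then show ?thesis unfolding op even using ij u v by auto
  next
    case 3
    have "v \<noteq> u" "v \<noteq> u + 1" unfolding u v using lt[OF 3, of j i] ij by auto
    then show ?thesis unfolding op using 3 by auto
  qed
qed

text \<open>Passes from decay in the block distance \<open>i\<close> to decay in the index distance,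
  which is at most \<open>2 i + 1\<close>: the rate becomes a square root, and the extra 1 costs the
  factor \<open>1 / sqrt \<sigma>\<close>.\<close>

lemma decay_half:
  assumes \<sigma>: "0 < \<sigma>" "\<sigma> < (1::real)" and i: "\<bar>x - y\<bar> \<le> 2 * i + 1" "i \<ge> 0"
  shows "\<sigma> ^ nat i \<le> (1 / sqrt \<sigma>) * sqrt \<sigma> ^ nat \<bar>x - y\<bar>"
proof -
  have "\<sigma> ^ nat i * sqrt \<sigma> = sqrt \<sigma> ^ (2 * nat i + 1)" using \<sigma> by (simp add: power_mult)
  also have "\<dots> \<le> sqrt \<sigma> ^ nat \<bar>x - y\<bar>" by (rule power_decreasing) (use \<sigma> i in auto)
  finally show ?thesis using \<sigma> by (simp add: field_simps)
qed

lemma has_sum_int_shift: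
  fixes f :: "int \<Rightarrow> complex"
  shows "(f has_sum s) UNIV \<Longrightarrow> ((\<lambda>k. f (k + t)) has_sum s) UNIV"
  by (subst has_sum_reindex_bij_betw[of "\<lambda>k. k + t" UNIV UNIV f])
    (auto intro!: bij_betw_byWitness[of _ "\<lambda>k. k - t"])

context hexagon
begin

abbreviation "AA \<equiv> A_mat a b c d \<alpha> \<beta> \<gamma> \<delta>"
abbreviation "BB \<equiv> B_mat a b c d \<alpha> \<beta> \<gamma> \<delta>"
abbreviation "C\<equiv> complex_of_real"

definition "sm = complex_of_real (mu_par a b c d \<alpha> \<beta> \<gamma> \<delta> powr (1/2))"
definition "im = complex_of_real (mu_par a b c d \<alpha> \<beta> \<gamma> \<delta> powr (-1/2))"
definition "sn = complex_of_real (nu_par a b c d \<alpha> \<beta> \<gamma> \<delta> powr (1/2))"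
definition "iin = complex_of_real (nu_par a b c d \<alpha> \<beta> \<gamma> \<delta> powr (-1/2))"

lemma par_pos: "mu_par a b c d \<alpha> \<beta> \<gamma> \<delta> > 0" "nu_par a b c d \<alpha> \<beta> \<gamma> \<delta> > 0"
  using pos by (auto simp: mu_par_def nu_par_def intro!: divide_pos_pos add_pos_pos mult_pos_pos)

text \<open>The last four relations are the definitions of \<mu> and \<nu> cleared of denominators,
  in the form needed to match the off-diagonal entries in \<open>swap_mu\<close> and
  \<open>swap_nu\<close>; the diagonal entries match by themselves.\<close>

lemma par_rels:
  "sm * im = 1" "im * sm = 1" "sn * iin = 1" "iin * sn = 1"
  "sm * sm * (c * \<alpha> + d * \<gamma>) = a * \<beta> + b * \<delta>" "im * im * (a * \<beta> + b * \<delta>) = c * \<alpha> + d * \<gamma>"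
  "sn * sn * (b * \<alpha> + d * \<beta>) = a * \<gamma> + c * \<delta>" "iin * iin * (a * \<gamma> + c * \<delta>) = b * \<alpha> + d * \<beta>"
proof -
  have h: "x powr (1/2) * x powr (-1/2) = 1" "x powr (-1/2) * x powr (1/2) = 1"
     "x powr (1/2) * x powr (1/2) = x" "x powr (-1/2) * x powr (-1/2) = 1 / x" if "x > 0" for x :: real
    using that by (simp_all add: powr_add[symmetric] powr_minus_divide)
  show "sm * im = 1" "im * sm = 1" "sn * iin = 1" "iin * sn = 1"
    unfolding sm_def im_def sn_def iin_def of_real_mult[symmetric] using h par_pos by simp_all
  have nz: "c * \<alpha> + d * \<gamma> > 0" "a * \<beta> + b * \<delta> > 0" "b * \<alpha> + d * \<beta> > 0" "a * \<gamma> + c * \<delta> > 0"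
    using pos by (auto intro!: add_pos_pos mult_pos_pos)
  show "sm * sm * (c * \<alpha> + d * \<gamma>) = a * \<beta> + b * \<delta>" "im * im * (a * \<beta> + b * \<delta>) = c * \<alpha> + d * \<gamma>"
    "sn * sn * (b * \<alpha> + d * \<beta>) = a * \<gamma> + c * \<delta>" "iin * iin * (a * \<gamma> + c * \<delta>) = b * \<alpha> + d * \<beta>"
    unfolding sm_def im_def sn_def iin_def of_real_mult[symmetric] of_real_eq_iff h(3)[OF par_pos(1)] h(4)[OF par_pos(1)]
      h(3)[OF par_pos(2)] h(4)[OF par_pos(2)]
    using nz by (simp_all add: mu_par_def nu_par_def)
qed

definition "fo z = mat2 (C a) (C b) (C c * z) (C d)"
definition "fe z = mat2 (C \<alpha>) (C \<beta>) (C \<gamma> * z) (C \<delta>)"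
definition "fo' z = mat2 (C a) (C c) (C b * z) (C d)"
definition "fe' z = mat2 (C \<alpha>) (C \<gamma>) (C \<beta> * z) (C \<delta>)"
definition "dm = mat2 sm 0 0 im"
definition "dm' = mat2 im 0 0 sm"
definition "dn = mat2 sn 0 0 iin"
definition "dn' = mat2 iin 0 0 sn"

lemma factor_carrier [simp]:
  "fo z \<in> carrier_mat 2 2" "fe z \<in> carrier_mat 2 2" "fo' z \<in> carrier_mat 2 2" "fe' z \<in> carrier_mat 2 2"
  "dm \<in> carrier_mat 2 2" "dm' \<in> carrier_mat 2 2" "dn \<in> carrier_mat 2 2" "dn' \<in> carrier_mat 2 2"
  by (simp_all add: fo_def fe_def fo'_def fe'_def dm_def dm'_def dn_def dn'_def)

lemma AA_eq: "AA z = dm * fe' z * dn * fe z"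
  by (simp add: A_mat_def Let_def dm_def fe'_def dn_def fe_def sm_def im_def sn_def iin_def)

lemma BB_eq: "BB z = fo z * dn' * fo' z * dm'"
  by (simp add: B_mat_def Let_def dm'_def fo'_def dn'_def fo_def sm_def im_def sn_def iin_def)

lemma diag_cancel: "dm' * dm = 1\<^sub>m 2" "dm * dm' = 1\<^sub>m 2" "dn * dn' = 1\<^sub>m 2" "dn' * dn = 1\<^sub>m 2"
  by (simp_all add: dm_def dm'_def dn_def dn'_def mat2_mult mat2_one par_rels)

text \<open>The choice of \<open>\<nu>\<close> and \<open>\<mu>\<close> makes the transition matrices of the two parities exchangeable; this is what turns
  the product \<open>fo fe fo fe\<close> over one period into \<open>A B = B A\<close>.\<close>

lemma swap_nu: "dn' * (fo' z * fe' z) * dn = fe z * fo z"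
proof -
  have e1: "iin * (C a * C \<gamma> + C c * C \<delta>) * iin = C \<alpha> * C b + C \<beta> * C d"
    using par_rels(8) by (simp add: algebra_simps)
  have e2: "sn * (C b * z * C \<alpha> + C d * (C \<beta> * z)) * sn = C \<gamma> * z * C a + C \<delta> * (C c * z)"
  proof -
    have "sn * (C b * z * C \<alpha> + C d * (C \<beta> * z)) * sn = (sn * sn * (C b * C \<alpha> + C d * C \<beta>)) * z" by (simp add: algebra_simps)
    also have "\<dots> = (C a * C \<gamma> + C c * C \<delta>) * z" using par_rels(7) by simp
    finally show ?thesis by (simp add: algebra_simps)
  qed
  have e3: "iin * x * sn = x" "sn * x * iin = x" for x using par_rels(3,4) by (simp_all add: mult_ac)
  show ?thesis
    unfolding dn_def dn'_def fo'_def fe'_def fe_def fo_def mat2_mult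
    by (simp only: mult_zero_left mult_zero_right add_0_left add_0_right e1 e2 e3) (simp add: mult_ac)
qed

lemma swap_mu: "dm * (fe' z * fo' z) * dm' = fo z * fe z"
proof -
  have e1: "sm * (C \<alpha> * C c + C \<gamma> * C d) * sm = C a * C \<beta> + C b * C \<delta>"
    using par_rels(5) by (simp add: algebra_simps)
  have e2: "im * (C \<beta> * z * C a + C \<delta> * (C b * z)) * im = C c * z * C \<alpha> + C d * (C \<gamma> * z)"
  proof -
    have "im * (C \<beta> * z * C a + C \<delta> * (C b * z)) * im = (im * im * (C a * C \<beta> + C b * C \<delta>)) * z" by (simp add: algebra_simps)
    also have "\<dots> = (C c * C \<alpha> + C d * C \<gamma>) * z" using par_rels(6) by simp
    finally show ?thesis by (simp add: algebra_simps)
  qed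
  have e3: "im * x * sm = x" "sm * x * im = x" for x using par_rels(1,2) by (simp_all add: mult_ac)
  show ?thesis
    unfolding dm_def dm'_def fo'_def fe'_def fe_def fo_def mat2_mult
    by (simp only: mult_zero_left mult_zero_right add_0_left add_0_right e1 e2 e3) (simp add: mult_ac)
qed

text \<open>In \<open>BB * AA\<close> the inner \<open>dm' dm\<close> cancels and one use of
  \<open>swap_nu\<close> finishes. In \<open>AA * BB\<close> the relation \<open>swap_nu\<close> is
  undone first, which leaves \<open>fe' fo' fe' fo'\<close> conjugated by \<open>dm\<close>;
  splitting it in the middle allows two uses of \<open>swap_mu\<close>.\<close>

lemma AABB: "AA z * BB z = fo z * fe z * fo z * fe z" and BBAA: "BB z * AA z = fo z * fe z * fo z * fe z"
proof -
  note as = sq_assoc[of _ 2] sq_mult_carrier[of _ 2]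
  have "BB z * AA z = fo z * (dn' * (fo' z * ((dm' * dm) * fe' z)) * dn) * fe z"
    unfolding AA_eq BB_eq by (simp add: as)
  also have "(dm' * dm) * fe' z = fe' z" unfolding diag_cancel by (rule left_mult_one_mat[of _ 2 2]) simp
  finally show "BB z * AA z = fo z * fe z * fo z * fe z" unfolding swap_nu by (simp add: as)
  have conj: "dn * (fe z * fo z) * dn' = fo' z * fe' z"
  proof -
    have "dn * (fe z * fo z) * dn' = (dn * dn') * (fo' z * fe' z) * (dn * dn')"
      unfolding swap_nu[symmetric] by (simp add: as)
    then show ?thesis unfolding diag_cancel
      using left_mult_one_mat[of "fo' z * fe' z" 2 2] right_mult_one_mat[of "fo' z * fe' z" 2 2] by (simp add: sq_mult_carrier)
  qed
  have "AA z * BB z = dm * (fe' z * ((dn * (fe z * fo z) * dn') * fo' z)) * dm'"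
    unfolding AA_eq BB_eq by (simp add: as)
  also have "\<dots> = dm * (fe' z * fo' z) * (1\<^sub>m 2 * ((fe' z * fo' z) * dm'))"
    unfolding conj by (simp add: as left_mult_one_mat[of _ 2 2])
  also have "\<dots> = dm * (fe' z * fo' z) * dm' * (dm * (fe' z * fo' z) * dm')"
    unfolding diag_cancel(1)[symmetric] by (simp add: as)
  finally show "AA z * BB z = fo z * fe z * fo z * fe z" unfolding swap_mu by (simp add: as)
qed

lemma AB_carrier [simp]: "AA z \<in> carrier_mat 2 2" "BB z \<in> carrier_mat 2 2"
  unfolding AA_eq BB_eq by (simp_all add: sq_mult_carrier)

lemma AB_commute: "AA z * BB z = BB z * AA z"
  unfolding AABB BBAA ..

text \<open>The diagonal factors have determinant 1, and \<open>fe'\<close> has the same determinant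
  as \<open>fe\<close>, so \<open>AA\<close> is singular only at a double zero, called
  \<open>pA\<close> below. The determinant of \<open>BB\<close> behaves alike, with
  \<open>pB\<close>.\<close>

lemma det_AA: "mat2_det (AA z) = (C (\<alpha> * \<delta>) - C (\<beta> * \<gamma>) * z)\<^sup>2"
proof -
  have "mat2_det (AA z) = mat2_det dm * mat2_det (fe' z) * mat2_det dn * mat2_det (fe z)"
    unfolding AA_eq by (simp add: mat2_det_mult sq_mult_carrier)
  moreover have "mat2_det dm = 1" "mat2_det dn = 1" by (simp_all add: mat2_det_def dm_def dn_def par_rels)
  moreover have "mat2_det (fe' z) = C (\<alpha> * \<delta>) - C (\<beta> * \<gamma>) * z" "mat2_det (fe z) = C (\<alpha> * \<delta>) - C (\<beta> * \<gamma>) * z"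
    by (simp_all add: mat2_det_def fe_def fe'_def mult_ac)
  ultimately show ?thesis by (simp add: power2_eq_square)
qed

lemma det_BB: "mat2_det (BB z) = (C (a * d) - C (b * c) * z)\<^sup>2"
proof -
  have "mat2_det (BB z) = mat2_det (fo z) * mat2_det dn' * mat2_det (fo' z) * mat2_det dm'"
    unfolding BB_eq by (simp add: mat2_det_mult sq_mult_carrier)
  moreover have "mat2_det dm' = 1" "mat2_det dn' = 1" by (simp_all add: mat2_det_def dm'_def dn'_def par_rels)
  moreover have "mat2_det (fo z) = C (a * d) - C (b * c) * z" "mat2_det (fo' z) = C (a * d) - C (b * c) * z"
    by (simp_all add: mat2_det_def fo_def fo'_def mult_ac)
  ultimately show ?thesis by (simp add: power2_eq_square)
qed

definition "pA = C ((\<alpha> * \<delta>) / (\<beta> * \<gamma>))"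
definition "pB = C ((a * d) / (b * c))"

lemma det_AA_nz: "z \<noteq> pA \<Longrightarrow> mat2_det (AA z) \<noteq> 0"
  using pos by (auto simp: det_AA pA_def field_simps)

lemma det_BB_nz: "z \<noteq> pB \<Longrightarrow> mat2_det (BB z) \<noteq> 0"
  using pos by (auto simp: det_BB pB_def field_simps)

definition "Ai z = mat2_inv (AA z)"
definition "Bi z = mat2_inv (BB z)"

lemma ABi_carrier [simp]: "Ai z \<in> carrier_mat 2 2" "Bi z \<in> carrier_mat 2 2"
  by (simp_all add: Ai_def Bi_def)

lemma factor_holomorphic:
  "mat_holomorphic S fo" "mat_holomorphic S fe" "mat_holomorphic S fo'" "mat_holomorphic S fe'"
  "mat_holomorphic S (\<lambda>_. dm)" "mat_holomorphic S (\<lambda>_. dm')" "mat_holomorphic S (\<lambda>_. dn)" "mat_holomorphic S (\<lambda>_. dn')"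
  unfolding fo_def[abs_def] fe_def[abs_def] fo'_def[abs_def] fe'_def[abs_def] dm_def dm'_def dn_def dn'_def
  by (intro mat_holomorphic_mat2 holomorphic_on_mult holomorphic_on_const holomorphic_on_ident)+

lemma AB_holomorphic: "mat_holomorphic S AA" "mat_holomorphic S BB"
  unfolding AA_eq[abs_def] BB_eq[abs_def] by (intro mat_holomorphic_mult factor_holomorphic)+

lemma Ai_holomorphic: "mat_holomorphic (- {pA}) Ai"
  unfolding Ai_def[abs_def] by (rule mat_holomorphic_inv[OF AB_holomorphic(1)]) (use det_AA_nz in auto)

lemma Bi_holomorphic: "mat_holomorphic (- {pB}) Bi"
  unfolding Bi_def[abs_def] by (rule mat_holomorphic_inv[OF AB_holomorphic(2)]) (use det_BB_nz in auto)

definition "symb m z = (if odd m then fo z else fe z)"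

lemma step_laurent: "C (step m u v) = laurent_op (symb m) u v"
  unfolding step_eq
  by (cases "odd m") (simp_all add: symb_def[abs_def] fo_def fe_def laurent_op_affine)

primrec symb_prod :: "nat \<Rightarrow> nat \<Rightarrow> complex \<Rightarrow> complex mat" where
  "symb_prod m 0 z = 1\<^sub>m 2"
| "symb_prod m (Suc k) z = symb_prod m k z * symb (m + k + 1) z"

lemma symb_holomorphic: "mat_holomorphic S (symb m)"
  unfolding symb_def[abs_def] by (cases "odd m") (simp_all add: factor_holomorphic)

lemma symb_prod_holomorphic: "mat_holomorphic S (symb_prod m k)"
proof (induction k)
  case 0
  have "symb_prod m 0 = (\<lambda>z. mat2 1 0 0 1)" by (auto simp: mat2_one)
  then show ?case by (simp only:) (intro mat_holomorphic_mat2 holomorphic_on_const)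
next
  case (Suc k)
  have "symb_prod m (Suc k) = (\<lambda>z. symb_prod m k z * symb (m + k + 1) z)" by auto
  then show ?case using mat_holomorphic_mult[OF Suc.IH symb_holomorphic] by simp
qed

lemma path_weight_symb: "C (path_weight step m k u v) = laurent_op (symb_prod m k) u v"
proof (induction k arbitrary: v)
  case 0
  have "symb_prod m 0 = (\<lambda>_. 1\<^sub>m 2)" by auto
  then show ?case by (simp add: laurent_op_one)
next
  case (Suc k)
  have sp: "symb_prod m (Suc k) = (\<lambda>z. symb_prod m k z * symb (m + k + 1) z)" by auto
  have "((\<lambda>w. laurent_op (symb_prod m k) u w * laurent_op (symb (m + k + 1)) w v) has_sum laurent_op (symb_prod m (Suc k)) u v) UNIV"
    unfolding sp
    by (rule laurent_op_mult_left[OF mat_holomorphic_disc[of 2] mat_holomorphic_circle[of UNIV]])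
      (simp_all add: symb_prod_holomorphic symb_holomorphic)
  then have "laurent_op (symb_prod m (Suc k)) u v = (\<Sum>w\<in>{v - 1, v}. laurent_op (symb_prod m k) u w * laurent_op (symb (m + k + 1)) w v)"
  proof (rule has_sum_eq_sum)
    fix w assume w: "w \<notin> {v - 1, v}"
    then have "laurent_op (symb (m + k + 1)) w v = 0"
      using bidiagonalD[OF bidiagonal_step, of v w "m + k + 1"] by (simp add: step_laurent[symmetric])
    then show "laurent_op (symb_prod m k) u w * laurent_op (symb (m + k + 1)) w v = 0" by simp
  qed simp
  moreover have "C (path_weight step m (Suc k) u v) = (\<Sum>w\<in>{v - 1, v}. laurent_op (symb_prod m k) u w * laurent_op (symb (m + k + 1)) w v)"
    unfolding path_weight.simps of_real_sum of_real_mult Suc.IH step_laurent ..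
  ultimately show ?case by (simp only:)
qed

section \<open>The symbol of one period and its growth\<close>

definition "Phi z = AA z * BB z"

lemma Phi_carrier [simp]: "Phi z \<in> carrier_mat 2 2" by (simp add: Phi_def sq_mult_carrier)

lemma Phi_holomorphic: "mat_holomorphic S Phi"
  unfolding Phi_def[abs_def] by (intro mat_holomorphic_mult AB_holomorphic)

text \<open>Between levels divisible by 4 the symbol accumulates whole periods
  \<open>fo fe fo fe\<close>, each of which equals \<open>A B\<close>.\<close>

lemma symb_prod_4: "symb_prod (4 * m) (4 * k) z = Phi z ^\<^sub>m k"
proof (induction k)
  case (Suc k)
  have e: "4 * Suc k = Suc (Suc (Suc (Suc (4 * k))))" by simp
  then have "symb_prod (4 * m) (4 * Suc k) z = symb_prod (4 * m) (4 * k) z * fo z * fe z * fo z * fe z"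
    unfolding e symb_prod.simps by (simp add: symb_def)
  also have "\<dots> = Phi z ^\<^sub>m k * (fo z * fe z * fo z * fe z)"
    unfolding Suc.IH by (simp add: sq_assoc[of _ 2] sq_mult_carrier[of _ 2] pow_carrier_mat)
  finally show ?case by (simp add: Phi_def AABB)
qed (use carrier_matD[OF Phi_carrier] in auto)

lemma path_weight_Phi: "C (path_weight step (4 * m) (4 * k) u v) = laurent_op (\<lambda>z. Phi z ^\<^sub>m k) u v"
proof -
  have "symb_prod (4 * m) (4 * k) = (\<lambda>z. Phi z ^\<^sub>m k)" using symb_prod_4 by blast
  then show ?thesis by (simp add: path_weight_symb)
qed

lemma BB_bound: "\<exists>M>0. \<forall>z r s. norm z \<ge> 1 \<longrightarrow> r < 2 \<longrightarrow> s < 2 \<longrightarrow> norm (BB z $$ (r, s)) \<le> M * norm z"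
proof -
  define p1 q1 p2 q3 p4 q4 where
    "p1 = C a * iin * C a * im" and "q1 = C b * sn * C b * im" and "p2 = (C a * iin * C c + C b * sn * C d) * sm"
    and "q3 = (C c * iin * C a + C d * sn * C b) * im" and "p4 = C d * sn * C d * sm" and "q4 = C c * iin * C c * sm"
  have B: "BB z = mat2 (p1 + q1 * z) p2 (q3 * z) (p4 + q4 * z)" for z
    unfolding BB_eq fo_def fo'_def dn'_def dm'_def mat2_mult p1_def q1_def p2_def q3_def p4_def q4_def
    by (simp add: algebra_simps)
  define M where "M = norm p1 + norm q1 + norm p2 + norm q3 + norm p4 + norm q4 + 1"
  have lin: "norm (p + q * z) \<le> (norm p + norm q) * norm z" if "norm z \<ge> 1" for p q z :: complex
  proof -
    have "norm (p + q * z) \<le> norm p * 1 + norm q * norm z" using norm_triangle_ineq[of p "q * z"] by (simp add: norm_mult)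
    also have "\<dots> \<le> norm p * norm z + norm q * norm z" using that by (intro add_right_mono mult_left_mono) auto
    finally show ?thesis by (simp add: distrib_right)
  qed
  have "norm (BB z $$ (r, s)) \<le> M * norm z" if z: "norm z \<ge> 1" and rs: "r < 2" "s < 2" for z r s
  proof -
    have "norm (p1 + q1 * z) \<le> M * norm z"
      by (rule order_trans[OF lin[OF z] mult_right_mono]) (auto simp: M_def)
    moreover have "norm (p4 + q4 * z) \<le> M * norm z"
      by (rule order_trans[OF lin[OF z] mult_right_mono]) (auto simp: M_def)
    moreover have "norm p2 \<le> M * norm z"
      using order_trans[OF lin[OF z, of p2 0] mult_right_mono[of "norm p2 + norm (0::complex)" M]] by (auto simp: M_def)
    moreover have "norm (q3 * z) \<le> M * norm z"
      unfolding norm_mult by (rule mult_right_mono) (auto simp: M_def)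
    ultimately show ?thesis using rs unfolding B by (auto dest!: less_2_cases_nat)
  qed
  moreover have "M > 0" unfolding M_def by (simp add: add_nonneg_pos)
  ultimately show ?thesis by blast
qed

end

section \<open>The limit of the correlation kernel\<close>

lemma sum_kernel_rearrange:
  fixes f :: "'k \<Rightarrow> 'i \<Rightarrow> 'a::comm_semiring_0"
  shows "(\<Sum>j\<in>J. (\<Sum>k\<in>K. b k * (\<Sum>i\<in>I. f k i * g i j)) * e j) =
    (\<Sum>i\<in>I. (\<Sum>k\<in>K. b k * f k i) * (\<Sum>j\<in>J. g i j * e j))"
proof -
  let ?t = "\<lambda>i j k. (b k * f k i) * (g i j * e j)"
  have "(\<Sum>j\<in>J. (\<Sum>k\<in>K. b k * (\<Sum>i\<in>I. f k i * g i j)) * e j) = (\<Sum>j\<in>J. \<Sum>k\<in>K. \<Sum>i\<in>I. ?t i j k)"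
    by (simp only: sum_distrib_left sum_distrib_right mult.assoc)
  also have "\<dots> = (\<Sum>j\<in>J. \<Sum>i\<in>I. \<Sum>k\<in>K. ?t i j k)"
    by (rule sum.cong[OF refl], rule sum.swap)
  also have "\<dots> = (\<Sum>i\<in>I. \<Sum>j\<in>J. \<Sum>k\<in>K. ?t i j k)" by (rule sum.swap)
  also have "\<dots> = (\<Sum>i\<in>I. \<Sum>k\<in>K. \<Sum>j\<in>J. ?t i j k)"
    by (rule sum.cong[OF refl], rule sum.swap)
  finally show ?thesis by (simp only: sum_product)
qed

text \<open>The inequalities amount to \<open>norm pA > 1\<close> and \<open>norm pB < 1\<close>:
  \<open>A\<close> is invertible near the closed unit disc, \<open>B\<close> on and outside the unit
  circle.\<close>

locale hexagon_gap = hexagon +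
  assumes gap: "(\<beta> * \<gamma>) / (\<alpha> * \<delta>) < 1" "1 < (b * c) / (a * d)"
begin

lemma pA_norm: "norm pA = (\<alpha> * \<delta>) / (\<beta> * \<gamma>)" "norm pA > 1"
proof -
  show 1: "norm pA = (\<alpha> * \<delta>) / (\<beta> * \<gamma>)" unfolding pA_def norm_of_real using pos by simp
  show "norm pA > 1" unfolding 1 using gap(1) pos by (simp add: field_simps)
qed

lemma pB_norm: "norm pB = (a * d) / (b * c)" "norm pB < 1" "norm pB > 0"
proof -
  show 1: "norm pB = (a * d) / (b * c)" unfolding pB_def norm_of_real using pos by simp
  show "norm pB < 1" "norm pB > 0" unfolding 1 using gap(2) pos by (simp_all add: field_simps)
qed

lemma Ai_disc: "disc_holomorphic (\<lambda>z. Ai z ^\<^sub>m k)"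
  by (rule mat_holomorphic_disc[OF mat_holomorphic_subset[OF mat_holomorphic_pow[OF Ai_holomorphic]] pA_norm(2)]) auto

lemma Bi_circle: "circle_continuous (\<lambda>z. Bi z ^\<^sub>m k)"
  by (rule mat_holomorphic_circle[OF mat_holomorphic_pow[OF Bi_holomorphic]]) (use pB_norm(2) in auto)

lemma entire_disc: "mat_holomorphic UNIV F \<Longrightarrow> disc_holomorphic F"
  by (rule mat_holomorphic_disc[of 2]) (auto elim: mat_holomorphic_subset)

lemma A_disc: "disc_holomorphic (\<lambda>z. AA z ^\<^sub>m k)" and B_disc: "disc_holomorphic (\<lambda>z. BB z ^\<^sub>m k)"
  and Phi_disc: "disc_holomorphic (\<lambda>z. Phi z ^\<^sub>m k)"
  by (intro entire_disc mat_holomorphic_pow AB_holomorphic Phi_holomorphic)+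

lemma inverse_identities:
  assumes "z \<noteq> pA" "z \<noteq> pB"
  shows "AA z * Ai z = 1\<^sub>m 2" "Ai z * AA z = 1\<^sub>m 2" "BB z * Bi z = 1\<^sub>m 2" "Bi z * BB z = 1\<^sub>m 2"
  unfolding Ai_def Bi_def using mat2_inv det_AA_nz[OF assms(1)] det_BB_nz[OF assms(2)] AB_carrier by blast+

lemma circle_avoids: "z \<in> sphere 0 1 \<Longrightarrow> z \<noteq> pA" "z \<in> sphere 0 1 \<Longrightarrow> z \<noteq> pB"
  using pA_norm(2) pB_norm(2) by auto

lemmas circle_identities =
  commuting_pair_identities[OF AB_carrier ABi_carrier inverse_identities[OF circle_avoids] AB_commute, folded Phi_def]

lemma lop_unit:
  assumes "\<And>z. z \<in> sphere 0 1 \<Longrightarrow> F z = 1\<^sub>m 2"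
  shows "laurent_op F u v = of_bool (u = v)"
  using laurent_op_cong[of F "\<lambda>_. 1\<^sub>m 2", OF assms] laurent_op_one by simp

text \<open>\<open>N\<close> periods shift the paths by \<open>N\<close> blocks, so the symbol of \<open>W\<close> is \<open>z\<^sup>-\<^sup>N\<close> times \<open>Phi\<^sup>N\<close>; the factor \<open>z\<^sup>-\<^sup>N\<close> goes to the
  lower triangular factor, and is expressed by a shift of the indices by \<open>2 * N\<close>.\<close>

definition "W x y = laurent_op (\<lambda>z. Phi z ^\<^sub>m N) x (y + 2 * int N)"
definition "U' = laurent_op (\<lambda>z. Ai z ^\<^sub>m N)"
definition "L' x y = laurent_op (\<lambda>z. Bi z ^\<^sub>m N) (x + 2 * int N) y"
definition "U = laurent_op (\<lambda>z. AA z ^\<^sub>m N)"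
definition "L x y = laurent_op (\<lambda>z. BB z ^\<^sub>m N) x (y + 2 * int N)"
definition "V x y = laurent_op (\<lambda>z. Bi z ^\<^sub>m N * Ai z ^\<^sub>m N) (x + 2 * int N) y"

text \<open>Each relation is an identity of symbols on the circle, transferred by the product rules;
  where needed the summation index is moved by \<open>2 N\<close> to account for the power of
  \<open>z\<close>. One symbol in each product is holomorphic near the closed disc, on the right in
  the last product and on the left in the others.\<close>

lemma has_sum_products:
  "((\<lambda>k. W x k * L' k y) has_sum U x y) UNIV"
  "((\<lambda>k. W x k * U' k y) has_sum L x y) UNIV"
  "((\<lambda>k. W x k * V k y) has_sum of_bool (x = y)) UNIV"
  "((\<lambda>k. U x k * U' k y) has_sum of_bool (x = y)) UNIV"
  "((\<lambda>k. L x k * L' k y) has_sum of_bool (x = y)) UNIV"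
  "((\<lambda>k. U' x k * L' k y) has_sum V x y) UNIV"
  "((\<lambda>k. L' x k * U' k y) has_sum V x y) UNIV"
proof -
  have 1: "laurent_op (\<lambda>z. Phi z ^\<^sub>m N * Bi z ^\<^sub>m N) x y = U x y"
    unfolding U_def by (rule laurent_op_cong) (use circle_identities(1)[of _ 0 N] in
      \<open>simp add: carrier_matD[OF ABi_carrier(2)] right_mult_one_mat[OF pow_carrier_mat[OF AB_carrier(1)]]\<close>)
  show "((\<lambda>k. W x k * L' k y) has_sum U x y) UNIV"
    using has_sum_int_shift[OF laurent_op_mult_left[OF Phi_disc[of N] Bi_circle[of N], of x y], of "2 * int N"]
    unfolding 1 W_def L'_def .
  have 2: "laurent_op (\<lambda>z. Phi z ^\<^sub>m N * Ai z ^\<^sub>m N) x (y + 2 * int N) = L x y"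
    unfolding L_def by (rule laurent_op_cong) (use circle_identities(3)[of _ 0 N] in simp)
  show "((\<lambda>k. W x k * U' k y) has_sum L x y) UNIV"
    using has_sum_int_shift[OF laurent_op_mult_left[OF Phi_disc[of N] disc_holomorphic_imp_continuous[OF Ai_disc[of N]], of x "y + 2 * int N"], of "2 * int N"]
    unfolding 2 W_def U'_def laurent_op_shift .
  have BA: "circle_continuous (\<lambda>z. Bi z ^\<^sub>m N * Ai z ^\<^sub>m N)"
    by (rule mat_holomorphic_circle[of "- {pA, pB}"], rule mat_holomorphic_mult)
      (use pA_norm(2) pB_norm(2) in \<open>auto intro: mat_holomorphic_subset[OF mat_holomorphic_pow[OF Ai_holomorphic]] mat_holomorphic_subset[OF mat_holomorphic_pow[OF Bi_holomorphic]]\<close>)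
  have 3: "laurent_op (\<lambda>z. Phi z ^\<^sub>m N * (Bi z ^\<^sub>m N * Ai z ^\<^sub>m N)) x y = of_bool (x = y)"
    by (rule lop_unit) (use circle_identities(5)[of _ 0 N] in simp)
  show "((\<lambda>k. W x k * V k y) has_sum of_bool (x = y)) UNIV"
    using has_sum_int_shift[OF laurent_op_mult_left[OF Phi_disc[of N] BA, of x y], of "2 * int N"]
    unfolding 3 W_def V_def .
  have 4: "laurent_op (\<lambda>z. AA z ^\<^sub>m N * Ai z ^\<^sub>m N) x y = of_bool (x = y)"
    by (rule lop_unit, rule pow_mat_inv[of _ 2]) (use inverse_identities[OF circle_avoids] in simp_all)
  show "((\<lambda>k. U x k * U' k y) has_sum of_bool (x = y)) UNIV"
    using laurent_op_mult_left[OF A_disc[of N] disc_holomorphic_imp_continuous[OF Ai_disc[of N]], of x y]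
    unfolding 4 U_def U'_def .
  have 5: "laurent_op (\<lambda>z. BB z ^\<^sub>m N * Bi z ^\<^sub>m N) x y = of_bool (x = y)"
    by (rule lop_unit, rule pow_mat_inv[of _ 2]) (use inverse_identities[OF circle_avoids] in simp_all)
  show "((\<lambda>k. L x k * L' k y) has_sum of_bool (x = y)) UNIV"
    using has_sum_int_shift[OF laurent_op_mult_left[OF B_disc[of N] Bi_circle[of N], of x y], of "2 * int N"]
    unfolding 5 L_def L'_def .
  have 6: "laurent_op (\<lambda>z. Ai z ^\<^sub>m N * Bi z ^\<^sub>m N) (x + 2 * int N) y = V x y"
    unfolding V_def by (rule laurent_op_cong) (use circle_identities(4)[of _ 0 N] in simp)
  show "((\<lambda>k. U' x k * L' k y) has_sum V x y) UNIV"
    using has_sum_int_shift[OF laurent_op_mult_left[OF Ai_disc[of N] Bi_circle[of N], of "x + 2 * int N" y], of "2 * int N"]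
    unfolding 6 U'_def L'_def laurent_op_shift .
  show "((\<lambda>k. L' x k * U' k y) has_sum V x y) UNIV"
    using laurent_op_mult_right[OF Bi_circle[of N] Ai_disc[of N], of "x + 2 * int N" y]
    unfolding V_def U'_def L'_def .
qed

lemma BB_pow_growth: "\<exists>M. \<forall>z r s. norm z \<ge> 1 \<longrightarrow> r < 2 \<longrightarrow> s < 2 \<longrightarrow> norm ((BB z ^\<^sub>m k) $$ (r, s)) \<le> M * norm z powi int k"
proof -
  obtain M where M: "M > 0" "\<And>z r s. norm z \<ge> 1 \<Longrightarrow> r < 2 \<Longrightarrow> s < 2 \<Longrightarrow> norm (BB z $$ (r, s)) \<le> M * norm z"
    using BB_bound by blast
  have "norm ((BB z ^\<^sub>m k) $$ (r, s)) \<le> (2 * M) ^ k * norm z powi int k" if "norm z \<ge> 1" "r < 2" "s < 2" for z r s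
    using pow_mat2_bound[OF AB_carrier(2) M(2)[OF that(1)] that(2,3), of k] by (simp add: power_mult_distrib mult_ac)
  then show ?thesis by blast
qed

lemma Bi_pow_growth: "\<exists>M. \<forall>z r s. norm z \<ge> 1 \<longrightarrow> r < 2 \<longrightarrow> s < 2 \<longrightarrow> norm ((Bi z ^\<^sub>m k) $$ (r, s)) \<le> M * norm z powi (- int k)"
proof -
  obtain M where M: "M > 0" "\<And>z r s. norm z \<ge> 1 \<Longrightarrow> r < 2 \<Longrightarrow> s < 2 \<Longrightarrow> norm (BB z $$ (r, s)) \<le> M * norm z"
    using BB_bound by blast
  \<comment> \<open>For \<open>norm z \<ge> 1\<close> the modulus of \<open>a d - b c z\<close> is
    at least \<open>e * norm z\<close>, and \<open>e > 0\<close> is the gap condition. The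
    determinant of \<open>BB\<close> is then of exact order 2 at infinity, and dividing entries of
    order 1 by it gives order \<open>-1\<close> for \<open>Bi\<close>.\<close>
  define e where "e = b * c - a * d"
  have e: "e > 0" using gap(2) pos by (simp add: e_def field_simps)
  have one: "norm (Bi z $$ (r, s)) \<le> M / e\<^sup>2 * (1 / norm z)" if z: "norm z \<ge> 1" and rs: "r < 2" "s < 2" for z r s
  proof -
    have "e * norm z \<le> b * c * norm z - a * d" using z pos mult_left_mono[OF z, of "a * d"] by (simp add: e_def algebra_simps)
    also have "\<dots> = norm (C (b * c) * z) - norm (C (a * d))" using pos by (simp add: norm_mult)
    also have "\<dots> \<le> norm (C (a * d) - C (b * c) * z)" using norm_triangle_ineq2[of "C (b * c) * z" "C (a * d)"] by (simp add: norm_minus_commute)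
    finally have "(e * norm z)\<^sup>2 \<le> norm (mat2_det (BB z))"
      unfolding det_BB norm_power using e by (intro power_mono) auto
    moreover have "(e * norm z)\<^sup>2 > 0" using e z by (intro zero_less_power mult_pos_pos) linarith+
    ultimately have q: "x / norm (mat2_det (BB z)) \<le> (M * norm z) / (e * norm z)\<^sup>2" if "x \<le> M * norm z" "0 \<le> x" for x
      using that M(1) by (intro frac_le) auto
    have "(M * norm z) / (e * norm z)\<^sup>2 = M / e\<^sup>2 * (1 / norm z)"
      using z e by (auto simp: power2_eq_square)
    then show ?thesis using rs q M(2)[OF z] unfolding Bi_def mat2_inv_def
      by (auto dest!: less_2_cases_nat simp: norm_divide)
  qed
  have "norm ((Bi z ^\<^sub>m k) $$ (r, s)) \<le> (2 * (M / e\<^sup>2)) ^ k * norm z powi (- int k)" if "norm z \<ge> 1" "r < 2" "s < 2" for z r s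
    using pow_mat2_bound[OF ABi_carrier(2) one[OF that(1)] that(2,3), of k]
    by (simp add: power_mult_distrib power_int_minus power_divide field_simps)
  then show ?thesis by blast
qed

text \<open>\<open>A^N\<close> and its inverse have no negative coefficients. \<open>B^N\<close> has
  none above \<open>N\<close> and its inverse none above \<open>-N\<close>; the index shift by
  \<open>2 N\<close> turns this into block lower triangularity.\<close>

lemma triangular:
  "y div 2 < x div 2 \<Longrightarrow> U x y = 0" "y div 2 < x div 2 \<Longrightarrow> U' x y = 0"
  "x div 2 < y div 2 \<Longrightarrow> L x y = 0" "x div 2 < y div 2 \<Longrightarrow> L' x y = 0"
proof -
  show "y div 2 < x div 2 \<Longrightarrow> U x y = 0" "y div 2 < x div 2 \<Longrightarrow> U' x y = 0"
    unfolding U_def U'_def by (rule laurent_op_eq_0_left[OF A_disc], simp) (rule laurent_op_eq_0_left[OF Ai_disc], simp)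
  assume xy: "x div 2 < y div 2"
  obtain M where M: "\<And>z r s. norm z \<ge> 1 \<Longrightarrow> r < 2 \<Longrightarrow> s < 2 \<Longrightarrow> norm ((BB z ^\<^sub>m N) $$ (r, s)) \<le> M * norm z powi int N"
    using BB_pow_growth by blast
  show "L x y = 0" unfolding L_def
    by (rule laurent_op_growth[OF mat_holomorphic_subset[OF mat_holomorphic_pow[OF AB_holomorphic(2)[of UNIV]]] pB_norm(2) M]) (use xy in auto)
  obtain M' where M': "\<And>z r s. norm z \<ge> 1 \<Longrightarrow> r < 2 \<Longrightarrow> s < 2 \<Longrightarrow> norm ((Bi z ^\<^sub>m N) $$ (r, s)) \<le> M' * norm z powi (- int N)"
    using Bi_pow_growth by blast
  show "L' x y = 0" unfolding L'_def
    by (rule laurent_op_growth[OF mat_holomorphic_pow[OF Bi_holomorphic] pB_norm(2) M']) (use xy in auto)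
qed

lemma W_path: "W x y = C (path_weight step 0 (4 * N) x (2 * int N + y))"
  using path_weight_Phi[of 0 N x "2 * int N + y"] by (simp add: W_def add.commute)

lemma wiener_hopf_exists: "\<exists>C \<rho>. wiener_hopf W U U' L L' V (2 * int N) C \<rho>"
proof -
  \<comment> \<open>Midpoints between the unit circle and the poles: radius \<open>r\<close> stays
    below \<open>pA\<close>, and the circle of radius \<open>s\<close> still encloses
    \<open>pB\<close>. The slower of the two rates is \<open>\<sigma>\<close>; the passage to scalar
    indices replaces it by \<open>sqrt \<sigma>\<close>.\<close>
  define r where "r = (1 + norm pA) / 2"
  define s where "s = (1 + norm pB) / 2"
  have r: "r > 1" "norm pA > r" using pA_norm(2) by (auto simp: r_def)
  have "0 \<le> norm pB" by simp
  then have s: "0 < s" "s < 1" "norm pB < s"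
    using pB_norm(2) by (simp_all add: s_def add_pos_nonneg)
  define \<sigma> where "\<sigma> = max (1 / r) s"
  have \<sigma>: "0 < \<sigma>" "\<sigma> < 1" "1 / r \<le> \<sigma>" "s \<le> \<sigma>" using r s by (auto simp: \<sigma>_def)
  obtain M1 where M1: "M1 \<ge> 0" "\<And>u v. norm (laurent_op (\<lambda>z. Phi z ^\<^sub>m N) u v) \<le> M1"
    using laurent_op_bounded[OF disc_holomorphic_imp_continuous[OF Phi_disc[of N]]] by metis
  obtain M2 where M2: "M2 \<ge> 0" "\<And>u v. norm (U' u v) \<le> M2 * r powi (u div 2 - v div 2)"
    unfolding U'_def by (rule laurent_op_radius_bound[OF mat_holomorphic_pow[OF Ai_holomorphic, of N], of r]) (use r in auto)
  obtain M3 where M3: "M3 \<ge> 0" "\<And>u v. norm (laurent_op (\<lambda>z. Bi z ^\<^sub>m N) u v) \<le> M3 * s powi (u div 2 - v div 2)"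
    by (rule laurent_op_radius_bound[OF mat_holomorphic_pow[OF Bi_holomorphic, of N], of s]) (use s pB_norm(2) in auto)
  define K where "K = M1 + M2 * (1 / sqrt \<sigma>) + M3 * (1 / sqrt \<sigma>)"
  have K: "M1 \<le> K" "M2 * (1 / sqrt \<sigma>) \<le> K" "M3 * (1 / sqrt \<sigma>) \<le> K" "0 \<le> K"
    using M1(1) M2(1) M3(1) \<sigma> by (auto simp: K_def)
  have dist: "\<bar>x - y\<bar> \<le> 2 * (y div 2 - x div 2) + 1" if "x div 2 \<le> y div 2" for x y :: int
    using that by presburger
  have dU: "norm (U' x y) \<le> K * sqrt \<sigma> ^ nat \<bar>x - y\<bar>" for x y
  proof (cases "y div 2 < x div 2")
    case True
    then show ?thesis using triangular(2) K \<sigma> by simp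
  next
    case False
    define i where "i = y div 2 - x div 2"
    have i: "i \<ge> 0" "\<bar>x - y\<bar> \<le> 2 * i + 1" using False dist[of x y] by (auto simp: i_def)
    have "r powi (x div 2 - y div 2) = (1 / r) ^ nat i"
      using i(1) by (simp add: i_def power_int_def power_one_over inverse_eq_divide)
    also have "\<dots> \<le> \<sigma> ^ nat i" by (rule power_mono) (use \<sigma> r in auto)
    also have "\<dots> \<le> (1 / sqrt \<sigma>) * sqrt \<sigma> ^ nat \<bar>x - y\<bar>" by (rule decay_half[OF \<sigma>(1,2) i(2,1)])
    finally have "norm (U' x y) \<le> M2 * ((1 / sqrt \<sigma>) * sqrt \<sigma> ^ nat \<bar>x - y\<bar>)"
      using M2 by (meson mult_left_mono order_trans)
    also have "\<dots> \<le> K * sqrt \<sigma> ^ nat \<bar>x - y\<bar>"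
      unfolding mult.assoc[symmetric] by (rule mult_right_mono[OF K(2)]) (use \<sigma> in auto)
    finally show ?thesis .
  qed
  have dL: "norm (L' x y) \<le> K * sqrt \<sigma> ^ nat \<bar>x - y\<bar>" for x y
  proof (cases "x div 2 < y div 2")
    case True
    then show ?thesis using triangular(4) K \<sigma> by simp
  next
    case False
    define i where "i = x div 2 - y div 2"
    have i: "i \<ge> 0" "\<bar>x - y\<bar> \<le> 2 * i + 1" using False dist[of y x] by (auto simp: i_def)
    have "s powi ((x + 2 * int N) div 2 - y div 2) = s ^ (nat i + N)"
    proof -
      have "(x + 2 * int N) div 2 - y div 2 = int (nat i + N)" using i(1) by (simp add: i_def)
      then show ?thesis by (simp only: power_int_of_nat)
    qed
    also have "\<dots> \<le> s ^ nat i" by (rule power_decreasing) (use s in auto)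
    also have "\<dots> \<le> \<sigma> ^ nat i" by (rule power_mono) (use \<sigma> s in auto)
    also have "\<dots> \<le> (1 / sqrt \<sigma>) * sqrt \<sigma> ^ nat \<bar>x - y\<bar>" by (rule decay_half[OF \<sigma>(1,2) i(2,1)])
    finally have "norm (L' x y) \<le> M3 * ((1 / sqrt \<sigma>) * sqrt \<sigma> ^ nat \<bar>x - y\<bar>)"
      unfolding L'_def using M3 by (meson mult_left_mono order_trans)
    also have "\<dots> \<le> K * sqrt \<sigma> ^ nat \<bar>x - y\<bar>"
      unfolding mult.assoc[symmetric] by (rule mult_right_mono[OF K(3)]) (use \<sigma> in auto)
    finally show ?thesis .
  qed
  have "wiener_hopf W U U' L L' V (2 * int N) K (sqrt \<sigma>)"
  proof
    show "0 < sqrt \<sigma>" "sqrt \<sigma> < 1" using \<sigma> by auto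
    show "W x y = 0" if "\<bar>x - y\<bar> > 2 * int N" for x y
      unfolding W_path using that by (subst path_weight_eq_0) auto
    show "norm (W x y) \<le> K" for x y unfolding W_def using M1(2) K(1) order_trans by blast
  qed (fact triangular dU dL has_sum_products)+
  then show ?thesis by blast
qed

text \<open>The kernel on the half-line. The sum starts at its end 0 and runs over whole blocks up
  to that of \<open>u'\<close>; beyond it the right factor vanishes, its symbol having no negative
  coefficients.\<close>

definition limit_entry :: "nat \<Rightarrow> int \<Rightarrow> nat \<Rightarrow> int \<Rightarrow> complex" where
  "limit_entry m u m' u' =
     (\<Sum>i\<in>{0..2 * (u' div 2) + 1}. laurent_op (\<lambda>z. AA z ^\<^sub>m (N - m) * Bi z ^\<^sub>m m) u i *
        laurent_op (\<lambda>z. Ai z ^\<^sub>m (N - m') * BB z ^\<^sub>m m') i u') -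
     of_bool (m < m') * laurent_op (\<lambda>z. Phi z ^\<^sub>m (m' - m)) u u'"

text \<open>The product rule sums over all integers. For \<open>k < 0\<close> the term vanishes
  because \<open>L'\<close> is lower triangular and \<open>i \<ge> 0\<close>, for
  \<open>k \<ge> K\<close> because the end point is out of reach. The symbol
  \<open>(A B)^(N - m) B^(-N)\<close> simplifies to \<open>A^(N - m) B^(-m)\<close>.\<close>

lemma left_factor:
  assumes m: "m < N" and i: "i \<ge> 0" and K: "u + 4 * int N < int K"
  shows "(\<Sum>k<K. C (path_weight step (4 * m) (4 * N - 4 * m) u (2 * int N + int k)) * L' (int k) i) =
    laurent_op (\<lambda>z. AA z ^\<^sub>m (N - m) * Bi z ^\<^sub>m m) u i"
proof -
  have pw: "C (path_weight step (4 * m) (4 * N - 4 * m) u v) = laurent_op (\<lambda>z. Phi z ^\<^sub>m (N - m)) u v" for v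
    using path_weight_Phi[of m "N - m" u v] by (simp add: right_diff_distrib')
  have "((\<lambda>k. laurent_op (\<lambda>z. Phi z ^\<^sub>m (N - m)) u (k + 2 * int N) * laurent_op (\<lambda>z. Bi z ^\<^sub>m N) (k + 2 * int N) i)
     has_sum laurent_op (\<lambda>z. Phi z ^\<^sub>m (N - m) * Bi z ^\<^sub>m N) u i) UNIV"
    by (rule has_sum_int_shift[OF laurent_op_mult_left[OF Phi_disc Bi_circle]])
  also have "laurent_op (\<lambda>z. Phi z ^\<^sub>m (N - m) * Bi z ^\<^sub>m N) u i = laurent_op (\<lambda>z. AA z ^\<^sub>m (N - m) * Bi z ^\<^sub>m m) u i"
    by (rule laurent_op_cong) (use circle_identities(1)[of _ m N] m in simp)
  finally have "laurent_op (\<lambda>z. AA z ^\<^sub>m (N - m) * Bi z ^\<^sub>m m) u i =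
     (\<Sum>k\<in>{0..<int K}. laurent_op (\<lambda>z. Phi z ^\<^sub>m (N - m)) u (k + 2 * int N) * laurent_op (\<lambda>z. Bi z ^\<^sub>m N) (k + 2 * int N) i)"
  proof (rule has_sum_eq_sum)
    fix k assume k: "k \<notin> {0..<int K}"
    show "laurent_op (\<lambda>z. Phi z ^\<^sub>m (N - m)) u (k + 2 * int N) * laurent_op (\<lambda>z. Bi z ^\<^sub>m N) (k + 2 * int N) i = 0"
    proof (cases "k < 0")
      case True
      then have "L' k i = 0" by (intro triangular(4) div_2_less_neg) (use i in auto)
      then show ?thesis by (simp add: L'_def)
    next
      case False
      have "path_weight step (4 * m) (4 * N - 4 * m) u (k + 2 * int N) = 0"
        by (rule path_weight_eq_0) (use False k K m in auto)
      then show ?thesis using pw[of "k + 2 * int N"] by simp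
    qed
  qed simp
  then show ?thesis unfolding sum_int_lessThan pw L'_def by (simp add: add.commute)
qed

text \<open>Here \<open>U'\<close> is zero for \<open>j < 0 \<le> i\<close>, and from
  \<open>j \<ge> J\<close> the point \<open>u\<close> lies below the path. The symbol
  \<open>A^(-N) (A B)^m\<close> simplifies to \<open>A^(m - N) B^m\<close>.\<close>

lemma right_factor:
  assumes m: "m < N" and i: "i \<ge> 0" and J: "u < int J"
  shows "(\<Sum>j<J. U' i (int j) * C (path_weight step 0 (4 * m) (int j) u)) =
    laurent_op (\<lambda>z. Ai z ^\<^sub>m (N - m) * BB z ^\<^sub>m m) i u"
proof -
  have pw: "C (path_weight step 0 (4 * m) v u) = laurent_op (\<lambda>z. Phi z ^\<^sub>m m) v u" for v
    using path_weight_Phi[of 0 m v u] by simp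
  have "((\<lambda>j. U' i j * laurent_op (\<lambda>z. Phi z ^\<^sub>m m) j u) has_sum laurent_op (\<lambda>z. Ai z ^\<^sub>m N * Phi z ^\<^sub>m m) i u) UNIV"
    unfolding U'_def by (rule laurent_op_mult_left[OF Ai_disc disc_holomorphic_imp_continuous[OF Phi_disc]])
  also have "laurent_op (\<lambda>z. Ai z ^\<^sub>m N * Phi z ^\<^sub>m m) i u = laurent_op (\<lambda>z. Ai z ^\<^sub>m (N - m) * BB z ^\<^sub>m m) i u"
    by (rule laurent_op_cong) (use circle_identities(2)[of _ m N] m in simp)
  finally have "laurent_op (\<lambda>z. Ai z ^\<^sub>m (N - m) * BB z ^\<^sub>m m) i u = (\<Sum>j\<in>{0..<int J}. U' i j * laurent_op (\<lambda>z. Phi z ^\<^sub>m m) j u)"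
  proof (rule has_sum_eq_sum)
    fix j assume j: "j \<notin> {0..<int J}"
    show "U' i j * laurent_op (\<lambda>z. Phi z ^\<^sub>m m) j u = 0"
    proof (cases "j < 0")
      case True
      then have "U' i j = 0" by (intro triangular(2) div_2_less_neg) (use i in auto)
      then show ?thesis by simp
    next
      case False
      have "path_weight step 0 (4 * m) j u = 0" by (rule path_weight_eq_0) (use False j J in auto)
      then show ?thesis using pw[of j] by simp
    qed
  qed simp
  then show ?thesis unfolding sum_int_lessThan pw by simp
qed

lemma finite_kernel_limit:
  assumes X: "\<forall>\<^sub>F n in sequentially. X n \<in> carrier_mat (2 * n) (2 * n)"
    and lim: "\<And>i j. (\<lambda>n. C (X n $$ (i, j))) \<longlonglongrightarrow> (\<Sum>k\<in>{0..int j + 1}. L' (int i) k * U' k (int j))"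
    and m: "m < N" "m' < N"
  shows "(\<lambda>n. C (finite_kernel n (X n) (4 * m, u) (4 * m', u'))) \<longlonglongrightarrow> limit_entry m u m' u'"
proof -
  \<comment> \<open>From \<open>u\<close> only ends with \<open>k < K\<close> are reachable, and
    \<open>u'\<close> only from starts \<open>j < J\<close>. For \<open>n \<ge> K + J\<close> both
    ranges are independent of \<open>n\<close>, so entrywise convergence of the inverse
    suffices.\<close>
  define K where "K = nat (u + 4 * int N) + 1"
  define J where "J = nat u' + 1"
  have K: "u + 4 * int N < int K" and J: "u' < int J" by (auto simp: K_def J_def)
  define bb where "bb k = path_weight step (4 * m) (4 * N - 4 * m) u (2 * int N + int k)" for k
  define ee where "ee j = path_weight step 0 (4 * m') (int j) u'" for j
  define cc where "cc = of_bool (m < m') * path_weight step (4 * m) (4 * m' - 4 * m) u u'"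
  have b0: "bb k = 0" if "k \<ge> K" for k unfolding bb_def using that K by (intro path_weight_eq_0) auto
  have e0: "ee j = 0" if "j \<ge> J" for j unfolding ee_def using that J by (intro path_weight_eq_0) auto
  have fk: "C (finite_kernel n (X n) (4 * m, u) (4 * m', u')) = (\<Sum>j<J. (\<Sum>k<K. C (bb k) * C (X n $$ (k, j))) * C (ee j)) - C cc"
    if n: "n \<ge> K + J" for n
  proof -
    have "(\<Sum>k<2 * n. bb k * X n $$ (k, j)) = (\<Sum>k<K. bb k * X n $$ (k, j))" for j
      by (rule sum.mono_neutral_right) (use n b0 in auto)
    moreover have "(\<Sum>j<2 * n. f j * ee j) = (\<Sum>j<J. f j * ee j)" for f
      by (rule sum.mono_neutral_right) (use n e0 in auto)
    ultimately have "finite_kernel n (X n) (4 * m, u) (4 * m', u') = (\<Sum>j<J. (\<Sum>k<K. bb k * X n $$ (k, j)) * ee j) - cc"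
      by (simp add: finite_kernel_def bb_def[symmetric] ee_def[symmetric] cc_def)
    then show ?thesis by simp
  qed
  have "(\<lambda>n. (\<Sum>j<J. (\<Sum>k<K. C (bb k) * C (X n $$ (k, j))) * C (ee j)) - C cc) \<longlonglongrightarrow>
     (\<Sum>j<J. (\<Sum>k<K. C (bb k) * (\<Sum>i\<in>{0..int j + 1}. L' (int k) i * U' i (int j))) * C (ee j)) - C cc"
    by (intro tendsto_diff tendsto_sum tendsto_mult tendsto_const lim)
  also have "(\<Sum>j<J. (\<Sum>k<K. C (bb k) * (\<Sum>i\<in>{0..int j + 1}. L' (int k) i * U' i (int j))) * C (ee j)) - C cc = limit_entry m u m' u'"
  proof -
    let ?I = "{0..2 * (u' div 2) + 1}"
    \<comment> \<open>The range of \<open>i\<close> depends on \<open>j\<close>. Block upper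
      triangularity of \<open>U'\<close> allows the common range \<open>?I\<close> as long as
      \<open>j \<le> u'\<close>, and all other \<open>j\<close> have weight 0; only then do the sums
      over \<open>k\<close> and \<open>j\<close> separate for each \<open>i\<close>.\<close>
    have inner: "(\<Sum>i\<in>{0..int j + 1}. L' (int k) i * U' i (int j)) * C (ee j) = (\<Sum>i\<in>?I. L' (int k) i * U' i (int j)) * C (ee j)" for k j
    proof (cases "int j \<le> u'")
      case True
      have S: "(\<Sum>i\<in>A. L' (int k) i * U' i (int j)) = (\<Sum>i\<in>{i. 0 \<le> i \<and> i div 2 \<le> int j div 2}. L' (int k) i * U' i (int j))"
        if "finite A" "{i. 0 \<le> i \<and> i div 2 \<le> int j div 2} \<subseteq> A" "\<And>i. i \<in> A \<Longrightarrow> i \<ge> 0" for A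
      proof (rule sum.mono_neutral_right)
        show "\<forall>i\<in>A - {i. 0 \<le> i \<and> i div 2 \<le> int j div 2}. L' (int k) i * U' i (int j) = 0"
        proof
          fix i assume "i \<in> A - {i. 0 \<le> i \<and> i div 2 \<le> int j div 2}"
          then have "int j div 2 < i div 2" using that(3) by auto
          then show "L' (int k) i * U' i (int j) = 0" using triangular(2) by simp
        qed
      qed (use that in auto)
      have "{i. 0 \<le> i \<and> i div 2 \<le> int j div 2} \<subseteq> {0..int j + 1}" by auto
      then have 1: "(\<Sum>i\<in>{0..int j + 1}. L' (int k) i * U' i (int j)) =
          (\<Sum>i\<in>{i. 0 \<le> i \<and> i div 2 \<le> int j div 2}. L' (int k) i * U' i (int j))"
        by (rule S[rotated]) simp_all
      have "int j div 2 \<le> u' div 2" using True by (rule zdiv_mono1) simp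
      then have "{i. 0 \<le> i \<and> i div 2 \<le> int j div 2} \<subseteq> ?I" by auto
      then have 2: "(\<Sum>i\<in>?I. L' (int k) i * U' i (int j)) =
          (\<Sum>i\<in>{i. 0 \<le> i \<and> i div 2 \<le> int j div 2}. L' (int k) i * U' i (int j))"
        by (rule S[rotated]) simp_all
      show ?thesis unfolding 1 2 ..
    next
      case False
      then have "ee j = 0" unfolding ee_def by (intro path_weight_eq_0) auto
      then show ?thesis by simp
    qed
    have "(\<Sum>k<K. C (bb k) * (\<Sum>i\<in>{0..int j + 1}. L' (int k) i * U' i (int j))) * C (ee j) =
      (\<Sum>k<K. C (bb k) * (\<Sum>i\<in>?I. L' (int k) i * U' i (int j))) * C (ee j)" for j
      unfolding sum_distrib_right by (rule sum.cong[OF refl]) (simp only: mult.assoc inner)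
    then have "(\<Sum>j<J. (\<Sum>k<K. C (bb k) * (\<Sum>i\<in>{0..int j + 1}. L' (int k) i * U' i (int j))) * C (ee j)) =
      (\<Sum>j<J. (\<Sum>k<K. C (bb k) * (\<Sum>i\<in>?I. L' (int k) i * U' i (int j))) * C (ee j))"
      by (simp only:)
    also have "\<dots> = (\<Sum>i\<in>?I. (\<Sum>k<K. C (bb k) * L' (int k) i) * (\<Sum>j<J. U' i (int j) * C (ee j)))"
      by (rule sum_kernel_rearrange)
    also have "\<dots> = (\<Sum>i\<in>?I. laurent_op (\<lambda>z. AA z ^\<^sub>m (N - m) * Bi z ^\<^sub>m m) u i *
        laurent_op (\<lambda>z. Ai z ^\<^sub>m (N - m') * BB z ^\<^sub>m m') i u')"
    proof (rule sum.cong[OF refl])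
      fix i assume "i \<in> ?I"
      then have "0 \<le> i" by simp
      show "(\<Sum>k<K. C (bb k) * L' (int k) i) * (\<Sum>j<J. U' i (int j) * C (ee j)) =
        laurent_op (\<lambda>z. AA z ^\<^sub>m (N - m) * Bi z ^\<^sub>m m) u i * laurent_op (\<lambda>z. Ai z ^\<^sub>m (N - m') * BB z ^\<^sub>m m') i u'"
        unfolding bb_def ee_def left_factor[OF m(1) \<open>0 \<le> i\<close> K] right_factor[OF m(2) \<open>0 \<le> i\<close> J] ..
    qed
    finally have "(\<Sum>j<J. (\<Sum>k<K. C (bb k) * (\<Sum>i\<in>{0..int j + 1}. L' (int k) i * U' i (int j))) * C (ee j)) = \<dots>" .
    moreover have "C cc = of_bool (m < m') * laurent_op (\<lambda>z. Phi z ^\<^sub>m (m' - m)) u u'"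
      using path_weight_Phi[of m "m' - m" u u'] by (simp add: cc_def right_diff_distrib')
    ultimately show ?thesis by (simp add: limit_entry_def)
  qed
  finally show ?thesis
    by (rule Lim_transform_eventually) (auto intro!: eventually_sequentiallyI[of "K + J"] simp: fk)
qed

text \<open>The Gram matrix is real while the estimates are complex: non-vanishing of
  \<open>det (TT n)\<close> for large \<open>n\<close> is pulled back to \<open>gram n\<close>, and
  the real inverse is embedded again to take its limit.\<close>

theorem probability_limit:
  assumes inj: "inj_on (\<lambda>k. (4 * m k, u k)) {..<l}" and m: "\<forall>k<l. 0 < m k \<and> m k < N"
  shows "(\<lambda>n. C (measure (hexm n) {Q \<in> configurations N n. \<forall>k<l. (4 * m k, u k) \<in> Q})) \<longlonglongrightarrow>
     Determinant.det (Matrix.mat l l (\<lambda>(r, q). limit_entry (m r) (u r) (m q) (u q)))"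
proof -
  obtain K \<rho> where wh: "wiener_hopf W U U' L L' V (2 * int N) K \<rho>" using wiener_hopf_exists by blast
  interpret wh: wiener_hopf W U U' L L' V "2 * int N" K \<rho> by (rule wh)
  have TT: "wh.TT n = map_mat C (gram n)" for n
    by (rule eq_matI) (auto simp: wh.TT_def gram_def W_path)
  have G: "gram n \<in> carrier_mat (2 * n) (2 * n)" for n by (simp add: gram_def)
  define X where "X n = the (mat_inverse (gram n))" for n
  have X: "\<forall>\<^sub>F n in sequentially. X n \<in> carrier_mat (2 * n) (2 * n) \<and> X n * gram n = 1\<^sub>m (2 * n)"
    using wh.eventually_det_nonzero
  proof eventually_elim
    case (elim n)
    have "Determinant.det (gram n) \<noteq> 0" using elim unfolding TT of_real_hom.hom_det by auto
    then have U: "gram n \<in> Units (ring_mat TYPE(real) (2 * n) ())" by (rule det_non_zero_imp_unit[OF G])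
    then obtain Y where Y: "mat_inverse (gram n) = Some Y" using mat_inverse(1)[OF G[of n], of "()"] by (cases "mat_inverse (gram n)") auto
    then show ?case using mat_inverse(2)[OF G Y] by (simp add: X_def)
  qed
  have lim: "(\<lambda>n. C (X n $$ (i, j))) \<longlonglongrightarrow> (\<Sum>k\<in>{0..int j + 1}. L' (int i) k * U' k (int j))" for i j
  proof -
    have "(\<lambda>n. map_mat C (X n) $$ (i, j)) \<longlonglongrightarrow> (\<Sum>k\<in>{0..int j + 1}. L' (int i) k * U' k (int j))"
    proof (rule wh.inverse_limit)
      show "\<forall>\<^sub>F n in sequentially. map_mat C (X n) \<in> carrier_mat (2 * n) (2 * n) \<and> map_mat C (X n) * wh.TT n = 1\<^sub>m (2 * n)"
        using X
      proof eventually_elim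
        case (elim n)
        then have Xc: "X n \<in> carrier_mat (2 * n) (2 * n)" and e: "X n * gram n = 1\<^sub>m (2 * n)" by auto
        have "map_mat C (X n) * wh.TT n = 1\<^sub>m (2 * n)"
          unfolding TT of_real_hom.mat_hom_mult[OF Xc G, symmetric] e by (rule of_real_hom.mat_hom_one)
        then show ?case using Xc by simp
      qed
    qed
    moreover have "\<forall>\<^sub>F n in sequentially. map_mat C (X n) $$ (i, j) = C (X n $$ (i, j))"
      using X eventually_gt_at_top[of "i + j"]
    proof eventually_elim
      case (elim n)
      then have "dim_row (X n) = 2 * n" "dim_col (X n) = 2 * n" by auto
      then show ?case using elim by simp
    qed
    ultimately show ?thesis by (rule Lim_transform_eventually)
  qed
  have "(\<lambda>n. Determinant.det (Matrix.mat l l (\<lambda>(r, q). C (finite_kernel n (X n) (4 * m r, u r) (4 * m q, u q)))))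
     \<longlonglongrightarrow> Determinant.det (Matrix.mat l l (\<lambda>(r, q). limit_entry (m r) (u r) (m q) (u q)))"
  proof (rule tendsto_det, rule finite_kernel_limit[OF _ lim])
    show "\<forall>\<^sub>F n in sequentially. X n \<in> carrier_mat (2 * n) (2 * n)"
      using X by (rule eventually_mono) simp
  qed (use m in auto)
  moreover have "\<forall>\<^sub>F n in sequentially. Determinant.det (Matrix.mat l l (\<lambda>(r, q). C (finite_kernel n (X n) (4 * m r, u r) (4 * m q, u q)))) =
     C (measure (hexm n) {Q \<in> configurations N n. \<forall>k<l. (4 * m k, u k) \<in> Q})"
    using X
  proof eventually_elim
    case (elim n)
    let ?M = "Matrix.mat l l (\<lambda>(r, q). finite_kernel n (X n) (4 * m r, u r) (4 * m q, u q))"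
    have "measure (hexm n) {Q \<in> configurations N n. \<forall>k<l. (4 * m k, u k) \<in> Q} = Determinant.det ?M"
    proof (rule hexagon_probability[OF inj])
      fix q assume "q < l"
      then show "0 < fst (4 * m q, u q) \<and> fst (4 * m q, u q) < 4 * N" using m by simp
    qed (use elim in auto)
    then have "C (measure (hexm n) {Q \<in> configurations N n. \<forall>k<l. (4 * m k, u k) \<in> Q}) = Determinant.det (map_mat C ?M)"
      by (simp only: of_real_hom.hom_det)
    moreover have "map_mat C ?M = Matrix.mat l l (\<lambda>(r, q). C (finite_kernel n (X n) (4 * m r, u r) (4 * m q, u q)))"
      by (rule eq_matI) auto
    ultimately show ?case by (simp only:)
  qed
  ultimately show ?thesis by (rule Lim_transform_eventually)
qed

end

section \<open>The contour integrals\<close>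

lemma contour_integral_eq_0_winding:
  assumes "finite S" "f holomorphic_on - S"
    and g: "valid_path g" "pathfinish g = pathstart g" "path_image g \<inter> S = {}"
    and w: "\<And>s. s \<in> S \<Longrightarrow> winding_number g s = 0"
  shows "contour_integral g f = 0"
proof -
  have hol: "f holomorphic_on UNIV - S" using assms(2) by (simp add: Compl_eq_Diff_UNIV)
  have "contour_integral g f = 2 * pi * \<i> * (\<Sum>p\<in>S. winding_number g p * residue f p)"
    by (rule Residue_theorem[OF _ _ assms(1) hol]) (use g in auto)
  then show ?thesis using w by simp
qed

lemma lcoef_closed_path:
  assumes f: "f holomorphic_on - {p}" and p: "norm p \<noteq> 1"
    and g: "valid_path g" "pathfinish g = pathstart g" "0 \<notin> path_image g" "p \<notin> path_image g"
    and w: "winding_number g 0 = 1" "winding_number g p = (if norm p < 1 then 1 else 0)"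
  shows "contour_integral g (\<lambda>z. f z * z powi (- k - 1)) = 2 * of_real pi * \<i> * lcoef f k"
proof -
  have "contour_integral g (\<lambda>z. f z * z powi (- k - 1)) = contour_integral (circlepath 0 1) (\<lambda>z. f z * z powi (- k - 1))"
  proof (rule contour_integral_eq_winding[of "{0, p}"])
    show "(\<lambda>z. f z * z powi (- k - 1)) holomorphic_on - {0, p}"
      by (intro holomorphic_on_mult holomorphic_on_powi holomorphic_on_subset[OF f]) auto
    fix s assume "s \<in> {0, p}"
    moreover have "winding_number (circlepath 0 1) p = (if norm p < 1 then 1 else 0)"
    proof (cases "norm p < 1")
      case True
      then show ?thesis by (simp add: winding_number_circlepath)
    next
      case False
      then have "winding_number (circlepath 0 1) p = 0"
        using p by (intro winding_number_zero_outside[of _ "cball 0 1"]) auto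
      then show ?thesis using False by simp
    qed
    ultimately show "winding_number g s = winding_number (circlepath 0 1) s"
      using w by (auto simp: winding_number_circlepath)
  qed (use g p in auto)
  then show ?thesis by (simp add: lcoef_def)
qed

lemma inverse_diff_expansion:
  fixes z w :: complex
  assumes "w \<noteq> 0" "z \<noteq> w"
  shows "1 / (z - w) = - (\<Sum>i\<le>n. z ^ i / w ^ Suc i) + z ^ Suc n / (w ^ Suc n * (z - w))"
proof (induction n)
  case 0
  show ?case using assms by (simp add: field_simps)
next
  case (Suc n)
  have "p / (q * D) = p * (w + D) / (q * w * D) - p / (q * w)" if "q \<noteq> 0" "D \<noteq> 0" for p q D :: complex
    using that assms(1) by (simp add: field_simps)
  from this[of "w ^ Suc n" "z - w" "z ^ Suc n"]
  have "z ^ Suc n / (w ^ Suc n * (z - w)) = z ^ Suc (Suc n) / (w ^ Suc (Suc n) * (z - w)) - z ^ Suc n / w ^ Suc (Suc n)"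
    using assms by (simp add: mult_ac)
  then show ?case using Suc.IH by simp
qed

text \<open>Expanding \<open>1 / (z - w)\<close> in powers of \<open>z\<close> up to order \<open>x\<close> leaves a remainder that cancels the pole at 0, so only
  finitely many Laurent coefficients of \<open>h\<close> enter, whatever the relative size of \<open>z\<close> and \<open>w\<close> on the contours.\<close>

lemma inner_integral:
  assumes h: "h holomorphic_on - {p}" and p: "norm p > 1" and w: "w \<noteq> 0"
    and g: "valid_path g" "pathfinish g = pathstart g" "0 \<notin> path_image g" "p \<notin> path_image g" "w \<notin> path_image g"
    and wn: "winding_number g 0 = 1" "winding_number g p = 0" "winding_number g w = 0"
  shows "((\<lambda>z. h z * (e / z powi (x + 1)) / (z - w)) has_contour_integral
     - (2 * of_real pi * \<i>) * e * (\<Sum>k\<in>{0..x}. w powi (- k - 1) * lcoef h (x - k))) g"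
proof -
  let ?S = "- {0, p, w}"
  have op: "open ?S" by (intro open_Compl finite_imp_closed) auto
  have pg: "path_image g \<subseteq> ?S" using g by auto
  have hS: "h holomorphic_on ?S" by (rule holomorphic_on_subset[OF h]) auto
  have hol: "(\<lambda>z. h z * z powi k) holomorphic_on ?S" "(\<lambda>z. h z * z powi k * t / (z - w)) holomorphic_on ?S" for k t
    by (intro holomorphic_on_divide holomorphic_on_mult hS holomorphic_on_powi holomorphic_on_diff holomorphic_on_const holomorphic_on_ident; force)+
  note int = contour_integrable_holomorphic_simple[OF _ op g(1) pg]
  have "((\<lambda>z. h z * (e / z powi (x + 1)) / (z - w)) has_contour_integral contour_integral g (\<lambda>z. h z * (e / z powi (x + 1)) / (z - w))) g"
  proof (rule has_contour_integral_integral, rule int)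
    show "(\<lambda>z. h z * (e / z powi (x + 1)) / (z - w)) holomorphic_on ?S"
      by (intro holomorphic_on_divide holomorphic_on_mult hS holomorphic_on_powi holomorphic_on_diff holomorphic_on_const holomorphic_on_ident; force)
  qed
  moreover have "contour_integral g (\<lambda>z. h z * (e / z powi (x + 1)) / (z - w)) =
     - (2 * of_real pi * \<i>) * e * (\<Sum>k\<in>{0..x}. w powi (- k - 1) * lcoef h (x - k))"
  proof (cases "x < 0")
    case True
    have "contour_integral g (\<lambda>z. h z * (e / z powi (x + 1)) / (z - w)) = contour_integral g (\<lambda>z. h z * (e * z powi (- x - 1)) / (z - w))"
    proof (rule contour_integral_eq)
      fix z assume "z \<in> path_image g"
      then have "z \<noteq> 0" using g by auto
      moreover have "- x - 1 = - (x + 1)" by simp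
      ultimately have "e / z powi (x + 1) = e * z powi (- x - 1)" by (simp only: power_int_minus divide_inverse)
      then show "h z * (e / z powi (x + 1)) / (z - w) = h z * (e * z powi (- x - 1)) / (z - w)" by simp
    qed
    \<comment> \<open>For \<open>x < 0\<close> the exponent of \<open>z\<close> is nonnegative, so 0
      is no pole, and neither \<open>p\<close> nor \<open>w\<close> is encircled; the sum over
      \<open>{0..x}\<close> is empty.\<close>
    also have "\<dots> = 0"
    proof (rule contour_integral_eq_0_winding[of "{p, w}"])
      show "(\<lambda>z. h z * (e * z powi (- x - 1)) / (z - w)) holomorphic_on - {p, w}"
        using True by (intro holomorphic_on_divide holomorphic_on_mult holomorphic_on_subset[OF h] holomorphic_on_powi holomorphic_on_diff holomorphic_on_const holomorphic_on_ident) auto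
    qed (use g wn in auto)
    finally show ?thesis using True by simp
  next
    case False
    define n where "n = nat x"
    have x: "x = int n" using False by (simp add: n_def)
    have eq: "h z * (e / z powi (x + 1)) / (z - w) =
       (\<Sum>i\<le>n. - e * w powi (- int i - 1) * (h z * z powi (- (x - int i) - 1))) + h z * z powi 0 * (e * w powi (- x - 1)) / (z - w)"
      if z: "z \<in> path_image g" for z
    proof -
      have nz: "z \<noteq> 0" "z \<noteq> w" using z g by auto
      have zp: "z ^ i / z powi (x + 1) = z powi (- (x - int i) - 1)" for i
      proof -
        have "z powi (- (x - int i) - 1) = z powi (int i - (x + 1))" by (simp add: algebra_simps)
        also have "\<dots> = z powi int i / z powi (x + 1)" using nz by (intro power_int_diff) auto
        finally show ?thesis by simp
      qed
      have wp: "1 / w ^ Suc i = w powi (- int i - 1)" for i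
      proof -
        have "- int i - 1 = - int (Suc i)" by simp
        then show ?thesis by (simp only: power_int_minus power_int_of_nat divide_inverse mult_1_left)
      qed
      have zn: "z ^ Suc n / z powi (x + 1) = 1" using zp[of "Suc n"] x by simp
      have "h z * (e / z powi (x + 1)) / (z - w) = h z * (e / z powi (x + 1)) * (1 / (z - w))" by simp
      also have "\<dots> = (\<Sum>i\<le>n. - e * (1 / w ^ Suc i) * (h z * (z ^ i / z powi (x + 1)))) +
         h z * (e * (1 / w ^ Suc n)) / (z - w) * (z ^ Suc n / z powi (x + 1))"
        unfolding inverse_diff_expansion[OF w nz(2), of n] distrib_left
        by (simp add: sum_distrib_left sum_negf mult_ac)
      also have "\<dots> = (\<Sum>i\<le>n. - e * w powi (- int i - 1) * (h z * z powi (- (x - int i) - 1))) + h z * z powi 0 * (e * w powi (- x - 1)) / (z - w)"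
        unfolding zn unfolding wp zp by (simp add: x)
      finally show ?thesis .
    qed
    have "contour_integral g (\<lambda>z. h z * (e / z powi (x + 1)) / (z - w)) =
       contour_integral g (\<lambda>z. (\<Sum>i\<le>n. - e * w powi (- int i - 1) * (h z * z powi (- (x - int i) - 1))) + h z * z powi 0 * (e * w powi (- x - 1)) / (z - w))"
      by (rule contour_integral_eq[OF eq])
    also have "\<dots> = contour_integral g (\<lambda>z. \<Sum>i\<le>n. - e * w powi (- int i - 1) * (h z * z powi (- (x - int i) - 1))) +
        contour_integral g (\<lambda>z. h z * z powi 0 * (e * w powi (- x - 1)) / (z - w))"
    proof (rule contour_integral_add)
      show "(\<lambda>z. \<Sum>i\<le>n. - e * w powi (- int i - 1) * (h z * z powi (- (x - int i) - 1))) contour_integrable_on g"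
        by (rule contour_integrable_sum) (simp, rule contour_integrable_lmul, rule int, rule hol(1))
      show "(\<lambda>z. h z * z powi 0 * (e * w powi (- x - 1)) / (z - w)) contour_integrable_on g"
        by (rule int, rule hol(2))
    qed
    also have "contour_integral g (\<lambda>z. h z * z powi 0 * (e * w powi (- x - 1)) / (z - w)) = 0"
    proof (rule contour_integral_eq_0_winding[of "{p, w}"])
      show "(\<lambda>z. h z * z powi 0 * (e * w powi (- x - 1)) / (z - w)) holomorphic_on - {p, w}"
        by (intro holomorphic_on_divide holomorphic_on_mult holomorphic_on_subset[OF h] holomorphic_on_powi holomorphic_on_diff holomorphic_on_const holomorphic_on_ident) auto
    qed (use g wn in auto)
    also have "contour_integral g (\<lambda>z. \<Sum>i\<le>n. - e * w powi (- int i - 1) * (h z * z powi (- (x - int i) - 1))) =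
      (\<Sum>i\<le>n. contour_integral g (\<lambda>z. - e * w powi (- int i - 1) * (h z * z powi (- (x - int i) - 1))))"
      by (rule contour_integral_sum) (simp, rule contour_integrable_lmul, rule int, rule hol(1))
    also have "\<dots> = (\<Sum>i\<le>n. - e * w powi (- int i - 1) * (2 * of_real pi * \<i> * lcoef h (x - int i)))"
    proof (rule sum.cong[OF refl])
      fix i
      have "contour_integral g (\<lambda>z. - e * w powi (- int i - 1) * (h z * z powi (- (x - int i) - 1))) =
         - e * w powi (- int i - 1) * contour_integral g (\<lambda>z. h z * z powi (- (x - int i) - 1))"
        by (rule contour_integral_lmul) (rule int, rule hol(1))
      also have "contour_integral g (\<lambda>z. h z * z powi (- (x - int i) - 1)) = 2 * of_real pi * \<i> * lcoef h (x - int i)"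
        by (rule lcoef_closed_path[OF h]) (use p g wn in auto)
      finally show "contour_integral g (\<lambda>z. - e * w powi (- int i - 1) * (h z * z powi (- (x - int i) - 1))) =
        - e * w powi (- int i - 1) * (2 * of_real pi * \<i> * lcoef h (x - int i))" .
    qed
    also have "\<dots> = (\<Sum>k\<in>{0..x}. - e * w powi (- k - 1) * (2 * of_real pi * \<i> * lcoef h (x - k)))"
      by (rule sum.reindex_bij_witness[of _ nat int]) (auto simp: x)
    finally show ?thesis by (simp add: sum_distrib_left mult_ac sum_negf)
  qed
  ultimately show ?thesis by simp
qed

lemma sum_pairs_int:
  fixes f :: "int \<Rightarrow> complex"
  shows "(\<Sum>i\<in>{0..2 * x + 1}. f i) = (\<Sum>k\<in>{0..x}. f (2 * k) + f (2 * k + 1))"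
proof (cases "x < 0")
  case False
  define n where "n = nat x"
  have "(\<Sum>i\<in>{0..2 * int n + 1}. f i) = (\<Sum>k\<in>{0..int n}. f (2 * k) + f (2 * k + 1))"
  proof (induction n)
    case 0
    have "{0..1} = {0, 1::int}" by auto
    then show ?case by simp
  next
    case (Suc n)
    have "{0..2 * int (Suc n) + 1} = insert (2 * int (Suc n) + 1) (insert (2 * int (Suc n)) {0..2 * int n + 1})" by auto
    moreover have "{0..int (Suc n)} = insert (int (Suc n)) {0..int n}" by auto
    ultimately show ?case using Suc.IH by (simp add: add_ac)
  qed
  then show ?thesis using False by (simp add: n_def)
qed simp

context hexagon_gap
begin

lemma mat_powi_AA: "z \<noteq> pA \<Longrightarrow> mat_powi (AA z) k = (if k \<ge> 0 then AA z ^\<^sub>m nat k else Ai z ^\<^sub>m nat (- k))"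
  by (simp add: mat_powi_def Ai_def mat_inverse_mat2[OF AB_carrier(1) det_AA_nz])

lemma mat_powi_BB: "z \<noteq> pB \<Longrightarrow> mat_powi (BB z) k = (if k \<ge> 0 then BB z ^\<^sub>m nat k else Bi z ^\<^sub>m nat (- k))"
  by (simp add: mat_powi_def Bi_def mat_inverse_mat2[OF AB_carrier(2) det_BB_nz])

lemma single_integral:
  assumes "m > m'"
  shows "contour_integral (circlepath 0 1) (\<lambda>z. (mat_powi (AA z) (int m - int m') * mat_powi (BB z) (int m - int m')) $$ (i, j)
      * z powi (x' - x) / z) = 2 * of_real pi * \<i> * lcoef (\<lambda>z. (Phi z ^\<^sub>m (m - m')) $$ (i, j)) (x - x')"
proof -
  have "contour_integral (circlepath 0 1) (\<lambda>z. (mat_powi (AA z) (int m - int m') * mat_powi (BB z) (int m - int m')) $$ (i, j)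
      * z powi (x' - x) / z) = contour_integral (circlepath 0 1) (\<lambda>z. (Phi z ^\<^sub>m (m - m')) $$ (i, j) * z powi (- (x - x') - 1))"
  proof (rule contour_integral_eq)
    fix z assume "z \<in> path_image (circlepath 0 (1::real))"
    then have z: "z \<in> sphere 0 1" "z \<noteq> 0" by auto
    have "nat (int m - int m') = m - m'" using assms by simp
    then have "mat_powi (AA z) (int m - int m') * mat_powi (BB z) (int m - int m') = Phi z ^\<^sub>m (m - m')"
      using assms mat_powi_AA[OF circle_avoids(1)[OF z(1)]] mat_powi_BB[OF circle_avoids(2)[OF z(1)]]
        pow_mat_mult[OF AB_carrier(1)[of z] AB_carrier(2)[of z] AB_commute[of z], of "m - m'"] by (simp add: Phi_def)
    moreover have "z powi (- (x - x') - 1) = z powi (x' - x) / z"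
      using power_int_diff[of z "x' - x" 1] z by simp
    ultimately show "(mat_powi (AA z) (int m - int m') * mat_powi (BB z) (int m - int m')) $$ (i, j) * z powi (x' - x) / z
       = (Phi z ^\<^sub>m (m - m')) $$ (i, j) * z powi (- (x - x') - 1)" by simp
  qed
  then show ?thesis by (simp add: lcoef_def)
qed

definition "FF m z = AA z ^\<^sub>m (N - m) * Bi z ^\<^sub>m m"
definition "GG m z = Ai z ^\<^sub>m (N - m) * BB z ^\<^sub>m m"

lemma FG_holomorphic: "mat_holomorphic (- {pB}) (FF m)" "mat_holomorphic (- {pA}) (GG m)"
  unfolding FF_def[abs_def] GG_def[abs_def]
  by (intro mat_holomorphic_mult mat_holomorphic_pow AB_holomorphic Ai_holomorphic Bi_holomorphic)+

text \<open>Each variable meets one pole of the symbols: \<open>w\<close> that of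
  \<open>B^(-m')\<close> at \<open>pB\<close>, enclosed by \<open>g1\<close>, and \<open>z\<close>
  that of \<open>A^(m - N)\<close> at \<open>pA\<close>, outside \<open>g0\<close>. For fixed
  \<open>w\<close> the inner integral is a finite combination of powers of \<open>w\<close> times
  entries of \<open>FF\<close>; the outer one turns each into a Laurent coefficient.\<close>

lemma double_integral:
  assumes m: "0 < m" "m < N" "0 < m'" "m' < N" and ij: "i < 2" "j < 2"
    and g0: "positive_simple_closed_curve g0" "0 \<in> inside (path_image g0)" "pA \<in> outside (path_image g0)"
    and g1: "positive_simple_closed_curve g1" "path_image g0 \<subseteq> inside (path_image g1)" "pB \<in> inside (path_image g1)"
  shows "contour_integral g1 (\<lambda>w. contour_integral g0 (\<lambda>z.
            (mat_powi (AA w) (int N - int m') * mat_powi (BB w) (- int m')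
              * mat_powi (AA z) (int m - int N) * mat_powi (BB z) (int m)) $$ (i, j)
              * (w powi x' / z powi (x + 1)) / (z - w))) =
     - (2 * of_real pi * \<i>)\<^sup>2 * (\<Sum>k\<in>{0..x}. \<Sum>r<2. lcoef (\<lambda>w. FF m' w $$ (i, r)) (k - x') * lcoef (\<lambda>z. GG m z $$ (r, j)) (x - k))"
proof -
  have v0: "valid_path g0" "pathfinish g0 = pathstart g0" and v1: "valid_path g1" "pathfinish g1 = pathstart g1"
    and w0: "\<And>z. z \<in> inside (path_image g0) \<Longrightarrow> winding_number g0 z = 1"
    and w1: "\<And>z. z \<in> inside (path_image g1) \<Longrightarrow> winding_number g1 z = 1"
    using g0(1) g1(1) by (auto simp: positive_simple_closed_curve_def)
  have p0: "path g0" and p1: "path g1" using v0 v1 valid_path_imp_path by auto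
  have out0: "winding_number g0 z = 0" if "z \<in> outside (path_image g0)" for z
    by (rule winding_number_zero_in_outside[OF p0 v0(2) that])
  have ins: "inside (path_image g0) \<subseteq> inside (path_image g1)"
    by (rule inside_inside_compact_connected)
      (use p0 p1 g1(2) in \<open>auto intro: compact_path_image closed_path_image connected_path_image\<close>)
  have disj: "z \<notin> path_image g" if "z \<in> inside (path_image g) \<or> z \<in> outside (path_image g)" for z and g :: "real \<Rightarrow> complex"
    using that inside_no_overlap[of "path_image g"] outside_no_overlap[of "path_image g"] by blast
  have off0: "0 \<notin> path_image g0" "pA \<notin> path_image g0" using disj g0 by auto
  have zero1: "0 \<in> inside (path_image g1)" using g0(2) ins by auto
  have off1: "0 \<notin> path_image g1" "pB \<notin> path_image g1" using disj zero1 g1(3) by auto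
  \<comment> \<open>\<open>g0\<close> and its interior lie inside \<open>g1\<close>, so a point
    \<open>w\<close> of \<open>g1\<close> is outside \<open>g0\<close> and the pole
    \<open>z = w\<close> is not encircled.\<close>
  have out1: "w \<in> outside (path_image g0)" if "w \<in> path_image g1" for w
  proof -
    have "w \<notin> inside (path_image g0)" "w \<notin> path_image g0" using that ins disj[of w g1] g1(2) by auto
    then show ?thesis using inside_Un_outside[of "path_image g0"] by blast
  qed
  have F: "(\<lambda>w. FF m' w $$ (i, r)) holomorphic_on - {pB}" and G: "(\<lambda>z. GG m z $$ (r, j)) holomorphic_on - {pA}" if "r < 2" for r
    using mat_holomorphicD(2)[OF FG_holomorphic(1)] mat_holomorphicD(2)[OF FG_holomorphic(2)] that ij by auto
  let ?c = "2 * of_real pi * \<i> :: complex"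
  have inner: "contour_integral g0 (\<lambda>z.
            (mat_powi (AA w) (int N - int m') * mat_powi (BB w) (- int m')
              * mat_powi (AA z) (int m - int N) * mat_powi (BB z) (int m)) $$ (i, j)
              * (w powi x' / z powi (x + 1)) / (z - w)) =
      (\<Sum>r<2. \<Sum>k\<in>{0..x}. (- ?c * lcoef (\<lambda>z. GG m z $$ (r, j)) (x - k)) * (FF m' w $$ (i, r) * w powi (- (k - x') - 1)))"
    if w: "w \<in> path_image g1" for w
  proof -
    have wnz: "w \<noteq> 0" "w \<noteq> pB" using w off1 by auto
    have wo: "w \<in> outside (path_image g0)" by (rule out1[OF w])
    have "nat (int N - int m') = N - m'" "int N - int m' \<ge> 0" using m by auto
    then have F1: "mat_powi (AA w) (int N - int m') = AA w ^\<^sub>m (N - m')" by (simp only: mat_powi_def if_True)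
    have F2: "mat_powi (BB w) (- int m') = Bi w ^\<^sub>m m'" using mat_powi_BB[OF wnz(2), of "- int m'"] m by simp
    have Fw': "mat_powi (AA w) (int N - int m') * mat_powi (BB w) (- int m') = FF m' w"
      unfolding F1 F2 FF_def ..
    have eq: "(mat_powi (AA w) (int N - int m') * mat_powi (BB w) (- int m')
              * mat_powi (AA z) (int m - int N) * mat_powi (BB z) (int m)) $$ (i, j)
              * (w powi x' / z powi (x + 1)) / (z - w) =
       (\<Sum>r<2. FF m' w $$ (i, r) * (GG m z $$ (r, j) * (w powi x' / z powi (x + 1)) / (z - w)))"
      if z: "z \<in> path_image g0" for z
    proof -
      have zA: "z \<noteq> pA" using z off0 by auto
      have n: "nat (- (int m - int N)) = N - m" "\<not> (int m - int N \<ge> 0)" using m by auto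
      have GA: "mat_powi (AA z) (int m - int N) = Ai z ^\<^sub>m (N - m)" unfolding mat_powi_AA[OF zA] n(1) using n(2) by (simp only: if_False)
      have GB: "mat_powi (BB z) (int m) = BB z ^\<^sub>m m" by (simp add: mat_powi_def)
      have "FF m' w * Ai z ^\<^sub>m (N - m) * BB z ^\<^sub>m m = FF m' w * GG m z"
        unfolding GG_def by (rule sq_assoc[of _ 2]) (use mat_holomorphicD(1)[OF FG_holomorphic(1)] in \<open>auto intro: pow_carrier_mat\<close>)
      then have "(mat_powi (AA w) (int N - int m') * mat_powi (BB w) (- int m')
              * mat_powi (AA z) (int m - int N) * mat_powi (BB z) (int m)) $$ (i, j) = (FF m' w * GG m z) $$ (i, j)"
        unfolding Fw' GA GB by simp
      also have "\<dots> = (\<Sum>r<2. FF m' w $$ (i, r) * GG m z $$ (r, j))"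
        by (rule index_mult_mat_sum[OF mat_holomorphicD(1)[OF FG_holomorphic(1)] mat_holomorphicD(1)[OF FG_holomorphic(2)] ij])
      finally show ?thesis by (simp add: sum_distrib_right sum_divide_distrib mult.assoc)
    qed
    have "((\<lambda>z. \<Sum>r<2. FF m' w $$ (i, r) * (GG m z $$ (r, j) * (w powi x' / z powi (x + 1)) / (z - w))) has_contour_integral
       (\<Sum>r<2. FF m' w $$ (i, r) * (- ?c * w powi x' * (\<Sum>k\<in>{0..x}. w powi (- k - 1) * lcoef (\<lambda>z. GG m z $$ (r, j)) (x - k))))) g0"
    proof (rule has_contour_integral_sum)
      fix r assume "r \<in> {..<2::nat}"
      then have r: "r < 2" by simp
      show "((\<lambda>z. FF m' w $$ (i, r) * (GG m z $$ (r, j) * (w powi x' / z powi (x + 1)) / (z - w))) has_contour_integral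
        FF m' w $$ (i, r) * (- ?c * w powi x' * (\<Sum>k\<in>{0..x}. w powi (- k - 1) * lcoef (\<lambda>z. GG m z $$ (r, j)) (x - k)))) g0"
        by (rule has_contour_integral_lmul, rule inner_integral[OF G[OF r] pA_norm(2) wnz(1) v0])
          (use disj[of w g0] off0 g0 wo w0 out0 in auto)
    qed simp
    then have "contour_integral g0 (\<lambda>z. \<Sum>r<2. FF m' w $$ (i, r) * (GG m z $$ (r, j) * (w powi x' / z powi (x + 1)) / (z - w))) =
      (\<Sum>r<2. FF m' w $$ (i, r) * (- ?c * w powi x' * (\<Sum>k\<in>{0..x}. w powi (- k - 1) * lcoef (\<lambda>z. GG m z $$ (r, j)) (x - k))))"
      by (rule contour_integral_unique)
    also have "\<dots> = (\<Sum>r<2. \<Sum>k\<in>{0..x}. (- ?c * lcoef (\<lambda>z. GG m z $$ (r, j)) (x - k)) * (FF m' w $$ (i, r) * w powi (- (k - x') - 1)))"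
    proof (rule sum.cong[OF refl])
      fix r
      have "w powi (- (k - x') - 1) = w powi x' * w powi (- k - 1)" for k
        using power_int_add[of w x' "- k - 1"] wnz by (simp add: algebra_simps)
      then show "FF m' w $$ (i, r) * (- ?c * w powi x' * (\<Sum>k\<in>{0..x}. w powi (- k - 1) * lcoef (\<lambda>z. GG m z $$ (r, j)) (x - k))) =
        (\<Sum>k\<in>{0..x}. (- ?c * lcoef (\<lambda>z. GG m z $$ (r, j)) (x - k)) * (FF m' w $$ (i, r) * w powi (- (k - x') - 1)))"
        by (simp add: sum_distrib_left sum_negf mult_ac)
    qed
    finally show ?thesis using contour_integral_eq[OF eq] by simp
  qed
  have gp: "path_image g1 \<subseteq> - {0, pB}" using off1 by auto
  have op: "open (- {0, pB})" by (intro open_Compl finite_imp_closed) auto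
  have int: "(\<lambda>w. FF m' w $$ (i, r) * w powi k) contour_integrable_on g1" if "r < 2" for r k
    by (rule contour_integrable_holomorphic_simple[OF _ op v1(1) gp])
      (intro holomorphic_on_mult holomorphic_on_subset[OF F[OF that]] holomorphic_on_powi; force)
  have "contour_integral g1 (\<lambda>w. contour_integral g0 (\<lambda>z.
            (mat_powi (AA w) (int N - int m') * mat_powi (BB w) (- int m')
              * mat_powi (AA z) (int m - int N) * mat_powi (BB z) (int m)) $$ (i, j)
              * (w powi x' / z powi (x + 1)) / (z - w))) =
     contour_integral g1 (\<lambda>w. \<Sum>r<2. \<Sum>k\<in>{0..x}. (- ?c * lcoef (\<lambda>z. GG m z $$ (r, j)) (x - k)) * (FF m' w $$ (i, r) * w powi (- (k - x') - 1)))"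
    by (rule contour_integral_eq[OF inner])
  also have "\<dots> = (\<Sum>r<2. \<Sum>k\<in>{0..x}. (- ?c * lcoef (\<lambda>z. GG m z $$ (r, j)) (x - k)) * (?c * lcoef (\<lambda>w. FF m' w $$ (i, r)) (k - x')))"
  proof (rule contour_integral_unique, rule has_contour_integral_sum, simp, rule has_contour_integral_sum, simp, rule has_contour_integral_lmul)
    fix r k assume "r \<in> {..<2::nat}"
    then have r: "r < 2" by simp
    have "contour_integral g1 (\<lambda>w. FF m' w $$ (i, r) * w powi (- (k - x') - 1)) = ?c * lcoef (\<lambda>w. FF m' w $$ (i, r)) (k - x')"
      by (rule lcoef_closed_path[OF F[OF r]]) (use pB_norm(2) v1 off1 w1 zero1 g1(3) in auto)
    then show "((\<lambda>w. FF m' w $$ (i, r) * w powi (- (k - x') - 1)) has_contour_integral ?c * lcoef (\<lambda>w. FF m' w $$ (i, r)) (k - x')) g1"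
      using has_contour_integral_integral[OF int[OF r]] by metis
  qed
  also have "\<dots> = - ?c\<^sup>2 * (\<Sum>k\<in>{0..x}. \<Sum>r<2. lcoef (\<lambda>w. FF m' w $$ (i, r)) (k - x') * lcoef (\<lambda>z. GG m z $$ (r, j)) (x - k))"
    unfolding sum_distrib_left by (subst sum.swap) (simp add: power2_eq_square mult_ac)
  finally show ?thesis .
qed

text \<open>Block index \<open>k\<close> and inner index \<open>r\<close> of the double integral
  recombine to the scalar index \<open>i = 2 k + r\<close> of \<open>limit_entry\<close>. The points
  are exchanged because \<open>limit_kernel\<close> takes the row index of the block from its second
  argument.\<close>

lemma limit_entry_kernel:
  assumes m: "0 < m" "m < N" "0 < m'" "m' < N"
    and g0: "positive_simple_closed_curve g0" "0 \<in> inside (path_image g0)" "pA \<in> outside (path_image g0)"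
    and g1: "positive_simple_closed_curve g1" "path_image g0 \<subseteq> inside (path_image g1)" "pB \<in> inside (path_image g1)"
  shows "limit_kernel a b c d \<alpha> \<beta> \<gamma> \<delta> N g0 g1 (4 * m, u) (4 * m', u') = limit_entry m' u' m u"
proof -
  let ?i = "nat (u' mod 2)" and ?j = "nat (u mod 2)" and ?x = "u div 2" and ?x' = "u' div 2"
  let ?c = "2 * of_real pi * \<i> :: complex"
  have c: "?c \<noteq> 0" by simp
  have single: "- (of_bool (m > m') / ?c) * contour_integral (circlepath 0 1) (\<lambda>z.
       (mat_powi (AA z) (int m - int m') * mat_powi (BB z) (int m - int m')) $$ (?i, ?j) * z powi (?x' - ?x) / z)
     = - of_bool (m' < m) * laurent_op (\<lambda>z. Phi z ^\<^sub>m (m - m')) u' u"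
  proof (cases "m' < m")
    case True
    show ?thesis unfolding single_integral[OF True] laurent_op_def using True c by simp
  qed simp
  have "- 1 / ?c\<^sup>2 * (- ?c\<^sup>2 * s) = s" for s using c by simp
  then have double: "- 1 / ?c\<^sup>2 * contour_integral g1 (\<lambda>w. contour_integral g0 (\<lambda>z.
            (mat_powi (AA w) (int N - int m') * mat_powi (BB w) (- int m')
              * mat_powi (AA z) (int m - int N) * mat_powi (BB z) (int m)) $$ (?i, ?j)
              * (w powi ?x' / z powi (?x + 1)) / (z - w))) =
     (\<Sum>k\<in>{0..?x}. \<Sum>r<2. lcoef (\<lambda>w. FF m' w $$ (?i, r)) (k - ?x') * lcoef (\<lambda>z. GG m z $$ (r, ?j)) (?x - k))"
    unfolding double_integral[OF m nat_mod_2_less nat_mod_2_less g0 g1] by (simp only:)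
  have pair: "(\<Sum>r<2. lcoef (\<lambda>w. FF m' w $$ (?i, r)) (k - ?x') * lcoef (\<lambda>z. GG m z $$ (r, ?j)) (?x - k)) =
    laurent_op (FF m') u' (2 * k) * laurent_op (GG m) (2 * k) u + laurent_op (FF m') u' (2 * k + 1) * laurent_op (GG m) (2 * k + 1) u" for k
    by (simp add: laurent_op_def numeral_2_eq_2)
  have "limit_entry m' u' m u = (\<Sum>k\<in>{0..?x}. \<Sum>r<2. lcoef (\<lambda>w. FF m' w $$ (?i, r)) (k - ?x') * lcoef (\<lambda>z. GG m z $$ (r, ?j)) (?x - k))
     - of_bool (m' < m) * laurent_op (\<lambda>z. Phi z ^\<^sub>m (m - m')) u' u"
    unfolding limit_entry_def sum_pairs_int pair unfolding FF_def[abs_def] GG_def[abs_def] ..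
  moreover have "limit_kernel a b c d \<alpha> \<beta> \<gamma> \<delta> N g0 g1 (4 * m, u) (4 * m', u') =
     - (of_bool (m > m') / ?c) * contour_integral (circlepath 0 1) (\<lambda>z.
       (mat_powi (AA z) (int m - int m') * mat_powi (BB z) (int m - int m')) $$ (?i, ?j) * z powi (?x' - ?x) / z)
     - 1 / ?c\<^sup>2 * contour_integral g1 (\<lambda>w. contour_integral g0 (\<lambda>z.
            (mat_powi (AA w) (int N - int m') * mat_powi (BB w) (- int m')
              * mat_powi (AA z) (int m - int N) * mat_powi (BB z) (int m)) $$ (?i, ?j)
              * (w powi ?x' / z powi (?x + 1)) / (z - w)))"
    using nat_mod_2_less by (simp add: limit_kernel_def kernel_block_def Let_def)
  ultimately show ?thesis using single double by simp
qed

end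

theorem theorem6p1:
  fixes a b c d \<alpha> \<beta> \<gamma> \<delta> :: real and N :: nat
    and g0 g1 :: "real \<Rightarrow> complex"
    and l :: nat and m :: "nat \<Rightarrow> nat" and u :: "nat \<Rightarrow> int"
  assumes "a > 0" "b > 0" "c > 0" "d > 0" "\<alpha> > 0" "\<beta> > 0" "\<gamma> > 0" "\<delta> > 0"
    and "(\<beta> * \<gamma>) / (\<alpha> * \<delta>) < 1" and "1 < (b * c) / (a * d)"
    and "N \<ge> 1"
    and "positive_simple_closed_curve g0"
    and "0 \<in> inside (path_image g0)"
    and "complex_of_real ((\<alpha> * \<delta>) / (\<beta> * \<gamma>)) \<in> outside (path_image g0)"
    and "positive_simple_closed_curve g1"
    and "path_image g0 \<subseteq> inside (path_image g1)"
    and "complex_of_real ((a * d) / (b * c)) \<in> inside (path_image g1)"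
    and "\<forall>k<l. 0 < m k \<and> m k < N"
    and "inj_on (\<lambda>k. (4 * m k, u k)) {..<l}"
  shows "(\<lambda>n. complex_of_real (measure (hexagon_measure a b c d \<alpha> \<beta> \<gamma> \<delta> N n)
              {C \<in> configurations N n. \<forall>k<l. (4 * m k, u k) \<in> C}))
           \<longlonglongrightarrow> Determinant.det (Matrix.mat l l (\<lambda>(k, k').
                 limit_kernel a b c d \<alpha> \<beta> \<gamma> \<delta> N g0 g1 (4 * m k, u k) (4 * m k', u k')))"
proof -
  interpret hexagon_gap a b c d \<alpha> \<beta> \<gamma> \<delta> N
    by unfold_locales (use assms in auto)
  let ?K = "Matrix.mat l l (\<lambda>(k, k'). limit_kernel a b c d \<alpha> \<beta> \<gamma> \<delta> N g0 g1 (4 * m k, u k) (4 * m k', u k'))"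
  \<comment> \<open>The statement uses the transpose of the usual convention for the kernel.\<close>
  have "Matrix.mat l l (\<lambda>(r, q). limit_entry (m r) (u r) (m q) (u q)) = ?K\<^sup>T"
    by (rule eq_matI) (use assms limit_entry_kernel in \<open>auto simp: pA_def pB_def\<close>)
  then have "Determinant.det (Matrix.mat l l (\<lambda>(r, q). limit_entry (m r) (u r) (m q) (u q))) = Determinant.det ?K"
    using det_transpose[of ?K l] by simp
  then show ?thesis using probability_limit[OF assms(19,18)] by simp
qed

end
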